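(* Let $\omega$ be a finite signed Radon measure on $\mathbb{R}^2$. Assume that $\int_0^1 s^{-1}M_s(\omega) \, ds < \infty$, and let $u = K\ast \omega$, so that $\mathrm{div}(u) = 0$ and $\mathrm{curl}(u) = \omega$. Then $$\frac{1}{|B_r(0)|}\int_{B_r(0)} \int_{\mathbb{R}^2} |u(x+h)-u(x)|^2\, dx \, dh \le \Vert \omega \Vert_{\mathcal{M}} \int_0^r \frac{M_s(\omega)}{s}\, ds$$ for all $r> 0$.
   Context: $\mathcal{M}$ is the space of finite signed Radon measures on $\mathbb{R}^2$ with total variation norm $\Vert\cdot\Vert_{\mathcal{M}}$. The vorticity maximal function of $\omega\in\mathcal{M}$ is $M_r(\omega) := \sup_{x\in\mathbb{R}^2} |\omega|(\overline{B}_r(x))$, where $\overline{B}_r(x)$ is the closed ball of radius $r$ around $x$ and $|\omega|$ is the variation of $\omega$. The kernel is $K(x) = \frac{1}{2\pi}\frac{x^\perp}{|x|^2}$, $x^\perp = (-x_2,x_1)$, and $u(x) = (K\ast\omega)(x) = \int_{\mathbb{R}^2} K(x-y)\,d\omega(y)$ (defined for almost every $x$). $\mathrm{div}$ and $\mathrm{curl}$ are in the sense of distributions, with $\mathrm{curl}(u)=\partial_1u_2-\partial_2u_1$. *)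

theory Defs
  imports "HOL-Analysis.Analysis"
begin

section \<open>Finite signed measures\<close>

text \<open>
  A finite signed measure is a real-valued, countably additive function on the Borel sets;
  its values on non-Borel sets are irrelevant.  On \<open>real ^ 2\<close> every finite Borel measure is
  regular (theorems \<open>inner_regular\<close> and \<open>outer_regular\<close> of \<open>HOL-Analysis.Regularity\<close>), so
  there the finite signed Radon measures are exactly these.
\<close>

definition finite_signed_measure :: "('a::topological_space set \<Rightarrow> real) \<Rightarrow> bool" where
  "finite_signed_measure \<omega> \<longleftrightarrow>
     \<omega> {} = 0 \<and>
     (\<forall>A :: nat \<Rightarrow> 'a set. range A \<subseteq> sets borel \<longrightarrow> disjoint_family A \<longrightarrow>
        (\<lambda>i. \<omega> (A i)) sums \<omega> (\<Union>i. A i))"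

text \<open>
  The variation of \<open>\<omega>\<close>: the supremum of \<open>\<Sum>i. \<bar>\<omega> (E i)\<bar>\<close> over the countable Borel
  partitions of the set.  (The set function is only a measure if \<open>\<omega>\<close> is a signed measure;
  otherwise \<^const>\<open>measure_of\<close> returns the zero measure.)
\<close>

definition variation :: "('a::topological_space set \<Rightarrow> real) \<Rightarrow> 'a measure" where
  "variation \<omega> = measure_of UNIV (sets borel)
     (\<lambda>A. SUP E \<in> {E :: nat \<Rightarrow> 'a set. range E \<subseteq> sets borel \<and> disjoint_family E \<and> (\<Union>i. E i) = A}.
        (\<Sum>i. ennreal \<bar>\<omega> (E i)\<bar>))"

definition total_variation_norm :: "('a::topological_space set \<Rightarrow> real) \<Rightarrow> ennreal" where
  "total_variation_norm \<omega> = emeasure (variation \<omega>) UNIV"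

text \<open>The Jordan decomposition \<open>\<omega>\<^sup>\<plusminus> = (\<bar>\<omega>\<bar> \<plusminus> \<omega>) / 2\<close> and the integral it induces.\<close>

definition positive_variation :: "('a::topological_space set \<Rightarrow> real) \<Rightarrow> 'a measure" where
  "positive_variation \<omega> = measure_of UNIV (sets borel)
     (\<lambda>A. ennreal ((measure (variation \<omega>) A + \<omega> A) / 2))"

definition negative_variation :: "('a::topological_space set \<Rightarrow> real) \<Rightarrow> 'a measure" where
  "negative_variation \<omega> = measure_of UNIV (sets borel)
     (\<lambda>A. ennreal ((measure (variation \<omega>) A - \<omega> A) / 2))"

definition signed_integral ::
    "('a::topological_space set \<Rightarrow> real) \<Rightarrow> ('a \<Rightarrow> 'b::{banach, second_countable_topology}) \<Rightarrow> 'b" where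
  "signed_integral \<omega> f =
     (\<integral>y. f y \<partial>positive_variation \<omega>) - (\<integral>y. f y \<partial>negative_variation \<omega>)"

definition signed_integrable ::
    "('a::topological_space set \<Rightarrow> real) \<Rightarrow> ('a \<Rightarrow> 'b::{banach, second_countable_topology}) \<Rightarrow> bool" where
  "signed_integrable \<omega> f \<longleftrightarrow> integrable (variation \<omega>) f"

section \<open>Vorticity maximal function and Biot--Savart law\<close>

definition vorticity_maximal :: "((real ^ 2) set \<Rightarrow> real) \<Rightarrow> real \<Rightarrow> ennreal" where
  "vorticity_maximal \<omega> r = (SUP x. emeasure (variation \<omega>) (cball x r))"

definition perp :: "real ^ 2 \<Rightarrow> real ^ 2" where
  "perp x = vector [- (x $ 2), x $ 1]"

text \<open>By the convention \<open>1 / 0 = 0\<close> the kernel takes the value \<open>0\<close> at the origin.\<close>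

definition biot_savart_kernel :: "real ^ 2 \<Rightarrow> real ^ 2" where
  "biot_savart_kernel x = (1 / (2 * pi)) *\<^sub>R ((1 / (norm x)\<^sup>2) *\<^sub>R perp x)"

text \<open>
  The integral exists for almost every \<open>x\<close>; on the exceptional null set the value is the
  default one of the Bochner integral.
\<close>

definition biot_savart :: "((real ^ 2) set \<Rightarrow> real) \<Rightarrow> real ^ 2 \<Rightarrow> real ^ 2" where
  "biot_savart \<omega> x = signed_integral \<omega> (\<lambda>y. biot_savart_kernel (x - y))"

section \<open>Distributional divergence and curl\<close>

definition partial_deriv :: "2 \<Rightarrow> (real ^ 2 \<Rightarrow> real) \<Rightarrow> real ^ 2 \<Rightarrow> real" where
  "partial_deriv i \<phi> x = frechet_derivative \<phi> (at x) (axis i 1)"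

primrec times_differentiable :: "nat \<Rightarrow> (real ^ 2 \<Rightarrow> real) \<Rightarrow> bool" where
  "times_differentiable 0 \<phi> \<longleftrightarrow> True"
| "times_differentiable (Suc n) \<phi> \<longleftrightarrow>
     (\<forall>x. \<phi> differentiable (at x)) \<and> (\<forall>i. times_differentiable n (partial_deriv i \<phi>))"

definition test_function :: "(real ^ 2 \<Rightarrow> real) \<Rightarrow> bool" where
  "test_function \<phi> \<longleftrightarrow> (\<forall>n. times_differentiable n \<phi>) \<and> compact (closure {x. \<phi> x \<noteq> 0})"

definition locally_integrable :: "(real ^ 2 \<Rightarrow> real ^ 2) \<Rightarrow> bool" where
  "locally_integrable u \<longleftrightarrow> (\<forall>C. compact C \<longrightarrow> set_integrable lborel C u)"

text \<open>The pairings \<open>\<langle>div u, \<phi>\<rangle>\<close> and \<open>\<langle>\<partial>\<^sub>1 u\<^sub>2 - \<partial>\<^sub>2 u\<^sub>1, \<phi>\<rangle>\<close> for a locally integrable field \<open>u\<close>.\<close>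

definition distr_div :: "(real ^ 2 \<Rightarrow> real ^ 2) \<Rightarrow> (real ^ 2 \<Rightarrow> real) \<Rightarrow> real" where
  "distr_div u \<phi> =
     - (\<integral>x. u x $ 1 * partial_deriv 1 \<phi> x + u x $ 2 * partial_deriv 2 \<phi> x \<partial>lborel)"

definition distr_curl :: "(real ^ 2 \<Rightarrow> real ^ 2) \<Rightarrow> (real ^ 2 \<Rightarrow> real) \<Rightarrow> real" where
  "distr_curl u \<phi> =
     - (\<integral>x. u x $ 2 * partial_deriv 1 \<phi> x - u x $ 1 * partial_deriv 2 \<phi> x \<partial>lborel)"

end

theory Submission
  imports Defs "HOL-Complex_Analysis.Cauchy_Integral_Formula" "HOL-Real_Asymp.Real_Asymp"
begin

text \<open>
  Let \<open>K\<close> be the kernel and \<open>\<mu> = \<bar>\<omega>\<bar>\<close>.  Averaging \<open>\<bar>u(x + h) - u(x)\<bar>\<^sup>2 = \<bar>u(x + h)\<bar>\<^sup>2 - \<bar>u(x)\<bar>\<^sup>2 + 2 u(x) \<bullet> (u(x) - u(x + h))\<close>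
  over \<open>h \<in> B\<^sub>r\<close> and integrating in \<open>x\<close> leaves twice the pairing of \<open>u = K * \<omega>\<close> with \<open>k * \<omega>\<close>, where \<open>k\<close> is \<open>K\<close> minus its average
  over balls of radius \<open>r\<close>.  By Newton's shell theorem \<open>k(x) = K(x) (1 - \<bar>x\<bar>\<^sup>2 / r\<^sup>2)\<^sub>+\<close>, and averaging over
  rotations shows that \<open>\<integral> K(x - y) \<bullet> k(x - z) dx\<close> is at most the integral of \<open>1 / (4 \<pi>\<^sup>2 \<bar>x\<bar>\<^sup>2)\<close> over the annulus
  \<open>\<bar>y - z\<bar> \<le> \<bar>x\<bar> < r\<close>.  Integrating against \<open>\<mu> \<otimes> \<mu>\<close> gives the estimate, with the factor \<open>1 / \<pi>\<close> to spare.
  Since \<open>u\<close> need not be square integrable at infinity, this is carried out for \<open>K\<close> cut off at \<open>\<bar>x\<bar> < R\<close>,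
  and \<open>R \<rightarrow> \<infinity>\<close> by Fatou's lemma.

  Both averages reduce to the circle mean of \<open>1 / (w + a e\<^sup>i\<^sup>\<theta>)\<close>, which Cauchy's formula evaluates.
  For the divergence, \<open>K(x) \<bullet> \<nabla>\<phi>(x + y)\<close> has mean zero on each circle around the origin; for the curl,
  \<open>\<integral> x \<bullet> \<nabla>\<phi>(x + y) / \<bar>x\<bar>\<^sup>2 dx\<close> is evaluated by integrating \<open>\<nabla>\<phi>\<close> along the rays from \<open>y\<close>.
\<close>

section \<open>The variation of a finite signed measure\<close>

text \<open>The signed measure is a bare set function, so finiteness of its variation has to be
  proved before the Jordan halves make sense. Their densities p and n combine to \<sigma> = p - n
  with |\<sigma>| \<le> 1; from there on only a positive measure \<mu> and this bound are used. The
  cutoff at R makes K integrable, and the condition on the maximal function then makes the truncated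
  velocity square integrable, so that squares may be subtracted. The price is that the shell theorem
  holds only while the ball of radius r stays inside the cutoff. For fixed r, the resulting error is
  of order R^(-1/2) uniformly in the two vorticity points y and z, hence integrating it against
  \<mu> \<times> \<mu> costs only the square of the total mass. Origin of the constants: the
  averages are not normalised, so the pairing is bounded by r^2 / (4 \<pi>) times the annulus
  integral of 1 / |x|^2. Integrating that against \<mu> gives 2 \<pi> times the integral of the
  maximal function, and the identity for averaged differences contributes 2. The product is r^2, and
  dividing by the area \<pi> r^2 leaves 1 / \<pi>.\<close>

definition borel_partitions :: "'a::topological_space set \<Rightarrow> (nat \<Rightarrow> 'a set) set" where
  "borel_partitions A = {E. range E \<subseteq> sets borel \<and> disjoint_family E \<and> (\<Union>i. E i) = A}"

definition variation_fun :: "('a::topological_space set \<Rightarrow> real) \<Rightarrow> 'a set \<Rightarrow> ennreal" where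
  "variation_fun \<omega> A = (SUP E \<in> borel_partitions A. \<Sum>i. ennreal \<bar>\<omega> (E i)\<bar>)"

lemma variation_alt: "variation \<omega> = measure_of UNIV (sets borel) (variation_fun \<omega>)"
  unfolding variation_def variation_fun_def borel_partitions_def by simp

lemma suminf_swap_ennreal:
  fixes f :: "nat \<Rightarrow> nat \<Rightarrow> ennreal"
  shows "(\<Sum>i. \<Sum>j. f i j) = (\<Sum>j. \<Sum>i. f i j)"
proof -
  have "(\<Sum>i. \<integral>\<^sup>+j. f i j \<partial>count_space UNIV) = (\<integral>\<^sup>+j. (\<Sum>i. f i j) \<partial>count_space UNIV)"
    by (rule nn_integral_suminf[symmetric]) simp
  then show ?thesis
    unfolding nn_integral_count_space_nat .
qed

text \<open>On \<open>{q > 1}\<close> the excess \<open>q - 1\<close> of the Radon-Nikodym density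
  integrates to zero, because \<open>P\<close> is at most \<open>M\<close> there and
  \<open>M\<close> is finite. Clipping at 1 turns the bound that holds almost everywhere into one
  that holds at every point.\<close>

lemma (in finite_measure) dominated_density:
  assumes P: "sets P = sets M" "\<And>A. A \<in> sets M \<Longrightarrow> emeasure P A \<le> emeasure M A"
  shows "\<exists>p\<in>borel_measurable M. (\<forall>y. 0 \<le> p y \<and> p y \<le> 1) \<and> P = density M (\<lambda>x. ennreal (p x))"
proof -
  have "absolutely_continuous M P"
    unfolding absolutely_continuous_def
  proof
    fix A assume "A \<in> null_sets M"
    then show "A \<in> null_sets P" using P(1) P(2)[of A] by (auto simp: null_sets_def)
  qed
  then obtain q where q [measurable]: "q \<in> borel_measurable M" and q_dens: "density M q = P"
    using Radon_Nikodym[of P] P by auto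
  have AE1: "AE x in M. q x \<le> 1"
  proof -
    define B where "B = {x \<in> space M. q x > 1}"
    have B [measurable]: "B \<in> sets M" unfolding B_def by measurable
    have "(\<integral>\<^sup>+x. indicator B x \<partial>M) + (\<integral>\<^sup>+x. (q x - 1) * indicator B x \<partial>M) =
        (\<integral>\<^sup>+x. indicator B x + (q x - 1) * indicator B x \<partial>M)"
      by (rule nn_integral_add[symmetric]) auto
    also have "\<dots> = (\<integral>\<^sup>+x. q x * indicator B x \<partial>M)"
      by (intro nn_integral_cong) (auto simp: B_def indicator_def)
    also have "\<dots> = emeasure P B"
      using B by (simp add: q_dens[symmetric] emeasure_density)
    also have "\<dots> \<le> emeasure M B" using P(2) B by simp
    also have "\<dots> = (\<integral>\<^sup>+x. indicator B x \<partial>M)" by simp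
    finally have "emeasure M B + (\<integral>\<^sup>+x. (q x - 1) * indicator B x \<partial>M) \<le> emeasure M B + 0"
      by simp
    then have "(\<integral>\<^sup>+x. (q x - 1) * indicator B x \<partial>M) = 0"
      using emeasure_finite[of B] by (metis ennreal_add_left_cancel_le infinity_ennreal_def le_zero_eq)
    then have "AE x in M. (q x - 1) * indicator B x = 0"
      by (subst (asm) nn_integral_0_iff_AE) auto
    then show ?thesis
      using AE_space
      by eventually_elim (auto simp: B_def indicator_def diff_eq_0_iff_ennreal split: if_splits)
  qed
  have "density M q = density M (\<lambda>x. ennreal (enn2real (min 1 (q x))))"
  proof (intro density_cong)
    show "AE x in M. q x = ennreal (enn2real (min 1 (q x)))"
      using AE1 by eventually_elim (auto simp: min_absorb2 ennreal_enn2real_if top_unique)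
  qed auto
  moreover have "enn2real (min 1 (q y)) \<le> 1" for y
    by (metis enn2real_1 enn2real_mono ennreal_one_less_top min.cobounded1)
  ultimately show ?thesis
    using q_dens by (intro bexI[of _ "\<lambda>x. enn2real (min 1 (q x))"]) auto
qed

locale signed_measure =
  fixes \<omega> :: "'a::topological_space set \<Rightarrow> real"
  assumes signed: "finite_signed_measure \<omega>"
begin

lemma empty [simp]: "\<omega> {} = 0"
  using signed by (simp add: finite_signed_measure_def)

lemma sums_Union:
  "range A \<subseteq> sets borel \<Longrightarrow> disjoint_family A \<Longrightarrow> (\<lambda>i. \<omega> (A i)) sums \<omega> (\<Union>i. A i)"
  using signed by (simp add: finite_signed_measure_def)

lemma additive:
  assumes "A \<in> sets borel" "B \<in> sets borel" "A \<inter> B = {}"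
  shows "\<omega> (A \<union> B) = \<omega> A + \<omega> B"
proof -
  have "(\<lambda>i. \<omega> (binaryset A B i)) sums \<omega> (\<Union>i. binaryset A B i)"
    using assms by (intro sums_Union) (auto simp: binaryset_def disjoint_family_on_def)
  moreover have "(\<lambda>i. \<omega> (binaryset A B i)) sums (\<omega> A + \<omega> B)"
    by (rule binaryset_sums) simp
  ultimately show ?thesis
    by (simp add: UN_binaryset_eq sums_unique2)
qed

lemma diff:
  assumes "A \<in> sets borel" "B \<in> sets borel" "A \<subseteq> B"
  shows "\<omega> (B - A) = \<omega> B - \<omega> A"
  using additive[of A "B - A"] assms by (simp add: Un_absorb1)

lemma finite_additive:
  assumes "finite I" "\<And>i. i \<in> I \<Longrightarrow> A i \<in> sets borel" "disjoint_family_on A I"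
  shows "\<omega> (\<Union>i\<in>I. A i) = (\<Sum>i\<in>I. \<omega> (A i))"
  using assms
proof (induction I)
  case (insert i I)
  have "\<omega> (A i \<union> (\<Union>j\<in>I. A j)) = \<omega> (A i) + \<omega> (\<Union>j\<in>I. A j)"
    using insert.prems insert.hyps
    by (intro additive) (auto simp: disjoint_family_on_def intro!: sets.finite_UN)
  then show ?case
    using insert.IH insert.prems insert.hyps
    by (simp add: disjoint_family_on_def)
qed simp

lemma binaryset_partition:
  "A \<in> sets borel \<Longrightarrow> binaryset A {} \<in> borel_partitions A"
  by (auto simp: borel_partitions_def disjoint_family_on_def UN_binaryset_eq binaryset_def)

lemma borel_partitions_nonempty: "A \<in> sets borel \<Longrightarrow> borel_partitions A \<noteq> {}"
  using binaryset_partition by blast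

lemma abs_le_variation_fun: "A \<in> sets borel \<Longrightarrow> ennreal \<bar>\<omega> A\<bar> \<le> variation_fun \<omega> A"
proof -
  assume A: "A \<in> sets borel"
  have "(\<Sum>i. ennreal \<bar>\<omega> (binaryset A {} i)\<bar>) = ennreal \<bar>\<omega> A\<bar>"
    using binaryset_sums[of "\<lambda>X. ennreal \<bar>\<omega> X\<bar>" A "{}"] by (simp add: sums_unique[symmetric])
  moreover have "binaryset A {} \<in> borel_partitions A"
    using A by (rule binaryset_partition)
  ultimately show ?thesis
    unfolding variation_fun_def by (metis SUP_upper)
qed

lemma variation_fun_empty: "variation_fun \<omega> {} = 0"
  proof -
  have "(\<Sum>i. ennreal \<bar>\<omega> (E i)\<bar>) = 0" if "E \<in> borel_partitions {}" for E
  proof -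
    have "E i = {}" for i using that by (auto simp: borel_partitions_def)
    then show ?thesis by simp
  qed
  then have "variation_fun \<omega> {} \<le> 0"
    unfolding variation_fun_def by (intro SUP_least) (simp only: order_refl)
  then show ?thesis by simp
qed

lemma variation_fun_superadditive:
  assumes "A \<in> sets borel" "B \<in> sets borel" "A \<inter> B = {}"
  shows "variation_fun \<omega> A + variation_fun \<omega> B \<le> variation_fun \<omega> (A \<union> B)"
proof -
  have "(\<Sum>i. ennreal \<bar>\<omega> (E i)\<bar>) + (\<Sum>i. ennreal \<bar>\<omega> (F i)\<bar>) \<le> variation_fun \<omega> (A \<union> B)"
    if E: "E \<in> borel_partitions A" and F: "F \<in> borel_partitions B" for E F
  proof -
    \<comment> \<open>The two partitions are interleaved, so that the first \<open>2 * n\<close>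
      terms of the joint series are the first \<open>n\<close> terms of both.\<close>
    define G where "G n = (if even n then E (n div 2) else F (n div 2))" for n
    have G [simp]: "G (2 * n) = E n" "G (Suc (2 * n)) = F n" for n
      by (auto simp: G_def)
    have "(\<Sum>i. ennreal \<bar>\<omega> (E i)\<bar>) + (\<Sum>i. ennreal \<bar>\<omega> (F i)\<bar>) =
        (\<Sum>i. ennreal \<bar>\<omega> (E i)\<bar> + ennreal \<bar>\<omega> (F i)\<bar>)"
      by (intro suminf_add) auto
    also have "\<dots> \<le> (\<Sum>i. ennreal \<bar>\<omega> (G i)\<bar>)"
    proof (intro suminf_le_const)
      fix n
      have "(\<Sum>i<n. ennreal \<bar>\<omega> (E i)\<bar> + ennreal \<bar>\<omega> (F i)\<bar>) = (\<Sum>i<2*n. ennreal \<bar>\<omega> (G i)\<bar>)"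
        by (induction n) (simp_all add: add.assoc del: ennreal_plus sum_ennreal)
      also have "\<dots> \<le> (\<Sum>i. ennreal \<bar>\<omega> (G i)\<bar>)"
        by (intro sum_le_suminf) auto
      finally show "(\<Sum>i<n. ennreal \<bar>\<omega> (E i)\<bar> + ennreal \<bar>\<omega> (F i)\<bar>) \<le> (\<Sum>i. ennreal \<bar>\<omega> (G i)\<bar>)" .
    qed auto
    also have "G \<in> borel_partitions (A \<union> B)"
    proof -
      have "(\<Union>n. G n) = (\<Union>n. E n) \<union> (\<Union>n. F n)"
      proof (intro equalityI subsetI)
        fix x assume "x \<in> (\<Union>n. G n)"
        then show "x \<in> (\<Union>n. E n) \<union> (\<Union>n. F n)" by (auto simp: G_def split: if_splits)
      next
        fix x assume "x \<in> (\<Union>n. E n) \<union> (\<Union>n. F n)"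
        then obtain n where "x \<in> G (2 * n) \<or> x \<in> G (Suc (2 * n))" by (auto simp: G)
        then show "x \<in> (\<Union>n. G n)" by blast
      qed
      moreover have "G m \<inter> G n = {}" if "m \<noteq> n" for m n
      proof -
        have "E i \<inter> F j = {}" for i j
          using E F assms(3) by (auto simp: borel_partitions_def)
        moreover have "E i \<inter> E j = {}" "F i \<inter> F j = {}" if "i \<noteq> j" for i j
          using E F that by (auto simp: borel_partitions_def disjoint_family_on_def)
        moreover have "m div 2 \<noteq> n div 2" if "even m = even n"
          using that \<open>m \<noteq> n\<close> by presburger
        ultimately show ?thesis
          unfolding G_def by (auto simp: disjoint_iff split: if_splits)
      qed
      ultimately show ?thesis
        using E F by (auto simp: borel_partitions_def disjoint_family_on_def G_def)
    qed
    then have "(\<Sum>i. ennreal \<bar>\<omega> (G i)\<bar>) \<le> variation_fun \<omega> (A \<union> B)"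
      unfolding variation_fun_def by (rule SUP_upper)
    finally show ?thesis .
  qed
  note le = this
  have "(SUP E\<in>borel_partitions A. \<Sum>i. ennreal \<bar>\<omega> (E i)\<bar>) + (\<Sum>i. ennreal \<bar>\<omega> (F i)\<bar>)
      \<le> variation_fun \<omega> (A \<union> B)" if "F \<in> borel_partitions B" for F
    unfolding ennreal_SUP_add_left[OF borel_partitions_nonempty[OF assms(1)], symmetric]
    by (intro SUP_least le that)
  then have "(SUP E\<in>borel_partitions A. \<Sum>i. ennreal \<bar>\<omega> (E i)\<bar>) + (SUP F\<in>borel_partitions B. \<Sum>i. ennreal \<bar>\<omega> (F i)\<bar>)
      \<le> variation_fun \<omega> (A \<union> B)"
    unfolding ennreal_SUP_add_right[OF borel_partitions_nonempty[OF assms(2)]]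
    by (intro SUP_least)
  then show ?thesis
    by (simp only: variation_fun_def)
qed

text \<open>A partition \<open>E\<close> of the union is refined to the cells
  \<open>E j \<inter> A i\<close>. The triangle inequality for the series over \<open>i\<close> and
  an interchange of the two sums give the bound.\<close>

lemma variation_fun_countably_subadditive:
  assumes A: "range A \<subseteq> sets borel" "disjoint_family A"
  shows "variation_fun \<omega> (\<Union>i. A i) \<le> (\<Sum>i. variation_fun \<omega> (A i))"
  unfolding variation_fun_def[of _ "\<Union>i. A i"]
proof (rule SUP_least)
  fix E assume E: "E \<in> borel_partitions (\<Union>i. A i)"
  have "(\<Sum>j. ennreal \<bar>\<omega> (E j)\<bar>) \<le> (\<Sum>j. \<Sum>i. ennreal \<bar>\<omega> (E j \<inter> A i)\<bar>)"
  proof (intro suminf_le)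
    fix j
    have "(\<lambda>i. \<omega> (E j \<inter> A i)) sums \<omega> (\<Union>i. E j \<inter> A i)"
      using A E by (intro sums_Union) (auto simp: borel_partitions_def disjoint_family_on_def disjoint_iff)
    moreover have "(\<Union>i. E j \<inter> A i) = E j"
      using E by (auto simp: borel_partitions_def)
    ultimately have s: "(\<lambda>i. \<omega> (E j \<inter> A i)) sums \<omega> (E j)" by simp
    show "ennreal \<bar>\<omega> (E j)\<bar> \<le> (\<Sum>i. ennreal \<bar>\<omega> (E j \<inter> A i)\<bar>)"
    \<comment> \<open>The triangle inequality for series requires absolute convergence; without it
      the right-hand side is infinite.\<close>
    proof (cases "summable (\<lambda>i. \<bar>\<omega> (E j \<inter> A i)\<bar>)")
      case True
      then have "\<bar>\<omega> (E j)\<bar> \<le> (\<Sum>i. \<bar>\<omega> (E j \<inter> A i)\<bar>)"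
        using summable_rabs[OF True] s by (simp add: sums_iff)
      then show ?thesis
        using True by (simp add: suminf_ennreal2 ennreal_leI)
    next
      case False
      then have "(\<Sum>i. ennreal \<bar>\<omega> (E j \<inter> A i)\<bar>) = \<infinity>"
        by (metis abs_ge_zero infinity_ennreal_def summable_suminf_not_top)
      then show ?thesis by simp
    qed
  qed auto
  also have "\<dots> = (\<Sum>i. \<Sum>j. ennreal \<bar>\<omega> (E j \<inter> A i)\<bar>)"
    by (rule suminf_swap_ennreal)
  also have "\<dots> \<le> (\<Sum>i. variation_fun \<omega> (A i))"
  proof (intro suminf_le)
    fix i
    have "(\<lambda>j. E j \<inter> A i) \<in> borel_partitions (A i)"
      using A E by (auto simp: borel_partitions_def disjoint_family_on_def disjoint_iff)
    then show "(\<Sum>j. ennreal \<bar>\<omega> (E j \<inter> A i)\<bar>) \<le> variation_fun \<omega> (A i)"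
      unfolding variation_fun_def by (rule SUP_upper2) simp
  qed auto
  finally show "(\<Sum>j. ennreal \<bar>\<omega> (E j)\<bar>) \<le> (\<Sum>i. variation_fun \<omega> (A i))" .
qed

lemma variation_fun_mono:
  assumes "A \<subseteq> B" "A \<in> sets borel" "B \<in> sets borel"
  shows "variation_fun \<omega> A \<le> variation_fun \<omega> B"
proof -
  have "variation_fun \<omega> A \<le> variation_fun \<omega> A + variation_fun \<omega> (B - A)" by simp
  also have "\<dots> \<le> variation_fun \<omega> (A \<union> (B - A))"
    by (rule variation_fun_superadditive) (use assms in auto)
  also have "A \<union> (B - A) = B" using assms by auto
  finally show ?thesis .
qed

text \<open>One inequality is superadditivity on finite unions followed by monotonicity and a limit;
  the other is countable subadditivity.\<close>

lemma measure_space_variation: "measure_space UNIV (sets borel) (variation_fun \<omega>)"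
  unfolding measure_space_def
proof (intro conjI)
  show "sigma_algebra UNIV (sets borel :: 'a set set)"
    using sets.sigma_algebra_axioms[of "borel :: 'a measure"] by simp
  show "positive (sets borel) (variation_fun \<omega>)"
    by (simp add: positive_def variation_fun_empty)
  show "countably_additive (sets borel) (variation_fun \<omega>)"
    unfolding countably_additive_def
  proof (intro allI impI antisym)
    fix A :: "nat \<Rightarrow> 'a set"
    assume A: "range A \<subseteq> sets borel" "disjoint_family A" "(\<Union>i. A i) \<in> sets borel"
    have "(\<Sum>i<n. variation_fun \<omega> (A i)) \<le> variation_fun \<omega> (\<Union>i<n. A i)" for n
    proof (induction n)
      case (Suc n)
      have "(\<Sum>i<Suc n. variation_fun \<omega> (A i)) \<le> variation_fun \<omega> (\<Union>i<n. A i) + variation_fun \<omega> (A n)"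
        using Suc by (simp add: add_mono)
      also have "\<dots> \<le> variation_fun \<omega> ((\<Union>i<n. A i) \<union> A n)"
        using A by (intro variation_fun_superadditive) (auto simp: disjoint_family_on_def disjoint_iff dest: less_imp_neq)
      also have "(\<Union>i<n. A i) \<union> A n = (\<Union>i<Suc n. A i)"
        by (auto simp: less_Suc_eq)
      finally show ?case .
    qed (simp add: variation_fun_empty)
    also have "variation_fun \<omega> (\<Union>i<n. A i) \<le> variation_fun \<omega> (\<Union>i. A i)" for n
      using A by (intro variation_fun_mono) auto
    finally show "(\<Sum>i. variation_fun \<omega> (A i)) \<le> variation_fun \<omega> (\<Union>i. A i)"
      by (intro suminf_le_const) auto
    show "variation_fun \<omega> (\<Union>i. A i) \<le> (\<Sum>i. variation_fun \<omega> (A i))"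
      using A by (intro variation_fun_countably_subadditive)
  qed
qed

lemma sets_variation [simp, measurable_cong]: "sets (variation \<omega>) = sets borel"
  and space_variation [simp]: "space (variation \<omega>) = UNIV"
  by (simp_all add: variation_alt sets.sigma_sets_eq[of borel, simplified])

lemma emeasure_variation: "A \<in> sets borel \<Longrightarrow> emeasure (variation \<omega>) A = variation_fun \<omega> A"
  using measure_space_variation unfolding variation_alt measure_space_def
  by (subst emeasure_measure_of_sigma) auto

section \<open>Finiteness of the variation\<close>

text \<open>Finitely many cells of some partition have absolute values summing to more than
  \<open>t\<close>. Grouping them by sign leaves one group \<open>B\<close> with |\<omega> B| > t /
  2 = 1 + |\<omega> E|, and additivity gives |\<omega> (E - B)| > 1 as well. The variation is
  infinite on \<open>B\<close> or on \<open>E - B\<close>; the other of the two is the piece to cut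
  off.\<close>

lemma large_subset:
  assumes E: "E \<in> sets borel" and inf: "variation_fun \<omega> E = \<infinity>"
  shows "\<exists>A\<in>sets borel. A \<subseteq> E \<and> \<bar>\<omega> A\<bar> > 1 \<and> variation_fun \<omega> (E - A) = \<infinity>"
proof -
  define t where "t = 2 * (1 + \<bar>\<omega> E\<bar>)"
  have "ennreal t < variation_fun \<omega> E" by (simp add: inf)
  then obtain P where P: "P \<in> borel_partitions E" and "ennreal t < (\<Sum>i. ennreal \<bar>\<omega> (P i)\<bar>)"
    unfolding variation_fun_def less_SUP_iff by auto
  then obtain n where n: "ennreal t < (\<Sum>i<n. ennreal \<bar>\<omega> (P i)\<bar>)"
    by (auto simp: suminf_eq_SUP less_SUP_iff)
  then have n: "t < (\<Sum>i<n. \<bar>\<omega> (P i)\<bar>)"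
    by (simp add: sum_nonneg ennreal_less_iff t_def del: ennreal_plus)
  have Pb: "P i \<in> sets borel" "P i \<subseteq> E" for i
    using P by (auto simp: borel_partitions_def)
  have disj: "disjoint_family_on P I" for I
    using P by (auto simp: borel_partitions_def disjoint_family_on_def)
  define I J where "I = {i. i < n \<and> \<omega> (P i) \<ge> 0}" and "J = {i. i < n \<and> \<omega> (P i) < 0}"
  have IJ: "finite I" "finite J" "I \<inter> J = {}" "{..<n} = I \<union> J"
    by (auto simp: I_def J_def)
  have "(\<Sum>i<n. \<bar>\<omega> (P i)\<bar>) = (\<Sum>i\<in>I. \<bar>\<omega> (P i)\<bar>) + (\<Sum>i\<in>J. \<bar>\<omega> (P i)\<bar>)"
    using IJ by (simp add: sum.union_disjoint)
  also have "(\<Sum>i\<in>I. \<bar>\<omega> (P i)\<bar>) = \<omega> (\<Union>i\<in>I. P i)"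
    using Pb disj IJ by (subst finite_additive) (auto simp: I_def)
  also have "(\<Sum>i\<in>J. \<bar>\<omega> (P i)\<bar>) = - \<omega> (\<Union>i\<in>J. P i)"
    using Pb disj IJ by (subst finite_additive) (auto simp: J_def sum_negf[symmetric] intro!: sum.cong)
  finally have "\<bar>\<omega> (\<Union>i\<in>I. P i)\<bar> > t / 2 \<or> \<bar>\<omega> (\<Union>i\<in>J. P i)\<bar> > t / 2"
    using n by linarith
  then obtain B where B: "B \<in> sets borel" "B \<subseteq> E" "\<bar>\<omega> B\<bar> > 1 + \<bar>\<omega> E\<bar>"
  proof (elim disjE)
    assume "\<bar>\<omega> (\<Union>i\<in>I. P i)\<bar> > t / 2"
    then show ?thesis using Pb IJ by (intro that[of "\<Union>i\<in>I. P i"]) (auto simp: t_def)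
  next
    assume "\<bar>\<omega> (\<Union>i\<in>J. P i)\<bar> > t / 2"
    then show ?thesis using Pb IJ by (intro that[of "\<Union>i\<in>J. P i"]) (auto simp: t_def)
  qed
  have C: "\<bar>\<omega> (E - B)\<bar> > 1" "E - B \<in> sets borel"
    using B E diff[of B E] by auto
  have "variation_fun \<omega> E = variation_fun \<omega> B + variation_fun \<omega> (E - B)"
    using plus_emeasure[of B "variation \<omega>" "E - B"] B E C
    by (simp add: emeasure_variation Un_absorb1)
  then consider "variation_fun \<omega> B = \<infinity>" | "variation_fun \<omega> (E - B) = \<infinity>"
    using inf by (metis ennreal_add_eq_top infinity_ennreal_def)
  then show ?thesis
  proof cases
    case 1
    moreover have "E - (E - B) = B" using B by auto
    ultimately show ?thesis using C by (intro bexI[of _ "E - B"]) auto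
  next
    case 2
    then show ?thesis using B by (intro bexI[of _ B]) auto
  qed
qed

text \<open>If the variation were infinite, large pieces could be cut off for ever,
  \<open>F n\<close> being what is left after \<open>n\<close> cuts. The pieces are disjoint and
  their values exceed 1 in modulus, yet countable additivity makes these values a convergent
  series.\<close>

lemma finite_measure_variation: "finite_measure (variation \<omega>)"
proof (rule ccontr)
  assume "\<not> ?thesis"
  then have inf: "variation_fun \<omega> UNIV = \<infinity>"
    using finite_measureI[of "variation \<omega>"] by (auto simp: emeasure_variation)
  let ?Q = "\<lambda>E. E \<in> sets borel \<and> variation_fun \<omega> E = \<infinity>"
  have "\<exists>F. \<forall>n. ?Q (F n) \<and> (F (Suc n) \<subseteq> F n \<and> \<bar>\<omega> (F n - F (Suc n))\<bar> > 1)"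
  proof (rule dependent_nat_choice)
    show "\<exists>E. ?Q E" using inf by (intro exI[of _ UNIV]) auto
    fix E and n :: nat assume E: "?Q E"
    then obtain A where A: "A\<in>sets borel" "A \<subseteq> E" "\<bar>\<omega> A\<bar> > 1" "variation_fun \<omega> (E - A) = \<infinity>"
      using large_subset[of E] by auto
    moreover have "E - (E - A) = A" using A by auto
    ultimately show "\<exists>B. ?Q B \<and> (B \<subseteq> E \<and> \<bar>\<omega> (E - B)\<bar> > 1)"
      using E by (intro exI[of _ "E - A"]) auto
  qed
  then obtain F where F: "\<And>n. F n \<in> sets borel" "\<And>n. F (Suc n) \<subseteq> F n"
      "\<And>n. \<bar>\<omega> (F n - F (Suc n))\<bar> > 1"
    by auto
  have "antimono F" using F(2) by (rule antimono_iff_le_Suc[THEN iffD2, rule_format])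
  then have disj: "disjoint_family (\<lambda>n. F n - F (Suc n))"
    unfolding disjoint_family_on_def
  proof (intro ballI impI)
    fix m n :: nat assume "m \<noteq> n"
    then consider "Suc m \<le> n" | "Suc n \<le> m" by linarith
    then show "(F m - F (Suc m)) \<inter> (F n - F (Suc n)) = {}"
      using \<open>antimono F\<close> by cases (auto dest: antimonoD)
  qed
  have "(\<lambda>n. \<omega> (F n - F (Suc n))) sums \<omega> (\<Union>n. F n - F (Suc n))"
    using F disj by (intro sums_Union) auto
  then have "(\<lambda>n. \<omega> (F n - F (Suc n))) \<longlonglongrightarrow> 0"
    using summable_LIMSEQ_zero sums_summable by blast
  then have "eventually (\<lambda>n. \<bar>\<omega> (F n - F (Suc n))\<bar> < 1) sequentially"
    using order_tendstoD(2)[OF tendsto_rabs_zero, of _ _ 1] by auto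
  then show False
    using F(3) by (metis (mono_tags, lifting) eventually_sequentially less_asym order_refl)
qed


lemma abs_le_measure_variation: "A \<in> sets borel \<Longrightarrow> \<bar>\<omega> A\<bar> \<le> measure (variation \<omega>) A"
  using abs_le_variation_fun[of A] finite_measure.emeasure_eq_measure[OF finite_measure_variation, of A]
  by (simp add: emeasure_variation)

lemma sums_measure_variation:
  assumes "range A \<subseteq> sets borel" "disjoint_family A"
  shows "(\<lambda>i. measure (variation \<omega>) (A i)) sums measure (variation \<omega>) (\<Union>i. A i)"
  using assms by (intro finite_measure.finite_measure_UNION[OF finite_measure_variation]) auto

section \<open>The Jordan halves and their densities\<close>

text \<open>The cases \<open>c = 1\<close> and \<open>c = - 1\<close> are the two Jordan halves.
  Nonnegativity, without which \<open>ennreal\<close> would truncate and destroy additivity, is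
  |\<omega> A| \<le> \<open>measure (variation \<omega>) A\<close>.\<close>

lemma emeasure_half_variation:
  fixes c :: real
  assumes c: "\<bar>c\<bar> = 1" and A: "A \<in> sets borel"
  shows "emeasure (measure_of UNIV (sets borel) (\<lambda>A. ennreal ((measure (variation \<omega>) A + c * \<omega> A) / 2))) A =
    ennreal ((measure (variation \<omega>) A + c * \<omega> A) / 2)"
proof (rule emeasure_measure_of_sigma)
  let ?f = "\<lambda>A. (measure (variation \<omega>) A + c * \<omega> A) / 2"
  have nonneg: "0 \<le> ?f A" if "A \<in> sets borel" for A
    using abs_le_measure_variation[OF that] c by (auto simp: abs_if split: if_splits)
  show "sigma_algebra UNIV (sets borel :: 'a set set)"
    using sets.sigma_algebra_axioms[of "borel :: 'a measure"] by simp
  show "positive (sets borel) (\<lambda>A. ennreal (?f A))"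
    by (simp add: positive_def)
  show "countably_additive (sets borel) (\<lambda>A. ennreal (?f A))"
    unfolding countably_additive_def
  proof (intro allI impI)
    fix A :: "nat \<Rightarrow> 'a set"
    assume A: "range A \<subseteq> sets borel" "disjoint_family A"
    have "(\<lambda>i. ?f (A i)) sums ?f (\<Union>i. A i)"
      by (intro sums_divide sums_add sums_mult sums_measure_variation sums_Union A)
    moreover have "0 \<le> ?f (A i)" for i using nonneg A by auto
    ultimately show "(\<Sum>i. ennreal (?f (A i))) = ennreal (?f (\<Union>i. A i))"
      by (intro suminf_ennreal_eq)
  qed
qed (use A in auto)

lemma emeasure_positive_variation:
  "A \<in> sets borel \<Longrightarrow> emeasure (positive_variation \<omega>) A = ennreal ((measure (variation \<omega>) A + \<omega> A) / 2)"
  using emeasure_half_variation[of 1 A] by (simp add: positive_variation_def)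

lemma emeasure_negative_variation:
  "A \<in> sets borel \<Longrightarrow> emeasure (negative_variation \<omega>) A = ennreal ((measure (variation \<omega>) A - \<omega> A) / 2)"
  using emeasure_half_variation[of "-1" A] by (simp add: negative_variation_def)

lemma sets_half_variations [simp, measurable_cong]:
  "sets (positive_variation \<omega>) = sets borel" "sets (negative_variation \<omega>) = sets borel"
  by (simp_all add: positive_variation_def negative_variation_def sets.sigma_sets_eq[of borel, simplified])

text \<open>The bound |\<omega> A| \<le> \<open>measure (variation \<omega>) A\<close> also shows
  that each half is at most the whole variation, so that \<open>dominated_density\<close> applies to
  both.\<close>

lemma half_variation_densities:
  obtains p n :: "'a \<Rightarrow> real" where
    "p \<in> borel_measurable borel" "\<And>y. 0 \<le> p y" "\<And>y. p y \<le> 1"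
    "positive_variation \<omega> = density (variation \<omega>) (\<lambda>x. ennreal (p x))"
    "n \<in> borel_measurable borel" "\<And>y. 0 \<le> n y" "\<And>y. n y \<le> 1"
    "negative_variation \<omega> = density (variation \<omega>) (\<lambda>x. ennreal (n x))"
proof -
  note V = finite_measure.emeasure_eq_measure[OF finite_measure_variation]
  obtain p where p [measurable]: "p \<in> borel_measurable borel" and p01: "\<And>y. 0 \<le> p y" "\<And>y. p y \<le> 1"
    and P: "positive_variation \<omega> = density (variation \<omega>) (\<lambda>x. ennreal (p x))"
  proof -
    have "emeasure (positive_variation \<omega>) A \<le> emeasure (variation \<omega>) A" if "A \<in> sets borel" for A
      using abs_le_measure_variation[OF that]
      by (simp add: emeasure_positive_variation that V)
    then have "\<exists>p\<in>borel_measurable borel. (\<forall>y. 0 \<le> p y \<and> p y \<le> 1) \<and>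
        positive_variation \<omega> = density (variation \<omega>) (\<lambda>x. ennreal (p x))"
      using finite_measure.dominated_density[OF finite_measure_variation, of "positive_variation \<omega>"]
      by (simp add: measurable_cong_sets[OF sets_variation refl])
    with that show ?thesis by blast
  qed
  obtain n where n [measurable]: "n \<in> borel_measurable borel" and n01: "\<And>y. 0 \<le> n y" "\<And>y. n y \<le> 1"
    and N: "negative_variation \<omega> = density (variation \<omega>) (\<lambda>x. ennreal (n x))"
  proof -
    have "emeasure (negative_variation \<omega>) A \<le> emeasure (variation \<omega>) A" if "A \<in> sets borel" for A
      using abs_le_measure_variation[OF that]
      by (simp add: emeasure_negative_variation that V)
    then have "\<exists>p\<in>borel_measurable borel. (\<forall>y. 0 \<le> p y \<and> p y \<le> 1) \<and>
        negative_variation \<omega> = density (variation \<omega>) (\<lambda>x. ennreal (p x))"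
      using finite_measure.dominated_density[OF finite_measure_variation, of "negative_variation \<omega>"]
      by (simp add: measurable_cong_sets[OF sets_variation refl])
    with that show ?thesis by blast
  qed
  show thesis
    by (rule that[OF p p01 P n n01 N])
qed

text \<open>Integrability against the variation passes to both halves because their densities are at
  most 1, so the difference may be taken under one integral. This replaces \<omega> by the bounded
  density \<open>p - n\<close> with respect to a positive measure.\<close>

lemma signed_integral_density:
  fixes f :: "'a \<Rightarrow> 'b::{banach, second_countable_topology}"
  assumes p [measurable]: "p \<in> borel_measurable borel" and p01: "\<And>y. 0 \<le> p y" "\<And>y. p y \<le> 1"
    and P: "positive_variation \<omega> = density (variation \<omega>) (\<lambda>x. ennreal (p x))"
    and n [measurable]: "n \<in> borel_measurable borel" and n01: "\<And>y. 0 \<le> n y" "\<And>y. n y \<le> 1"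
    and N: "negative_variation \<omega> = density (variation \<omega>) (\<lambda>x. ennreal (n x))"
    and f: "integrable (variation \<omega>) f"
  shows "signed_integral \<omega> f = (\<integral>y. (p y - n y) *\<^sub>R f y \<partial>variation \<omega>)"
proof -
  have [measurable]: "f \<in> borel_measurable borel" using f by (auto dest: borel_measurable_integrable)
  have int: "integrable (variation \<omega>) (\<lambda>x. g x *\<^sub>R f x)"
    if "g \<in> borel_measurable borel" "\<And>y. 0 \<le> g y" "\<And>y. g y \<le> 1" for g :: "'a \<Rightarrow> real"
    using that by (intro Bochner_Integration.integrable_bound[OF f]) (auto intro!: mult_left_le_one_le)
  show ?thesis
    unfolding signed_integral_def P N
    by (subst (1 2) integral_density)
      (auto simp: p01 n01 scaleR_diff_left intro!: Bochner_Integration.integral_diff[symmetric] int)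
qed

lemma finite_half_variations:
  "finite_measure (positive_variation \<omega>)" "finite_measure (negative_variation \<omega>)"
proof -
  have sp: "space (positive_variation \<omega>) = UNIV" "space (negative_variation \<omega>) = UNIV"
    using sets_eq_imp_space_eq[OF sets_half_variations(1)] sets_eq_imp_space_eq[OF sets_half_variations(2)] by simp_all
  show "finite_measure (positive_variation \<omega>)" "finite_measure (negative_variation \<omega>)"
    by (auto intro!: finite_measureI simp: sp emeasure_positive_variation emeasure_negative_variation)
qed

end

section \<open>Rotation averages and the Biot--Savart kernel\<close>

text \<open>The angle is \<open>2 * pi * t\<close>, so that a circle mean is an integral over
  \<open>{0..1}\<close> without a normalising factor.\<close>

definition rot :: "real \<Rightarrow> real ^ 2 \<Rightarrow> real ^ 2" where
  "rot t x = vector [cos (2 * pi * t) * x $ 1 - sin (2 * pi * t) * x $ 2,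
                     sin (2 * pi * t) * x $ 1 + cos (2 * pi * t) * x $ 2]"

definition cpx :: "real ^ 2 \<Rightarrow> complex" where
  "cpx x = Complex (x $ 1) (x $ 2)"

lemma rot_nth [simp]:
  "rot t x $ 1 = cos (2 * pi * t) * x $ 1 - sin (2 * pi * t) * x $ 2"
  "rot t x $ 2 = sin (2 * pi * t) * x $ 1 + cos (2 * pi * t) * x $ 2"
  by (simp_all add: rot_def)

lemma inner_real2: "x \<bullet> y = x $ 1 * y $ 1 + x $ 2 * y $ 2" for x y :: "real ^ 2"
  by (simp add: inner_vec_def sum_2)

lemma norm_real2: "(norm x)\<^sup>2 = (x $ 1)\<^sup>2 + (x $ 2)\<^sup>2" for x :: "real ^ 2"
  unfolding power2_norm_eq_inner inner_real2 by (simp add: power2_eq_square)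

lemma vec2_eqI: "x $ 1 = y $ 1 \<Longrightarrow> x $ 2 = y $ 2 \<Longrightarrow> x = y" for x y :: "'a ^ 2"
  by (simp add: vec_eq_iff forall_2)

lemma perp_nth [simp]: "perp x $ 1 = - (x $ 2)" "perp x $ 2 = x $ 1"
  by (simp_all add: perp_def)

lemma cpx_simps: "cpx (x + y) = cpx x + cpx y" "cpx (rot t x) = cis (2 * pi * t) * cpx x"
  by (simp_all add: cpx_def complex_eq_iff)

lemma norm_cpx [simp]: "norm (cpx x) = norm x"
  by (simp add: cpx_def cmod_def norm_eq_sqrt_inner inner_real2 power2_eq_square)

lemma rot_compose: "rot (- t) (rot t x) = x" "rot t (rot (- t) x) = x"
proof -
  have "cpx (rot (- t) (rot t x)) = cpx x" "cpx (rot t (rot (- t) x)) = cpx x"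
    by (simp_all add: cpx_simps cis_mult flip: mult.assoc)
  then show "rot (- t) (rot t x) = x" "rot t (rot (- t) x) = x"
    by (auto simp: cpx_def intro!: vec2_eqI)
qed

lemma norm_rot [simp]: "norm (rot t x) = norm x"
  using norm_cpx[of "rot t x"] by (simp add: cpx_simps norm_mult)

lemma orthogonal_transformation_rot: "orthogonal_transformation (rot t)"
  unfolding orthogonal_transformation
proof (intro conjI allI)
  show "linear (rot t)"
    by (intro linearI vec2_eqI) (simp_all add: algebra_simps)
qed simp

lemma continuous_rot: "continuous_on UNIV (\<lambda>p. rot (fst p) (snd p))"
proof -
  have eq: "rot t x = (\<chi> i. if i = 1 then cos (2 * pi * t) * x $ 1 - sin (2 * pi * t) * x $ 2
      else sin (2 * pi * t) * x $ 1 + cos (2 * pi * t) * x $ 2)" for t x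
    by (intro vec2_eqI) simp_all
  show ?thesis unfolding eq
  proof (intro continuous_on_vec_lambda)
    fix i :: 2
    show "continuous_on UNIV (\<lambda>p :: real \<times> (real ^ 2). if i = 1 then cos (2 * pi * fst p) * snd p $ 1 - sin (2 * pi * fst p) * snd p $ 2
      else sin (2 * pi * fst p) * snd p $ 1 + cos (2 * pi * fst p) * snd p $ 2)"
      by (cases "i = 1") (auto intro!: continuous_intros)
  qed
qed

lemma measurable_rot [measurable]:
  assumes "f \<in> borel_measurable M" "g \<in> borel_measurable M"
  shows "(\<lambda>x. rot (f x) (g x)) \<in> borel_measurable M"
proof -
  have "(\<lambda>p. rot (fst p) (snd p)) \<in> borel_measurable borel"
    by (rule borel_measurable_continuous_onI[OF continuous_rot])
  from measurable_compose[OF borel_measurable_Pair[OF assms] this]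
  show ?thesis by simp
qed

lemma distr_rot: "distr lborel borel (rot t) = lborel"
proof (rule lborel_eqI[symmetric])
  fix l u :: "real ^ 2" assume lu: "\<And>b. b \<in> Basis \<Longrightarrow> l \<bullet> b \<le> u \<bullet> b"
  have vim: "rot t -` box l u = rot (- t) ` box l u"
    by (auto simp: image_iff rot_compose intro!: bexI[of _ "rot t _"])
  have [measurable]: "rot t -` box l u \<in> sets borel"
    using measurable_sets_borel[of "rot t" borel "box l u"] by auto
  have o: "orthogonal_transformation (rot (- t))" by (rule orthogonal_transformation_rot)
  have meas: "rot t -` box l u \<in> lmeasurable"
    unfolding vim by (rule measurable_orthogonal_image[OF o]) simp
  have "emeasure (distr lborel borel (rot t)) (box l u) = emeasure lebesgue (rot t -` box l u)"
    by (subst emeasure_distr) auto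
  also have "\<dots> = measure lebesgue (rot t -` box l u)"
    using meas by (simp add: emeasure_eq_measure2)
  also have "\<dots> = measure lebesgue (box l u)"
    unfolding vim by (rule arg_cong[of _ _ ennreal], rule measure_orthogonal_image[OF o]) simp
  also have "\<dots> = (\<Prod>b\<in>Basis. (u - l) \<bullet> b)"
    using lu by (simp add: measure_lborel_box)
  finally show "emeasure (distr lborel borel (rot t)) (box l u) = (\<Prod>b\<in>Basis. (u - l) \<bullet> b)" .
qed simp

lemma nn_integral_rot:
  assumes [measurable]: "f \<in> borel_measurable borel"
  shows "(\<integral>\<^sup>+x. f (rot t x) \<partial>lborel) = (\<integral>\<^sup>+x. f x \<partial>lborel)"
  by (subst (2) distr_rot[of t, symmetric]) (simp add: nn_integral_distr)

lemma integral_rot: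
  fixes f :: "real ^ 2 \<Rightarrow> 'b::{banach, second_countable_topology}"
  assumes [measurable]: "f \<in> borel_measurable borel"
  shows "(\<integral>x. f (rot t x) \<partial>lborel) = (\<integral>x. f x \<partial>lborel)"
  by (subst (2) distr_rot[of t, symmetric]) (simp add: integral_distr)

text \<open>All rotated copies of \<open>F\<close> have the same integral; averaging over the angle
  and Fubini leave the integral of the circle means. These need to be known only almost everywhere,
  since the mean of K is evaluated only on circles that miss the singularity.\<close>

lemma integral_by_rotation:
  fixes F :: "real ^ 2 \<Rightarrow> 'b::{banach, second_countable_topology}"
  assumes F: "integrable lborel F" and G [measurable]: "G \<in> borel_measurable borel"
    and avg: "AE x in lborel. (LINT t:{0..1}|lborel. F (rot t x)) = G x"
  shows "(\<integral>x. F x \<partial>lborel) = (\<integral>x. G x \<partial>lborel)"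
proof -
  have [measurable]: "F \<in> borel_measurable borel" using F by auto
  define H where "H t x = indicator {0..1::real} t *\<^sub>R F (rot t x)" for t x
  have [measurable]: "(\<lambda>p. H (fst p) (snd p)) \<in> borel_measurable (lborel \<Otimes>\<^sub>M lborel)"
    unfolding H_def by measurable
  have "integrable (lborel \<Otimes>\<^sub>M lborel) (\<lambda>p. H (fst p) (snd p))"
  proof (rule integrableI_bounded)
    have "(\<integral>\<^sup>+p. ennreal (norm (H (fst p) (snd p))) \<partial>(lborel \<Otimes>\<^sub>M lborel))
        = (\<integral>\<^sup>+t. \<integral>\<^sup>+x. ennreal (norm (H t x)) \<partial>lborel \<partial>lborel)"
      by (subst lborel.nn_integral_fst[symmetric]) auto
    also have "\<dots> = (\<integral>\<^sup>+t. indicator {0..1::real} t * (\<integral>\<^sup>+x. ennreal (norm (F x)) \<partial>lborel) \<partial>lborel)"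
    proof (intro nn_integral_cong)
      fix t :: real
      show "(\<integral>\<^sup>+x. ennreal (norm (H t x)) \<partial>lborel) = indicator {0..1} t * (\<integral>\<^sup>+x. ennreal (norm (F x)) \<partial>lborel)"
        using nn_integral_rot[of "\<lambda>x. ennreal (norm (F x))" t] by (auto simp: H_def split: split_indicator)
    qed
    also have "\<dots> = (\<integral>\<^sup>+x. ennreal (norm (F x)) \<partial>lborel)"
      by (subst nn_integral_multc) auto
    also have "\<dots> < \<infinity>" using F by (simp add: integrable_iff_bounded)
    finally show "(\<integral>\<^sup>+p. ennreal (norm (H (fst p) (snd p))) \<partial>(lborel \<Otimes>\<^sub>M lborel)) < \<infinity>" .
  qed measurable
  then have "(\<integral>x. (\<integral>t. H t x \<partial>lborel) \<partial>lborel) = (\<integral>t. (\<integral>x. H t x \<partial>lborel) \<partial>lborel)"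
    by (intro lborel_pair.Fubini_integral) (simp add: case_prod_beta')
  also have "\<dots> = (\<integral>t. indicator {0..1::real} t *\<^sub>R (\<integral>x. F x \<partial>lborel) \<partial>lborel)"
    by (simp add: H_def integral_rot)
  also have "\<dots> = (\<integral>x. F x \<partial>lborel)"
    by simp
  also have "(\<integral>x. (\<integral>t. H t x \<partial>lborel) \<partial>lborel) = (\<integral>x. G x \<partial>lborel)"
    using avg by (intro integral_cong_AE) (auto simp: H_def set_lebesgue_integral_def)
  finally show ?thesis by simp
qed

section \<open>Circle means from the Cauchy formula\<close>

lemma has_integral_holomorphic_circle:
  assumes "f holomorphic_on cball 0 1"
  shows "((\<lambda>t. f (cis (2 * pi * t))) has_integral f 0) {0..1}"
proof -
  have "((\<lambda>u. f u / (u - 0)) has_contour_integral (2 * of_real pi * \<i> * f 0)) (circlepath 0 1)"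
    by (rule Cauchy_integral_circlepath_simple) (use assms in auto)
  then have "((\<lambda>t. f (exp (2 * of_real pi * \<i> * of_real t)) * (2 * of_real pi * \<i>)) has_integral (2 * of_real pi * \<i> * f 0)) {0..1}"
    unfolding has_contour_integral
    by (rule has_integral_spike_finite[of "{}", rotated 2, OF _ finite.emptyI])
      (simp add: vector_derivative_circlepath, simp add: circlepath)
  from has_integral_mult_left[OF this, of "1 / (2 * of_real pi * \<i>)"]
  have "((\<lambda>t. f (exp (2 * of_real pi * \<i> * of_real t))) has_integral f 0) {0..1}"
    by simp
  moreover have "exp (2 * of_real pi * \<i> * of_real t) = cis (2 * pi * t)" for t
    by (simp add: cis_conv_exp mult_ac)
  ultimately show ?thesis by simp
qed

lemma has_integral_inverse_circle:
  assumes "norm a \<noteq> norm w"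
  shows "((\<lambda>t. 1 / (w + cis (2 * pi * t) * a)) has_integral (if norm a < norm w then 1 / w else 0)) {0..1}"
proof (cases "norm a < norm w")
  case True
  have "w + u * a \<noteq> 0" if "norm u \<le> 1" for u
  proof
    assume "w + u * a = 0"
    then have "norm w = norm u * norm a" by (metis add_eq_0_iff norm_minus_cancel norm_mult)
    also have "\<dots> \<le> norm a" using that by (simp add: mult_left_le_one_le)
    finally show False using True by simp
  qed
  then have "(\<lambda>u. 1 / (w + u * a)) holomorphic_on cball 0 1"
    by (intro holomorphic_intros) auto
  from has_integral_holomorphic_circle[OF this] True show ?thesis by simp
next
  case False
  then have lt: "norm w < norm a" and "a \<noteq> 0" using assms by auto
  \<comment> \<open>Now the pole of \<open>1 / (w + u * a)\<close> lies inside the disc. On the unit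
    circle \<open>cnj u = 1 / u\<close>, so this function is the conjugate of
    \<open>u / (cnj a + u * cnj w)\<close>, which is holomorphic on the closed disc and vanishes at
    0.\<close>
  have "cnj a + u * cnj w \<noteq> 0" if "norm u \<le> 1" for u
  proof
    assume "cnj a + u * cnj w = 0"
    then have "norm a = norm u * norm w"
      by (metis add_eq_0_iff complex_mod_cnj norm_minus_cancel norm_mult)
    also have "\<dots> \<le> norm w" using that by (simp add: mult_left_le_one_le)
    finally show False using lt by simp
  qed
  then have "(\<lambda>u. u / (cnj a + u * cnj w)) holomorphic_on cball 0 1"
    by (intro holomorphic_intros) auto
  from has_integral_linear[OF has_integral_holomorphic_circle[OF this] bounded_linear_cnj]
  have "((\<lambda>t. cnj (cis (2 * pi * t) / (cnj a + cis (2 * pi * t) * cnj w))) has_integral 0) {0..1}"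
    by (simp add: o_def)
  moreover have "cnj (cis (2 * pi * t) / (cnj a + cis (2 * pi * t) * cnj w)) = 1 / (w + cis (2 * pi * t) * a)" for t
  proof -
    have "cnj (cis (2 * pi * t)) * (w + cis (2 * pi * t) * a) = cnj (cnj a + cis (2 * pi * t) * cnj w)"
      by (simp add: algebra_simps cis_cnj cis_mult)
    moreover have "cnj (cis (2 * pi * t)) \<noteq> 0" by (simp add: cis_cnj)
    ultimately show ?thesis
      by (metis (no_types, lifting) complex_cnj_divide mult_divide_mult_cancel_left mult.right_neutral)
  qed
  ultimately show ?thesis using False by simp
qed

lemma perp_add: "perp (x + y) = perp x + perp y"
  and perp_scaleR: "perp (c *\<^sub>R x) = c *\<^sub>R perp x"
  by (auto intro!: vec2_eqI)

lemma perp_0 [simp]: "perp 0 = 0"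
  by (intro vec2_eqI) simp_all

lemma norm_perp [simp]: "norm (perp x) = norm x"
  by (simp add: norm_eq_sqrt_inner inner_real2 add.commute)

lemma bounded_linear_perp: "bounded_linear perp"
  by (rule bounded_linear_intro[of _ 1]) (auto simp: perp_add perp_scaleR)

lemma measurable_perp: "perp \<in> borel_measurable borel"
  by (intro borel_measurable_continuous_onI linear_continuous_on bounded_linear_perp)

lemma measurable_kernel [measurable (raw)]:
  assumes [measurable]: "f \<in> borel_measurable M"
  shows "(\<lambda>x. biot_savart_kernel (f x)) \<in> borel_measurable M"
proof -
  note measurable_compose[OF assms measurable_perp, measurable]
  show ?thesis unfolding biot_savart_kernel_def by measurable
qed

lemma measurable_ball [measurable]: "ball c r \<in> sets borel" "cball c r \<in> sets borel"
  for c :: "'a::metric_space"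
  by auto

lemma norm_kernel: "norm (biot_savart_kernel x) = 1 / (2 * pi * norm x)"
  by (simp add: biot_savart_kernel_def power2_eq_square)

lemma kernel_0 [simp]: "biot_savart_kernel 0 = 0"
  using norm_kernel[of 0] by simp

lemma perp_inner_kernel: "v \<noteq> 0 \<Longrightarrow> perp v \<bullet> biot_savart_kernel v = 1 / (2 * pi)"
  by (simp add: biot_savart_kernel_def dot_square_norm)

text \<open>For z = \<open>cpx x\<close> one has 1 / z = (x1 - i x2) / |x|^2, and exchanging real
  and imaginary parts gives \<open>perp x\<close> over |x|^2. Thus K is a real-linear image of 1 /
  z, and this linear map commutes with circle means.\<close>

definition swap_vec :: "complex \<Rightarrow> real ^ 2" where
  "swap_vec z = vector [Im z, Re z]"

lemma swap_vec_nth [simp]: "swap_vec z $ 1 = Im z" "swap_vec z $ 2 = Re z"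
  by (simp_all add: swap_vec_def)

lemma bounded_linear_swap_vec: "bounded_linear swap_vec"
proof (rule bounded_linear_intro[of _ 1])
  have "(norm (swap_vec z))\<^sup>2 = (norm z)\<^sup>2" for z
    by (simp add: norm_real2 cmod_power2 add.commute)
  then show "norm (swap_vec z) \<le> norm z * 1" for z
    by (simp add: power2_eq_imp_eq)
qed (auto intro!: vec2_eqI)

lemma kernel_cpx: "biot_savart_kernel x = (1 / (2 * pi)) *\<^sub>R swap_vec (1 / cpx x)"
  by (rule vec2_eqI)
    (simp_all add: biot_savart_kernel_def cpx_def Re_divide Im_divide norm_real2)

text \<open>This is \<open>has_integral_inverse_circle\<close> with \<open>w = cpx x\<close> and
  \<open>a = cpx h\<close>, carried over by \<open>kernel_cpx\<close>. The norms must differ, since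
  otherwise the circle runs through the singularity.\<close>

lemma kernel_circle:
  assumes "norm h \<noteq> norm x"
  shows "set_integrable lborel {0..1} (\<lambda>t. biot_savart_kernel (x + rot t h))"
    and "(LINT t:{0..1}|lborel. biot_savart_kernel (x + rot t h)) =
      (if norm h < norm x then biot_savart_kernel x else 0)"
proof -
  let ?f = "\<lambda>t. 1 / (cpx x + cis (2 * pi * t) * cpx h)"
  have K: "biot_savart_kernel (x + rot t h) = (1 / (2 * pi)) *\<^sub>R swap_vec (?f t)" for t
    by (simp add: kernel_cpx cpx_simps)
  have "cpx x + cis (2 * pi * t) * cpx h \<noteq> 0" for t
  proof
    assume "cpx x + cis (2 * pi * t) * cpx h = 0"
    then have "norm (cpx x) = norm (cis (2 * pi * t) * cpx h)"
      by (metis add_eq_0_iff norm_minus_cancel)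
    then show False using assms by (simp add: norm_mult)
  qed
  then have "continuous_on {0..1} ?f"
    by (intro continuous_intros) (auto simp: cis.ctr intro!: continuous_intros)
  then have int: "set_integrable lborel {0..1} ?f"
    by (rule borel_integrable_atLeastAtMost')
  have "(LINT t:{0..1}|lborel. ?f t) = (if norm h < norm x then 1 / cpx x else 0)"
    using has_integral_inverse_circle[of "cpx h" "cpx x"] assms set_borel_integral_eq_integral(2)[OF int]
    by (simp add: integral_unique)
  moreover have bl: "bounded_linear (\<lambda>z. (1 / (2 * pi)) *\<^sub>R swap_vec z)"
    by (rule bounded_linear_scaleR_right[THEN bounded_linear_compose, OF bounded_linear_swap_vec])
  ultimately show "(LINT t:{0..1}|lborel. biot_savart_kernel (x + rot t h)) =
      (if norm h < norm x then biot_savart_kernel x else 0)"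
    using integral_bounded_linear[OF bl, of lborel "\<lambda>t. indicator {0..1} t *\<^sub>R ?f t"] int
    by (simp add: K set_lebesgue_integral_def set_integrable_def linear_simps(5)[OF bounded_linear_swap_vec]
        kernel_cpx[of x] linear_simps(3)[OF bounded_linear_swap_vec] mult.commute del: scaleR_scaleR)
  show "set_integrable lborel {0..1} (\<lambda>t. biot_savart_kernel (x + rot t h))"
    using integrable_bounded_linear[OF bl int[unfolded set_integrable_def]]
    by (simp add: K set_integrable_def linear_simps(5)[OF bounded_linear_swap_vec] mult.commute)
qed

text \<open>With \<open>v = rot t x + w\<close>, the vector \<open>perp (rot t x)\<close> is
  \<open>perp v - perp w\<close>, and \<open>perp v \<bullet> biot_savart_kernel v\<close> is the
  constant 1 / (2 \<pi>). The other term contains the circle mean of K around \<open>w\<close>,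
  which is K at \<open>w\<close> or 0; in the first case it contributes the same constant and
  everything cancels.\<close>

lemma perp_kernel_circle:
  assumes "norm x \<noteq> norm w"
  shows "(LINT t:{0..1}|lborel. perp (rot t x) \<bullet> biot_savart_kernel (rot t x + w)) =
      (if norm w < norm x then 1 / (2 * pi) else 0)"
proof -
  have ne: "rot t x + w \<noteq> 0" for t
    using assms by (metis add_eq_0_iff norm_minus_cancel norm_rot)
  have "perp (rot t x) \<bullet> biot_savart_kernel (rot t x + w) =
      1 / (2 * pi) - perp w \<bullet> biot_savart_kernel (w + rot t x)" for t
    using perp_inner_kernel[OF ne[of t]] by (simp add: perp_add inner_add_left add.commute)
  then have "(LINT t:{0..1}|lborel. perp (rot t x) \<bullet> biot_savart_kernel (rot t x + w)) =
      (LINT t:{0..1}|lborel. 1 / (2 * pi) - perp w \<bullet> biot_savart_kernel (w + rot t x))"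
    by simp
  also have "\<dots> = (LINT t:{0..1::real}|lborel. 1 / (2 * pi)) -
      (LINT t:{0..1}|lborel. perp w \<bullet> biot_savart_kernel (w + rot t x))"
    using kernel_circle(1)[OF assms]
    by (intro set_integral_diff) (auto simp: set_integrable_def inner_scaleR_right[symmetric] simp del: inner_scaleR_right)
  also have "(LINT t:{0..1}|lborel. perp w \<bullet> biot_savart_kernel (w + rot t x)) =
      perp w \<bullet> (LINT t:{0..1}|lborel. biot_savart_kernel (w + rot t x))"
    using kernel_circle(1)[OF assms]
    by (simp add: set_lebesgue_integral_def set_integrable_def inner_scaleR_right[symmetric] del: inner_scaleR_right)
  also have "(LINT t:{0..1::real}|lborel. 1 / (2 * pi)) = 1 / (2 * pi)"
    by (simp add: set_lebesgue_integral_def)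
  finally show ?thesis
    using assms perp_inner_kernel[of w]
    by (cases "w = 0") (auto simp: kernel_circle(2)[OF assms])
qed

section \<open>Polar coordinates for radial functions\<close>

lemma AE_norm_neq: "AE x in lborel. norm (x :: real ^ 2) \<noteq> c"
proof -
  have "negligible (sphere 0 c :: (real ^ 2) set)" by (rule negligible_sphere)
  then have "AE x in lebesgue. x \<notin> (sphere 0 c :: (real ^ 2) set)"
    by (intro AE_not_in) (simp add: negligible_iff_null_sets)
  then show ?thesis by (simp add: AE_completion_iff)
qed

text \<open>Both measures give \<open>{..a}\<close> the area \<pi> a^2 of the disc (0 for negative
  \<open>a\<close>), and these half-lines are a generator closed under intersection.\<close>

lemma distr_norm: "distr lborel borel (norm :: real ^ 2 \<Rightarrow> real) = density lborel (\<lambda>s. ennreal (2 * pi * s) * indicator {0<..} s)"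
  (is "?M = ?N")
proof (rule measure_eqI_generator_eq[where E = "range (\<lambda>a::real. {..a})" and \<Omega> = UNIV and A = "\<lambda>i. {..real i}"])
  show "Int_stable (range (\<lambda>a::real. {..a}))"
    by (auto simp: Int_stable_def Int_atMost)
  fix X assume "X \<in> range (\<lambda>a::real. {..a})"
  then obtain a where X: "X = {..a}" by auto
  have "emeasure ?M X = emeasure lborel (cball (0 :: real ^ 2) a)"
    unfolding X by (subst emeasure_distr) (auto simp: cball_def intro!: arg_cong[of _ _ "emeasure lborel"])
  also have "\<dots> = ennreal (if a \<ge> 0 then pi * a\<^sup>2 else 0)"
    using emeasure_cball[of a "0 :: real ^ 2"] by (auto simp: unit_ball_vol_2)
  also have "\<dots> = emeasure ?N X"
  proof (cases "a \<ge> 0")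
    case True
    have "emeasure ?N X = (\<integral>\<^sup>+s. ennreal (2 * pi * s) * indicator {0..a} s \<partial>lborel)"
      unfolding X by (subst emeasure_density) (auto intro!: nn_integral_cong split: split_indicator)
    also have "\<dots> = ennreal (pi * a\<^sup>2 - pi * 0\<^sup>2)"
      using True by (intro nn_integral_FTC_Icc) (auto intro!: derivative_eq_intros)
    finally show ?thesis using True by simp
  next
    case False
    then have "emeasure ?N X = (\<integral>\<^sup>+s. 0 \<partial>(lborel :: real measure))"
      unfolding X by (subst emeasure_density, simp, simp, intro nn_integral_cong) (auto split: split_indicator)
    then show ?thesis using False by simp
  qed
  finally show "emeasure ?M X = emeasure ?N X" .
next
  show "(\<Union>i::nat. {..real i}) = UNIV" by (auto intro: real_arch_simple)
  show "emeasure ?M {..real i} \<noteq> \<infinity>" for i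
  proof -
    have "emeasure ?M {..real i} = emeasure lborel (cball (0 :: real ^ 2) (real i))"
      by (subst emeasure_distr) (auto simp: cball_def intro!: arg_cong[of _ _ "emeasure lborel"])
    then show ?thesis using emeasure_lborel_cball_finite[of "0 :: real ^ 2" "real i"] by simp
  qed
qed (auto simp: borel_eq_atMost)

lemma nn_integral_radial:
  assumes [measurable]: "f \<in> borel_measurable borel"
  shows "(\<integral>\<^sup>+x. f (norm (x :: real ^ 2)) \<partial>lborel) = (\<integral>\<^sup>+s. ennreal (2 * pi * s) * f s * indicator {0<..} s \<partial>lborel)"
proof -
  have "(\<integral>\<^sup>+x. f (norm (x :: real ^ 2)) \<partial>lborel) = integral\<^sup>N (distr lborel borel (norm :: real ^ 2 \<Rightarrow> real)) f"
    by (simp add: nn_integral_distr)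
  also have "\<dots> = (\<integral>\<^sup>+s. ennreal (2 * pi * s) * indicator {0<..} s * f s \<partial>lborel)"
    unfolding distr_norm by (subst nn_integral_density) auto
  finally show ?thesis by (simp add: mult_ac)
qed

section \<open>Truncated kernels and their averaged differences\<close>

lemma nn_integral_translate:
  fixes f :: "'a::euclidean_space \<Rightarrow> ennreal"
  assumes [measurable]: "f \<in> borel_measurable borel"
  shows "(\<integral>\<^sup>+x. f (x + c) \<partial>lborel) = (\<integral>\<^sup>+x. f x \<partial>lborel)"
  by (subst (2) lborel_distr_plus[of c, symmetric]) (simp add: nn_integral_distr add.commute)

lemma integral_translate:
  fixes f :: "'a::euclidean_space \<Rightarrow> 'b::{banach, second_countable_topology}"
  assumes [measurable]: "f \<in> borel_measurable borel"
  shows "(\<integral>x. f (x + c) \<partial>lborel) = (\<integral>x. f x \<partial>lborel)"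
  by (subst (2) lborel_distr_plus[of c, symmetric]) (simp add: integral_distr add.commute)

lemma integrable_translate:
  fixes f :: "'a::euclidean_space \<Rightarrow> 'b::{banach, second_countable_topology}"
  assumes "integrable lborel f"
  shows "integrable lborel (\<lambda>x. f (x + c))"
proof -
  have [measurable]: "f \<in> borel_measurable borel" using assms by auto
  show ?thesis
    using assms by (subst (asm) lborel_distr_plus[of c, symmetric]) (simp add: integrable_distr_eq add.commute)
qed

lemma AE_translate:
  fixes c :: "'a::euclidean_space"
  assumes "AE x in lborel. P x"
  shows "AE x in lborel. P (c + x)"
proof (rule AE_distrD[of "\<lambda>x. c + x" lborel borel])
  show "AE x in distr lborel borel ((+) c). P x"
    using assms by (simp only: lborel_distr_plus)
qed simp

definition trunc_kernel :: "real \<Rightarrow> real ^ 2 \<Rightarrow> real ^ 2" where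
  "trunc_kernel R x = (if norm x < R then biot_savart_kernel x else 0)"

lemma measurable_trunc_kernel [measurable (raw)]:
  assumes [measurable]: "f \<in> borel_measurable M"
  shows "(\<lambda>x. trunc_kernel R (f x)) \<in> borel_measurable M"
  unfolding trunc_kernel_def by measurable

lemma norm_trunc_kernel: "norm (trunc_kernel R x) = (if norm x < R then 1 / (2 * pi * norm x) else 0)"
  by (simp add: trunc_kernel_def norm_kernel)

text \<open>The circumference 2 \<pi> s cancels the size 1 / (2 \<pi> s) of the kernel, so every
  unit of radius contributes 1.\<close>

lemma nn_integral_trunc_kernel:
  assumes "R \<ge> 0"
  shows "(\<integral>\<^sup>+x. ennreal (norm (trunc_kernel R x)) \<partial>lborel) = ennreal R"
proof -
  have "(\<integral>\<^sup>+x. ennreal (norm (trunc_kernel R x)) \<partial>lborel) =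
      (\<integral>\<^sup>+x. ennreal (if norm (x :: real ^ 2) < R then 1 / (2 * pi * norm x) else 0) \<partial>lborel)"
    by (simp add: norm_trunc_kernel)
  also have "\<dots> = (\<integral>\<^sup>+s. ennreal (2 * pi * s) * ennreal (if s < R then 1 / (2 * pi * s) else 0) * indicator {0<..} s \<partial>lborel)"
    by (rule nn_integral_radial) measurable
  also have "\<dots> = (\<integral>\<^sup>+s. indicator {0<..<R} s \<partial>lborel)"
    by (intro nn_integral_cong) (auto split: split_indicator simp flip: ennreal_mult)
  also have "\<dots> = ennreal R" using assms by simp
  finally show ?thesis .
qed

lemma integrable_trunc_kernel: "integrable lborel (\<lambda>x. trunc_kernel R (x + c))"
proof -
  have "integrable lborel (trunc_kernel R)"
  proof (cases "R \<ge> 0")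
    case True
    then show ?thesis by (intro integrableI_bounded) (auto simp: nn_integral_trunc_kernel)
  next
    case False
    then have "trunc_kernel R = (\<lambda>x. 0)"
      by (auto simp: trunc_kernel_def fun_eq_iff dest: order_le_less_trans[OF norm_ge_zero])
    then show ?thesis by simp
  qed
  then show ?thesis by (rule integrable_translate)
qed

lemma emeasure_ball_real2: "r \<ge> 0 \<Longrightarrow> emeasure lborel (ball (c :: real ^ 2) r) = ennreal (pi * r\<^sup>2)"
  by (simp add: emeasure_ball unit_ball_vol_2)

lemma measure_ball_real2: "r \<ge> 0 \<Longrightarrow> measure lborel (ball (c :: real ^ 2) r) = pi * r\<^sup>2"
  by (simp add: measure_def emeasure_ball_real2)

lemma LINT_ball_const:
  fixes v :: "'b::{banach, second_countable_topology}"
  assumes "r \<ge> 0"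
  shows "(LINT h:ball (c :: real ^ 2) r|lborel. v) = (pi * r\<^sup>2) *\<^sub>R v"
  using emeasure_lborel_ball_finite[of c r] assms unfolding set_lebesgue_integral_def
  by (subst integral_scaleR_left) (auto simp: measure_ball_real2)

text \<open>Circles with |h| < |x| contribute K at \<open>x\<close> and all larger ones contribute
  nothing, so K is multiplied by the area of the smaller of the two discs. The integral is
  deliberately not divided by the area of the ball.\<close>

lemma shell_theorem:
  assumes "r > 0"
  shows "(LINT h:ball 0 r|lborel. biot_savart_kernel (x + h)) = (pi * (min r (norm x))\<^sup>2) *\<^sub>R biot_savart_kernel x"
proof -
  define F where "F h = indicator (ball 0 r) h *\<^sub>R biot_savart_kernel (x + h)" for h
  have "integrable lborel (\<lambda>h. trunc_kernel (norm x + r) (h + x))"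
    by (rule integrable_trunc_kernel)
  then have F: "integrable lborel F"
  proof (rule Bochner_Integration.integrable_bound)
    show "F \<in> borel_measurable lborel" unfolding F_def by measurable
    have "norm (F h) \<le> norm (trunc_kernel (norm x + r) (h + x))" for h
      using norm_triangle_ineq[of x h] by (auto simp: F_def trunc_kernel_def add.commute split: split_indicator)
    then show "AE h in lborel. norm (F h) \<le> norm (trunc_kernel (norm x + r) (h + x))" by simp
  qed
  define G where "G h = indicator (ball 0 (min r (norm x))) h *\<^sub>R biot_savart_kernel x" for h :: "real ^ 2"
  have "(\<integral>h. F h \<partial>lborel) = (\<integral>h. G h \<partial>lborel)"
  proof (rule integral_by_rotation[OF F])
    show "G \<in> borel_measurable borel" unfolding G_def by measurable
    show "AE h in lborel. (LINT t:{0..1}|lborel. F (rot t h)) = G h"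
      using AE_norm_neq[of "norm x"]
    proof eventually_elim
      fix h :: "real ^ 2" assume "norm h \<noteq> norm x"
      then have "(LINT t:{0..1}|lborel. F (rot t h)) = indicator (ball 0 r) h *\<^sub>R (LINT t:{0..1}|lborel. biot_savart_kernel (x + rot t h))"
        by (simp add: F_def indicator_def)
      then show "(LINT t:{0..1}|lborel. F (rot t h)) = G h"
        using \<open>norm h \<noteq> norm x\<close> by (auto simp: kernel_circle(2) G_def split: split_indicator)
    qed
  qed
  also have "\<dots> = (pi * (min r (norm x))\<^sup>2) *\<^sub>R biot_savart_kernel x"
    using LINT_ball_const[of "min r (norm x)" 0 "biot_savart_kernel x"] assms
    by (simp add: G_def set_lebesgue_integral_def)
  finally show ?thesis by (simp add: F_def set_lebesgue_integral_def)
qed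

section \<open>The truncated kernel minus its ball average\<close>

text \<open>Up to the factor \<pi> r^2 this is the kernel k of the overview, formed from the
  truncated K. Keeping the factor postpones all division to the final estimate.\<close>

definition diff_kernel :: "real \<Rightarrow> real \<Rightarrow> real ^ 2 \<Rightarrow> real ^ 2" where
  "diff_kernel R r x = (LINT h:ball 0 r|lborel. trunc_kernel R x - trunc_kernel R (x + h))"

lemma measurable_diff_kernel [measurable (raw)]:
  assumes "f \<in> borel_measurable M"
  shows "(\<lambda>x. diff_kernel R r (f x)) \<in> borel_measurable M"
proof -
  have "diff_kernel R r \<in> borel_measurable borel"
    unfolding diff_kernel_def set_lebesgue_integral_def by measurable
  from measurable_compose[OF assms this] show ?thesis .
qed

lemma set_integrable_ball_const: "set_integrable lborel (ball c r) (\<lambda>h :: 'a::euclidean_space. v)"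
  using emeasure_lborel_ball_finite[of c r] by (auto simp: set_integrable_def)

lemma set_integrable_trunc_kernel: "set_integrable lborel (ball c r) (\<lambda>h. trunc_kernel R (x + h))"
  unfolding set_integrable_def add.commute[of x]
  by (intro integrable_mult_indicator integrable_trunc_kernel) auto

text \<open>No translate \<open>x + h\<close> reaches the cutoff, so the shell theorem applies. The
  coefficient \<pi> r^2 - \<pi> min(r, |x|)^2 vanishes once |x| \<ge> r, which confines the kernel
  to the disc of radius r as long as the cutoff is not felt.\<close>

lemma diff_kernel_inner:
  assumes "r > 0" "norm x + r \<le> R"
  shows "diff_kernel R r x = (pi * max 0 (r\<^sup>2 - (norm x)\<^sup>2)) *\<^sub>R biot_savart_kernel x"
proof -
  have eq: "indicator (ball 0 r) h *\<^sub>R trunc_kernel R (x + h) = indicator (ball 0 r) h *\<^sub>R biot_savart_kernel (x + h)" for h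
    using norm_triangle_ineq[of x h] assms by (auto simp: trunc_kernel_def split: split_indicator)
  have "diff_kernel R r x = (LINT h:ball (0 :: real ^ 2) r|lborel. trunc_kernel R x) - (LINT h:ball 0 r|lborel. trunc_kernel R (x + h))"
    unfolding diff_kernel_def
    by (intro set_integral_diff(2) set_integrable_ball_const set_integrable_trunc_kernel)
  also have "(LINT h:ball 0 r|lborel. trunc_kernel R (x + h)) = (pi * (min r (norm x))\<^sup>2) *\<^sub>R biot_savart_kernel x"
    using shell_theorem[OF assms(1), of x] by (simp add: set_lebesgue_integral_def eq)
  also have "(LINT h:ball (0 :: real ^ 2) r|lborel. trunc_kernel R x) = (pi * r\<^sup>2) *\<^sub>R biot_savart_kernel x"
    using assms by (simp add: LINT_ball_const trunc_kernel_def)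
  also have "(pi * r\<^sup>2) *\<^sub>R biot_savart_kernel x - (pi * (min r (norm x))\<^sup>2) *\<^sub>R biot_savart_kernel x
      = (pi * r\<^sup>2 - pi * (min r (norm x))\<^sup>2) *\<^sub>R biot_savart_kernel x"
    by (simp add: scaleR_diff_left)
  also have "pi * r\<^sup>2 - pi * (min r (norm x))\<^sup>2 = pi * max 0 (r\<^sup>2 - (norm x)\<^sup>2)"
    using assms by (auto simp: min_def max_def algebra_simps power_mono)
  finally show ?thesis .
qed

lemma diff_kernel_outer:
  assumes "r > 0" "R + r \<le> norm x"
  shows "diff_kernel R r x = 0"
proof -
  have "indicator (ball 0 r) h *\<^sub>R (trunc_kernel R x - trunc_kernel R (x + h)) = 0" for h
    using norm_triangle_ineq4[of "x + h" h] assms by (auto simp: trunc_kernel_def split: split_indicator)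
  then show ?thesis unfolding diff_kernel_def set_lebesgue_integral_def by (simp only: Bochner_Integration.integral_zero)
qed

text \<open>No cancellation is used near the cutoff. By \<open>4 * r \<le> R\<close> all points
  involved have norm at least R - 2 r \<ge> R / 2, so each kernel value is at most 1 / (\<pi> R);
  the difference of two of them is integrated over the area \<pi> r^2.\<close>

lemma diff_kernel_middle:
  assumes "r > 0" "4 * r \<le> R" "R - r \<le> norm x"
  shows "norm (diff_kernel R r x) \<le> 2 * r\<^sup>2 / R"
proof -
  have tk: "norm (trunc_kernel R v) \<le> 1 / (pi * R)" if "norm v \<ge> R - 2 * r" for v
  proof -
    have "R \<le> 2 * norm v" "R > 0" using that assms by auto
    then have "1 / (2 * pi * norm v) \<le> 1 / (pi * R)"
      by (intro divide_left_mono) (auto intro!: mult_pos_pos)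
    then show ?thesis using \<open>R > 0\<close> by (auto simp: norm_trunc_kernel)
  qed
  have "norm (diff_kernel R r x) \<le> (\<integral>h. norm (indicator (ball 0 r) h *\<^sub>R (trunc_kernel R x - trunc_kernel R (x + h))) \<partial>lborel)"
    unfolding diff_kernel_def set_lebesgue_integral_def by (rule integral_norm_bound)
  also have "\<dots> \<le> (\<integral>h. indicator (ball (0 :: real ^ 2) r) h * (2 / (pi * R)) \<partial>lborel)"
  proof (rule integral_mono)
    show "integrable lborel (\<lambda>h. norm (indicator (ball 0 r) h *\<^sub>R (trunc_kernel R x - trunc_kernel R (x + h))))"
      using set_integral_diff(1)[OF set_integrable_ball_const set_integrable_trunc_kernel]
      unfolding set_integrable_def by (rule integrable_norm)
    show "integrable lborel (\<lambda>h. indicator (ball (0 :: real ^ 2) r) h * (2 / (pi * R)))"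
      using set_integrable_ball_const[of 0 r "2 / (pi * R) :: real"] by (simp add: set_integrable_def)
    fix h :: "real ^ 2"
    have "norm (trunc_kernel R x - trunc_kernel R (x + h)) \<le> 2 / (pi * R)" if "norm h < r"
    proof -
      have "norm (x + h) \<ge> R - 2 * r" using norm_triangle_ineq4[of "x + h" h] assms that by simp
      then have "norm (trunc_kernel R x) + norm (trunc_kernel R (x + h)) \<le> 1 / (pi * R) + 1 / (pi * R)"
        using assms by (intro add_mono tk) auto
      moreover have "1 / (pi * R) + 1 / (pi * R) = 2 / (pi * R)" by (simp flip: add_divide_distrib)
      ultimately show ?thesis using norm_triangle_ineq4[of "trunc_kernel R x" "trunc_kernel R (x + h)"]
        by (metis order_trans)
    qed
    then show "norm (indicator (ball 0 r) h *\<^sub>R (trunc_kernel R x - trunc_kernel R (x + h))) \<le> indicator (ball 0 r) h * (2 / (pi * R))"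
      by (auto split: split_indicator)
  qed
  also have "\<dots> = 2 * r\<^sup>2 / R"
    using assms by (simp add: measure_ball_real2)
  finally show ?thesis .
qed

text \<open>A crude majorant of the same type as the kernel, meant for integrability and Fubini and
  not for the sharp estimate. Doubling the cutoff covers the annulus up to R + r, where 2 r^2 / R
  \<le> 4 r^2 / |x|.\<close>

lemma norm_diff_kernel_le:
  assumes "r > 0" "4 * r \<le> R"
  shows "norm (diff_kernel R r x) \<le> 8 * pi * r\<^sup>2 * norm (trunc_kernel (2 * R) x)"
proof -
  consider "norm x + r \<le> R" | "R - r \<le> norm x" "norm x < R + r" | "R + r \<le> norm x" by linarith
  then show ?thesis
  proof cases
    case 1
    then have "norm x < 2 * R" using assms by simp
    have "norm (diff_kernel R r x) = pi * max 0 (r\<^sup>2 - (norm x)\<^sup>2) * norm (biot_savart_kernel x)"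
      using assms 1 by (simp add: diff_kernel_inner)
    also have "\<dots> \<le> (8 * pi * r\<^sup>2) * norm (biot_savart_kernel x)"
      by (intro mult_right_mono) (auto simp: max_def algebra_simps add_increasing)
    finally show ?thesis using \<open>norm x < 2 * R\<close> by (simp add: trunc_kernel_def)
  next
    case 2
    then have "norm x < 2 * R" "norm x > 0" using assms by linarith+
    have "norm (diff_kernel R r x) \<le> 2 * r\<^sup>2 / R"
      using assms 2 by (intro diff_kernel_middle) auto
    also have "\<dots> \<le> 4 * r\<^sup>2 / norm x"
      using \<open>norm x < 2 * R\<close> \<open>norm x > 0\<close> assms by (simp add: field_simps)
    finally show ?thesis using \<open>norm x < 2 * R\<close> by (simp add: norm_trunc_kernel)
  next
    case 3
    then show ?thesis using assms by (simp add: diff_kernel_outer)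
  qed
qed

lemma ennreal_norm_integral_le:
  fixes f :: "'a \<Rightarrow> 'b::{banach, second_countable_topology}"
  shows "ennreal (norm (integral\<^sup>L M f)) \<le> (\<integral>\<^sup>+x. ennreal (norm (f x)) \<partial>M)"
  by (cases "integrable M f") (auto simp: integral_norm_bound_ennreal not_integrable_integral_eq)

section \<open>Pairings of the kernel with its averaged difference\<close>

text \<open>For 0 < d < r the value is 2 \<pi> ln (r / d). It is kept as an integral because
  interchanging it with an integral over \<mu> turns the condition |y - z| \<le> |x| into the mass
  of a closed ball of radius |x|.\<close>

definition annulus_energy :: "real \<Rightarrow> real \<Rightarrow> ennreal" where
  "annulus_energy r d = (\<integral>\<^sup>+x. ennreal (1 / (norm (x :: real ^ 2))\<^sup>2) * indicator {d..<r} (norm x) \<partial>lborel)"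

lemma measurable_annulus_energy [measurable (raw)]:
  assumes "f \<in> borel_measurable M"
  shows "(\<lambda>x. annulus_energy r (f x)) \<in> borel_measurable M"
proof -
  have "(\<lambda>d. annulus_energy r d) \<in> borel_measurable borel"
    unfolding annulus_energy_def indicator_def atLeastLessThan_iff by measurable
  from measurable_compose[OF assms this] show ?thesis .
qed

text \<open>Isolates a coefficient that depends on |x| only, so that the rotation average reduces to
  \<open>perp_kernel_circle\<close>.\<close>

lemma kernel_inner_rot:
  "biot_savart_kernel (rot t x + w) \<bullet> (c *\<^sub>R biot_savart_kernel (rot t x)) =
    c / (2 * pi * (norm x)\<^sup>2) * (perp (rot t x) \<bullet> biot_savart_kernel (rot t x + w))"
  by (simp add: biot_savart_kernel_def[of "rot t x"] inner_commute)

text \<open>The integrand of the pairing at displacement \<open>w\<close> with the cutoff removed: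
  the second factor is the closed form from \<open>diff_kernel_inner\<close>.\<close>

definition kernel_cross :: "real \<Rightarrow> real ^ 2 \<Rightarrow> real ^ 2 \<Rightarrow> real" where
  "kernel_cross r w x = biot_savart_kernel (x + w) \<bullet> ((pi * max 0 (r\<^sup>2 - (norm x)\<^sup>2)) *\<^sub>R biot_savart_kernel x)"

lemma integral_kernel_cross_le:
  fixes w :: "real ^ 2"
  assumes "r > 0"
    and F: "integrable lborel (kernel_cross r w)"
  shows "ennreal \<bar>\<integral>x. kernel_cross r w x \<partial>lborel\<bar> \<le> ennreal (r\<^sup>2 / (4 * pi)) * annulus_energy r (norm w)"
proof -
  define c where "c x = pi * max 0 (r\<^sup>2 - (norm x)\<^sup>2) / (2 * pi * (norm x)\<^sup>2)" for x :: "real ^ 2"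
  define G where "G x = c x * (if norm w < norm x then 1 / (2 * pi) else 0)" for x
  have G [measurable]: "G \<in> borel_measurable borel" unfolding G_def c_def by measurable
  have "(\<integral>x. kernel_cross r w x \<partial>lborel) = (\<integral>x. G x \<partial>lborel)"
  proof (rule integral_by_rotation[OF F G])
    show "AE x in lborel. (LINT t:{0..1}|lborel. kernel_cross r w (rot t x)) = G x"
      using AE_norm_neq[of "norm w"]
    proof eventually_elim
      fix x :: "real ^ 2" assume "norm x \<noteq> norm w"
      have "(LINT t:{0..1}|lborel. kernel_cross r w (rot t x)) = (LINT t:{0..1}|lborel. c x * (perp (rot t x) \<bullet> biot_savart_kernel (rot t x + w)))"
        unfolding kernel_cross_def kernel_inner_rot by (simp add: c_def)
      then show "(LINT t:{0..1}|lborel. kernel_cross r w (rot t x)) = G x"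
        by (simp add: G_def perp_kernel_circle[OF \<open>norm x \<noteq> norm w\<close>])
    qed
  qed
  then have "ennreal \<bar>\<integral>x. kernel_cross r w x \<partial>lborel\<bar> \<le> (\<integral>\<^sup>+x. ennreal \<bar>G x\<bar> \<partial>lborel)"
    using ennreal_norm_integral_le[of lborel G] by simp
  also have "\<dots> \<le> (\<integral>\<^sup>+x. ennreal (r\<^sup>2 / (4 * pi)) * (ennreal (1 / (norm (x :: real ^ 2))\<^sup>2) * indicator {norm w..<r} (norm x)) \<partial>lborel)"
  proof (intro nn_integral_mono)
    fix x :: "real ^ 2"
    show "ennreal \<bar>G x\<bar> \<le> ennreal (r\<^sup>2 / (4 * pi)) * (ennreal (1 / (norm x)\<^sup>2) * indicator {norm w..<r} (norm x))"
    proof (cases "norm w < norm x \<and> norm x < r")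
      case True
      then have "(norm x)\<^sup>2 < r\<^sup>2" "norm x > 0"
        by (auto intro!: power_strict_mono intro: le_less_trans[OF norm_ge_zero])
      \<comment> \<open>Dropping - |x|^2 bounds \<open>c x\<close> by r^2 / (2 |x|^2), and the
        circle mean supplies the factor 1 / (2 \<pi>).\<close>
      then have "\<bar>G x\<bar> \<le> r\<^sup>2 / (4 * pi) * (1 / (norm x)\<^sup>2)"
        using True by (simp add: G_def c_def divide_simps)
      then show ?thesis
        using True by (simp add: ennreal_leI flip: ennreal_mult)
    next
      case False
      have "r\<^sup>2 \<le> (norm x)\<^sup>2" if "r \<le> norm x" using that assms by (intro power_mono) auto
      with False have "G x = 0" by (auto simp: G_def c_def)
      then show ?thesis by simp
    qed
  qed
  also have "\<dots> = ennreal (r\<^sup>2 / (4 * pi)) * annulus_energy r (norm w)"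
    unfolding annulus_energy_def by (intro nn_integral_cmult) measurable
  finally show ?thesis .
qed

lemma emeasure_annulus:
  assumes "0 \<le> a" "a \<le> b"
  shows "emeasure lborel {x :: real ^ 2. a \<le> norm x \<and> norm x < b} = ennreal (pi * b\<^sup>2 - pi * a\<^sup>2)"
proof -
  have "{x :: real ^ 2. a \<le> norm x \<and> norm x < b} = ball 0 b - ball 0 a" by auto
  moreover have "ball 0 a \<subseteq> (ball 0 b :: (real ^ 2) set)" using assms by auto
  ultimately show ?thesis
    using assms emeasure_lborel_ball_finite[of "0 :: real ^ 2" a]
    by (simp add: emeasure_Diff emeasure_ball_real2 ennreal_minus)
qed

text \<open>The deviation \<open>q\<close> from the pairing without cutoff has two sources: K cut
  off at R differs from K by at most 1 / (2 \<pi> R) where |x| < r, and the closed form of the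
  difference kernel fails near |x| = R. The bound has to be uniform in \<open>w\<close>, although
  the singularity of the first factor at x = - w may lie in that annulus.\<close>

lemma truncated_cross_le:
  fixes w :: "real ^ 2"
  assumes r: "r > 0" and R: "4 * r \<le> R"
  shows "ennreal \<bar>\<integral>x. trunc_kernel R (x + w) \<bullet> diff_kernel R r x \<partial>lborel\<bar> \<le>
    ennreal (r\<^sup>2 / (4 * pi)) * annulus_energy r (norm w) + ennreal (r ^ 3 / (2 * R) + 2 * r\<^sup>2 * (1 + 2 * r) / sqrt R)"
proof (cases "integrable lborel (\<lambda>x. trunc_kernel R (x + w) \<bullet> diff_kernel R r x)")
  case False
  \<comment> \<open>The Bochner integral is then \<open>0\<close> by convention.\<close>
  then show ?thesis by (simp add: not_integrable_integral_eq)
next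
  case True
  define p where p_eq: "p = kernel_cross r w"
  note p_def = kernel_cross_def[of r w, folded p_eq]
  define q where "q x = trunc_kernel R (x + w) \<bullet> diff_kernel R r x - p x" for x
  have [measurable]: "q \<in> borel_measurable borel" "p \<in> borel_measurable borel"
    unfolding q_def p_def by measurable
  have "R > 0" using assms by simp
  define A where "A = {x :: real ^ 2. R - r \<le> norm x \<and> norm x < R + r}"
  have [measurable]: "A \<in> sets borel" unfolding A_def by measurable
  have kR: "norm (biot_savart_kernel v) \<le> 1 / (2 * pi * a)" if "a \<le> norm v" "a > 0" for v a
    using that unfolding norm_kernel by (intro divide_left_mono) (auto intro!: mult_pos_pos)
  \<comment> \<open>The first term belongs to |x| < r, the other two to the annulus
    \<open>A\<close>. There the first factor is split at distance sqrt R from its singularity: the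
    near part has integral sqrt R, and the far part is at most 1 / (2 \<pi> sqrt R) on an area of 4
    \<pi> R r. After multiplication by 2 r^2 / R both are of order R^(-1/2).\<close>
  define b where "b x = r\<^sup>2 / (2 * R) * norm (trunc_kernel r x) +
      (2 * r\<^sup>2 / R * norm (trunc_kernel (sqrt R) (x + w)) + r\<^sup>2 / (pi * (R * sqrt R)) * indicator A x)" for x
  have q_le: "\<bar>q x\<bar> \<le> b x" for x
  proof -
    have pos: "0 \<le> r\<^sup>2 / (2 * R) * norm (trunc_kernel r x)" "0 \<le> 2 * r\<^sup>2 / R * norm (trunc_kernel (sqrt R) (x + w))"
        "0 \<le> r\<^sup>2 / (pi * (R * sqrt R)) * indicator A x"
      using \<open>R > 0\<close> by auto
    have p0: "p x = 0" if "r \<le> norm x"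
    proof -
      have "r\<^sup>2 \<le> (norm x)\<^sup>2" using that r by (intro power_mono) auto
      then show ?thesis by (simp add: p_def)
    qed
    consider "norm x < r" | "r \<le> norm x" "norm x < R - r" | "R - r \<le> norm x" "norm x < R + r" | "R + r \<le> norm x"
      by linarith
    then show ?thesis
    proof cases
      case 1
      let ?m = "pi * max 0 (r\<^sup>2 - (norm x)\<^sup>2)"
      have "q x = (trunc_kernel R (x + w) - biot_savart_kernel (x + w)) \<bullet> (?m *\<^sub>R biot_savart_kernel x)"
        using 1 r R by (simp add: q_def p_def diff_kernel_inner inner_diff_left right_diff_distrib)
      then have "\<bar>q x\<bar> \<le> norm (trunc_kernel R (x + w) - biot_savart_kernel (x + w)) * norm (?m *\<^sub>R biot_savart_kernel x)"
        by (simp only: Cauchy_Schwarz_ineq2)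
      also have "\<dots> \<le> 1 / (2 * pi * R) * (pi * r\<^sup>2 * norm (trunc_kernel r x))"
      proof (intro mult_mono)
        show "norm (trunc_kernel R (x + w) - biot_savart_kernel (x + w)) \<le> 1 / (2 * pi * R)"
          using kR[of R "x + w"] \<open>R > 0\<close> by (auto simp: trunc_kernel_def)
        show "norm (?m *\<^sub>R biot_savart_kernel x) \<le> pi * r\<^sup>2 * norm (trunc_kernel r x)"
          using 1 by (auto simp: trunc_kernel_def intro!: mult_right_mono)
      qed (use \<open>R > 0\<close> in auto)
      also have "\<dots> = r\<^sup>2 / (2 * R) * norm (trunc_kernel r x)" by simp
      finally show ?thesis using pos by (simp add: b_def)
    next
      case 2
      then have "(norm x)\<^sup>2 \<ge> r\<^sup>2" using r by (intro power_mono) auto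
      then have "q x = 0" using p0 2 r by (simp add: q_def diff_kernel_inner)
      then show ?thesis using pos by (simp add: b_def)
    next
      case 3
      then have "\<bar>q x\<bar> \<le> norm (trunc_kernel R (x + w)) * norm (diff_kernel R r x)"
        using p0 r R Cauchy_Schwarz_ineq2 by (simp add: q_def)
      also have "\<dots> \<le> (norm (trunc_kernel (sqrt R) (x + w)) + 1 / (2 * pi * sqrt R)) * (2 * r\<^sup>2 / R)"
      proof (intro mult_mono diff_kernel_middle assms)
        show "norm (trunc_kernel R (x + w)) \<le> norm (trunc_kernel (sqrt R) (x + w)) + 1 / (2 * pi * sqrt R)"
          using kR[of "sqrt R" "x + w"] \<open>R > 0\<close> by (auto simp: trunc_kernel_def not_less)
      qed (use 3 \<open>R > 0\<close> in auto)
      also have "\<dots> = 2 * r\<^sup>2 / R * norm (trunc_kernel (sqrt R) (x + w)) + r\<^sup>2 / (pi * (R * sqrt R)) * indicator A x"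
        using 3 \<open>R > 0\<close> by (simp add: A_def algebra_simps)
      finally show ?thesis using pos by (simp add: b_def)
    next
      case 4
      then have "q x = 0" using p0 r R by (simp add: q_def diff_kernel_outer)
      then show ?thesis using pos by (simp add: b_def)
    qed
  qed
  have "(\<integral>\<^sup>+x. ennreal \<bar>q x\<bar> \<partial>lborel) \<le> (\<integral>\<^sup>+x. ennreal (b x) \<partial>lborel)"
    using q_le by (intro nn_integral_mono ennreal_leI)
  also have "\<dots> = (\<integral>\<^sup>+x. ennreal (r\<^sup>2 / (2 * R)) * ennreal (norm (trunc_kernel r x)) +
      (ennreal (2 * r\<^sup>2 / R) * ennreal (norm (trunc_kernel (sqrt R) (x + w))) + ennreal (r\<^sup>2 / (pi * (R * sqrt R))) * indicator A x) \<partial>lborel)"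
    using \<open>R > 0\<close> by (intro nn_integral_cong)
      (auto simp: b_def split: split_indicator simp flip: ennreal_mult ennreal_plus)
  also have "\<dots> = ennreal (r\<^sup>2 / (2 * R)) * (\<integral>\<^sup>+x. ennreal (norm (trunc_kernel r x)) \<partial>lborel) +
      (ennreal (2 * r\<^sup>2 / R) * (\<integral>\<^sup>+x. ennreal (norm (trunc_kernel (sqrt R) (x + w))) \<partial>lborel) +
       ennreal (r\<^sup>2 / (pi * (R * sqrt R))) * emeasure lborel A)"
    by (simp add: nn_integral_add nn_integral_cmult)
  also have "(\<integral>\<^sup>+x. ennreal (norm (trunc_kernel (sqrt R) (x + w))) \<partial>lborel) = ennreal (sqrt R)"
    using \<open>R > 0\<close> nn_integral_translate[of "\<lambda>x. ennreal (norm (trunc_kernel (sqrt R) x))" w]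
    by (simp add: nn_integral_trunc_kernel)
  also have "(\<integral>\<^sup>+x. ennreal (norm (trunc_kernel r x)) \<partial>lborel) = ennreal r"
    using r by (simp add: nn_integral_trunc_kernel)
  also have "emeasure lborel A = ennreal (4 * pi * R * r)"
    using r R unfolding A_def by (subst emeasure_annulus) (auto simp: power2_eq_square algebra_simps)
  also have "ennreal (r\<^sup>2 / (2 * R)) * ennreal r + (ennreal (2 * r\<^sup>2 / R) * ennreal (sqrt R) +
       ennreal (r\<^sup>2 / (pi * (R * sqrt R))) * ennreal (4 * pi * R * r)) =
      ennreal (r\<^sup>2 / (2 * R) * r + (2 * r\<^sup>2 / R * sqrt R + r\<^sup>2 / (pi * (R * sqrt R)) * (4 * pi * R * r)))"
    using r \<open>R > 0\<close> by (simp flip: ennreal_mult ennreal_plus)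
  also have "r\<^sup>2 / (2 * R) * r + (2 * r\<^sup>2 / R * sqrt R + r\<^sup>2 / (pi * (R * sqrt R)) * (4 * pi * R * r)) =
      r ^ 3 / (2 * R) + 2 * r\<^sup>2 * (1 + 2 * r) / sqrt R"
  proof -
    have "2 * r\<^sup>2 / R * sqrt R = 2 * r\<^sup>2 / sqrt R"
      using \<open>R > 0\<close> real_sqrt_mult_self[of R] by (simp add: field_simps)
    moreover have "r\<^sup>2 / (pi * (R * sqrt R)) * (4 * pi * R * r) = 2 * r\<^sup>2 * (2 * r) / sqrt R"
      using \<open>R > 0\<close> by (simp add: field_simps)
    ultimately show ?thesis
      by (simp add: power3_eq_cube power2_eq_square distrib_left add_divide_distrib)
  qed
  finally have nq: "(\<integral>\<^sup>+x. ennreal \<bar>q x\<bar> \<partial>lborel) \<le> ennreal (r ^ 3 / (2 * R) + 2 * r\<^sup>2 * (1 + 2 * r) / sqrt R)" .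
  then have iq: "integrable lborel q"
    by (intro integrableI_bounded) (auto simp: less_top[symmetric] top_unique)
  have ip: "integrable lborel p"
    using Bochner_Integration.integrable_diff[OF True iq] by (simp add: q_def)
  have "(\<integral>x. trunc_kernel R (x + w) \<bullet> diff_kernel R r x \<partial>lborel) = (\<integral>x. p x + q x \<partial>lborel)"
    by (simp add: q_def)
  also have "\<dots> = (\<integral>x. p x \<partial>lborel) + (\<integral>x. q x \<partial>lborel)"
    by (rule Bochner_Integration.integral_add[OF ip iq])
  finally have "ennreal \<bar>\<integral>x. trunc_kernel R (x + w) \<bullet> diff_kernel R r x \<partial>lborel\<bar> \<le>
      ennreal (\<bar>\<integral>x. p x \<partial>lborel\<bar> + \<bar>\<integral>x. q x \<partial>lborel\<bar>)"
    by (intro ennreal_leI) simp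
  also have "\<dots> = ennreal \<bar>\<integral>x. p x \<partial>lborel\<bar> + ennreal \<bar>\<integral>x. q x \<partial>lborel\<bar>"
    by simp
  also have "\<dots> \<le> ennreal (r\<^sup>2 / (4 * pi)) * annulus_energy r (norm w) + (\<integral>\<^sup>+x. ennreal \<bar>q x\<bar> \<partial>lborel)"
    using integral_kernel_cross_le[OF r ip[unfolded p_eq]] ennreal_norm_integral_le[of lborel q]
    by (intro add_mono) (auto simp: p_eq)
  also note nq
  finally show ?thesis by (simp add: add_left_mono)
qed

text \<open>The product is estimated at whichever of x and x + w is nearer to the origin, and these
  two choices give the factor 2. If the nearer point has norm at least d = |w|, both kernels are
  bounded by the reciprocal of that norm. Otherwise the farther one has norm at least d / 2, and the
  kernel at the nearer one, cut off at d, has integral d; this contributes at most 1 /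
  \<pi>.\<close>

lemma nn_integral_trunc_kernel_product_le:
  fixes w :: "real ^ 2"
  shows "(\<integral>\<^sup>+x. ennreal (norm (trunc_kernel R x) * norm (trunc_kernel R (x + w))) \<partial>lborel) \<le>
    2 * (annulus_energy R (norm w) + 1)"
proof -
  define d where "d = norm w"
  define g where "g v = ennreal (1 / (norm v)\<^sup>2) * indicator {d..<R} (norm v) + ennreal (1 / (pi * d)) * ennreal (norm (trunc_kernel d v))"
    for v :: "real ^ 2"
  have [measurable]: "g \<in> borel_measurable borel" unfolding g_def by measurable
  have *: "ennreal (norm (trunc_kernel R x) * norm (trunc_kernel R y)) \<le> g x"
    if "norm x \<le> norm y" "norm y \<ge> d - norm x" for x y
  proof (cases "norm x < R \<and> x \<noteq> 0")
    case False
    then have "norm (trunc_kernel R x) = 0" by (auto simp: trunc_kernel_def)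
    then show ?thesis by simp
  next
    case True
    have "norm (trunc_kernel R x) * norm (trunc_kernel R y) \<le> 1 / (2 * pi * norm x) * (1 / (2 * pi * norm y))"
      using True by (intro mult_mono) (auto simp: norm_trunc_kernel)
    also have "ennreal \<dots> \<le> g x"
    proof (cases "norm x \<ge> d")
      case True
      have "1 / (2 * pi * norm x) * (1 / (2 * pi * norm y)) \<le> 1 / norm x * (1 / norm x)"
      proof (intro mult_mono)
        have "norm x > 0" using \<open>norm x < R \<and> x \<noteq> 0\<close> by simp
        have p: "1 \<le> 2 * pi" using pi_gt3 by simp
        have le: "norm x \<le> 2 * pi * norm z" if "norm x \<le> norm z" for z :: "real ^ 2"
          using mult_mono[OF p that] by simp
        show "1 / (2 * pi * norm x) \<le> 1 / norm x"
          using le[of x] \<open>norm x > 0\<close> by (intro divide_left_mono) (auto intro!: mult_pos_pos)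
        show "1 / (2 * pi * norm y) \<le> 1 / norm x"
          using le[of y] that \<open>norm x > 0\<close> by (intro divide_left_mono) (auto intro!: mult_pos_pos)
      qed auto
      then show ?thesis using True \<open>norm x < R \<and> x \<noteq> 0\<close>
        by (auto simp: g_def power2_eq_square intro!: ennreal_leI add_increasing2)
    next
      case False
      then have "norm y \<ge> d / 2" "d > 0" using that norm_ge_zero[of x] by linarith+
      then have "1 / (2 * pi * norm y) \<le> 1 / (pi * d)"
        by (intro divide_left_mono) (auto intro!: mult_pos_pos)
      then have "1 / (2 * pi * norm x) * (1 / (2 * pi * norm y)) \<le> 1 / (2 * pi * norm x) * (1 / (pi * d))"
        by (intro mult_left_mono) auto
      then have "ennreal (1 / (2 * pi * norm x) * (1 / (2 * pi * norm y))) \<le> ennreal (1 / (pi * d)) * ennreal (1 / (2 * pi * norm x))"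
        using \<open>d > 0\<close> by (subst ennreal_mult[symmetric]) (auto intro!: ennreal_leI simp: mult.commute)
      also have "\<dots> = g x" using False by (simp add: g_def norm_trunc_kernel)
      finally show ?thesis .
    qed
    finally show ?thesis by (simp add: ennreal_leI)
  qed
  have "ennreal (norm (trunc_kernel R x) * norm (trunc_kernel R (x + w))) \<le> g x + g (x + w)" for x
  proof (cases "norm x \<le> norm (x + w)")
    case True
    have "d \<le> norm (x + w) + norm x"
      using norm_triangle_ineq4[of "x + w" x] by (simp add: d_def)
    with * True show ?thesis by (intro add_increasing2) auto
  next
    case False
    have "d \<le> norm (x + w) + norm x"
      using norm_triangle_ineq4[of "x + w" x] by (simp add: d_def)
    with False have "ennreal (norm (trunc_kernel R (x + w)) * norm (trunc_kernel R x)) \<le> g (x + w)"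
      by (intro *) auto
    then show ?thesis by (intro add_increasing) (auto simp: mult.commute)
  qed
  then have "(\<integral>\<^sup>+x. ennreal (norm (trunc_kernel R x) * norm (trunc_kernel R (x + w))) \<partial>lborel) \<le> (\<integral>\<^sup>+x. g x + g (x + w) \<partial>lborel)"
    by (intro nn_integral_mono)
  also have "\<dots> = 2 * (\<integral>\<^sup>+x. g x \<partial>lborel)"
    by (simp add: nn_integral_add nn_integral_translate mult_2)
  also have "(\<integral>\<^sup>+x. g x \<partial>lborel) = annulus_energy R d + ennreal (1 / (pi * d)) * (\<integral>\<^sup>+x. ennreal (norm (trunc_kernel d x)) \<partial>lborel)"
    unfolding g_def annulus_energy_def by (simp add: nn_integral_add nn_integral_cmult)
  also have "ennreal (1 / (pi * d)) * (\<integral>\<^sup>+x. ennreal (norm (trunc_kernel d x)) \<partial>lborel) \<le> 1"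
  proof -
    have "d \<ge> 0" by (simp add: d_def)
    then have "ennreal (1 / (pi * d)) * (\<integral>\<^sup>+x. ennreal (norm (trunc_kernel d x)) \<partial>lborel) = ennreal (1 / (pi * d) * d)"
      by (simp add: nn_integral_trunc_kernel flip: ennreal_mult)
    also have "\<dots> \<le> ennreal 1"
      using pi_gt3 by (intro ennreal_leI) (simp add: field_simps)
    finally show ?thesis by simp
  qed
  finally show ?thesis by (simp add: d_def mult_left_mono add_left_mono)
qed

section \<open>Divergence and curl of the kernel\<close>

lemma has_vector_derivative_rot:
  "((\<lambda>t. rot t x) has_vector_derivative (2 * pi) *\<^sub>R perp (rot t x)) (at t within S)"
proof -
  have "((\<lambda>t. (rot t x) $ i) has_vector_derivative ((2 * pi) *\<^sub>R perp (rot t x)) $ i) (at t within S)" for i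
    using exhaust_2[of i]
    by (auto simp: algebra_simps intro!: derivative_eq_intros simp flip: has_real_derivative_iff_has_vector_derivative)
  then show ?thesis
    unfolding has_vector_derivative_def
    by (subst has_derivative_componentwise_within) (auto simp: Basis_vec_def inner_axis mult.assoc)
qed

lemma integral_scaling:
  fixes f :: "real ^ 2 \<Rightarrow> 'b::{banach, second_countable_topology}"
  assumes "s > 0" and [measurable]: "f \<in> borel_measurable borel"
  shows "(\<integral>x. f x \<partial>lborel) = s\<^sup>2 *\<^sub>R (\<integral>v. f (s *\<^sub>R v) \<partial>lborel)"
proof -
  have eq: "(lborel :: (real ^ 2) measure) = density (distr lborel borel (\<lambda>v. 0 + s *\<^sub>R v)) (\<lambda>_. ennreal (\<bar>s\<bar> ^ DIM(real ^ 2)))"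
    by (rule lborel_affine) (use assms in simp)
  have "(\<integral>x. f x \<partial>lborel) = (\<integral>x. f x \<partial>density (distr lborel borel (\<lambda>v. 0 + s *\<^sub>R v)) (\<lambda>_. ennreal (\<bar>s\<bar> ^ DIM(real ^ 2))))"
    by (simp only: eq[symmetric])
  also have "\<dots> = s\<^sup>2 *\<^sub>R (\<integral>v. f (s *\<^sub>R v) \<partial>lborel)"
    using assms by (simp add: integral_density integral_distr)
  finally show ?thesis .
qed

lemma integrable_kernel_bounded:
  assumes [measurable]: "h \<in> borel_measurable borel" and "\<And>x. norm (h x) \<le> B" "\<And>x. norm x \<ge> R \<Longrightarrow> h x = 0"
  shows "integrable lborel (\<lambda>x. biot_savart_kernel x \<bullet> h x)"
proof (rule Bochner_Integration.integrable_bound)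
  show "integrable lborel (\<lambda>x. B *\<^sub>R trunc_kernel R (x + 0))"
    by (intro integrable_scaleR_right integrable_trunc_kernel)
  have "\<bar>biot_savart_kernel x \<bullet> h x\<bar> \<le> norm (B *\<^sub>R trunc_kernel R x)" for x
  proof (cases "norm x < R")
    case True
    have "\<bar>biot_savart_kernel x \<bullet> h x\<bar> \<le> norm (biot_savart_kernel x) * norm (h x)"
      by (rule Cauchy_Schwarz_ineq2)
    also have "\<dots> \<le> norm (biot_savart_kernel x) * \<bar>B\<bar>"
      using assms(2)[of x] by (intro mult_left_mono) auto
    finally show ?thesis using True by (simp add: trunc_kernel_def mult.commute)
  qed (use assms(3) in auto)
  then show "AE x in lborel. norm (biot_savart_kernel x \<bullet> h x) \<le> norm (B *\<^sub>R trunc_kernel R (x + 0))"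
    by simp
qed measurable

lemma nn_integral_cube_tail:
  assumes "a > 0"
  shows "(\<integral>\<^sup>+s. ennreal (1 / s ^ 3) * indicator {a..} s \<partial>lborel) = ennreal (1 / (2 * a\<^sup>2))"
proof -
  have "(\<integral>\<^sup>+s. ennreal (1 / s ^ 3) * indicator {a..} s \<partial>lborel) = ennreal (0 - (- 1 / (2 * a\<^sup>2)))"
  proof (rule nn_integral_FTC_atLeast)
    show "((\<lambda>s::real. - 1 / (2 * s\<^sup>2)) \<longlongrightarrow> 0) at_top" by real_asymp
    show "DERIV (\<lambda>s. - 1 / (2 * s\<^sup>2)) s :> 1 / s ^ 3" if "a \<le> s" for s
      using that assms by (auto intro!: derivative_eq_intros simp: field_simps power2_eq_square power3_eq_cube)
  qed (use assms in auto)
  then show ?thesis by simp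
qed

text \<open>The vector field \<open>g\<close> is the gradient of \<phi>, and \<rho> is a radius
  beyond which both vanish. The two kernel identities need only this first-order information about a
  test function.\<close>

locale test_field =
  fixes \<phi> :: "real ^ 2 \<Rightarrow> real" and g :: "real ^ 2 \<Rightarrow> real ^ 2" and \<rho> :: real
  assumes deriv: "(\<phi> has_derivative (\<lambda>v. v \<bullet> g x)) (at x)"
    and cont_g: "continuous_on UNIV g"
    and rho: "\<rho> > 0" "norm x \<ge> \<rho> \<Longrightarrow> \<phi> x = 0" "norm x \<ge> \<rho> \<Longrightarrow> g x = 0"
begin

lemma measurable_g [measurable (raw)]:
  assumes "f \<in> borel_measurable M"
  shows "(\<lambda>x. g (f x)) \<in> borel_measurable M"
  using measurable_compose[OF assms borel_measurable_continuous_onI[OF cont_g]] .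

lemma g_bounded: obtains B where "B > 0" "\<And>x. norm (g x) \<le> B"
proof -
  have "compact (g ` cball 0 \<rho>)"
    by (intro compact_continuous_image continuous_on_subset[OF cont_g]) auto
  then obtain B where B: "B > 0" "\<And>x. x \<in> cball 0 \<rho> \<Longrightarrow> norm (g x) \<le> B"
    using compact_imp_bounded[THEN bounded_pos[THEN iffD1]] by (metis imageI)
  have "norm (g x) \<le> B" for x
    using B rho(3)[of x] by (cases "norm x \<le> \<rho>") auto
  then show ?thesis using that B(1) by blast
qed

lemma field_along_curve:
  assumes "(c has_vector_derivative c') (at t within S)"
  shows "((\<lambda>t. \<phi> (c t)) has_vector_derivative (c' \<bullet> g (c t))) (at t within S)"
  using diff_chain_within[OF assms[unfolded has_vector_derivative_def] has_derivative_at_withinI[OF deriv]]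
  by (simp add: has_vector_derivative_def o_def)

lemma far_g: "norm x \<ge> \<rho> + norm y \<Longrightarrow> g (x + y) = 0"
  using norm_triangle_ineq4[of "x + y" y] by (intro rho) simp

lemma integral_kernel_gradient:
  "(\<integral>x. biot_savart_kernel x \<bullet> g (x + y) \<partial>lborel) = 0"
proof -
  obtain B where B: "B > 0" "\<And>x. norm (g x) \<le> B" using g_bounded by blast
  have "(\<integral>x. biot_savart_kernel x \<bullet> g (x + y) \<partial>lborel) = (\<integral>x. 0 \<partial>(lborel :: (real ^ 2) measure))"
  proof (rule integral_by_rotation)
    show "integrable lborel (\<lambda>x. biot_savart_kernel x \<bullet> g (x + y))"
      by (rule integrable_kernel_bounded[of _ B "\<rho> + norm y"]) (auto intro: B far_g)
    have "(LINT t:{0..1}|lborel. biot_savart_kernel (rot t x) \<bullet> g (rot t x + y)) = 0" for x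
    proof -
      \<comment> \<open>K at \<open>rot t x\<close> is a multiple of the velocity of the curve
        \<open>rot t x + y\<close>, with a factor depending on |x| only. The integral is therefore
        the change of \<phi> along a closed curve.\<close>
      have "(\<integral>t. indicator {0..1} t *\<^sub>R (((2 * pi) *\<^sub>R perp (rot t x)) \<bullet> g (rot t x + y)) \<partial>lborel) =
          \<phi> (rot 1 x + y) - \<phi> (rot 0 x + y)"
      proof (rule integral_FTC_Icc)
        show "((\<lambda>t. \<phi> (rot t x + y)) has_vector_derivative ((2 * pi) *\<^sub>R perp (rot t x)) \<bullet> g (rot t x + y)) (at t within {0..1})" for t
          by (rule field_along_curve) (auto intro!: derivative_eq_intros has_vector_derivative_rot)
        have "continuous_on {0..1} (\<lambda>t. rot t x)"
          using has_vector_derivative_rot by (rule continuous_on_vector_derivative)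
        then show "continuous_on {0..1} (\<lambda>t. ((2 * pi) *\<^sub>R perp (rot t x)) \<bullet> g (rot t x + y))"
          by (intro continuous_intros continuous_on_compose2[OF cont_g]
              continuous_on_compose2[OF linear_continuous_on[OF bounded_linear_perp]]) auto
      qed simp
      also have "rot 1 x = rot 0 x" by (intro vec2_eqI) simp_all
      finally have *: "(\<integral>t. indicator {0..1} t *\<^sub>R (((2 * pi) *\<^sub>R perp (rot t x)) \<bullet> g (rot t x + y)) \<partial>lborel) = 0" by simp
      have "(LINT t:{0..1}|lborel. biot_savart_kernel (rot t x) \<bullet> g (rot t x + y)) =
          (\<integral>t. (1 / (2 * pi)\<^sup>2 / (norm x)\<^sup>2) * (indicator {0..1} t *\<^sub>R (((2 * pi) *\<^sub>R perp (rot t x)) \<bullet> g (rot t x + y))) \<partial>lborel)"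
        unfolding set_lebesgue_integral_def
        by (intro Bochner_Integration.integral_cong) (auto simp: biot_savart_kernel_def power2_eq_square)
      then show ?thesis by (simp only: integral_mult_right_zero * mult_zero_right)
    qed
    then show "AE x in lborel. (LINT t:{0..1}|lborel. biot_savart_kernel (rot t x) \<bullet> g (rot t x + y)) = 0"
      by simp
  qed simp
  then show ?thesis by simp
qed

text \<open>Since \<open>perp\<close> preserves inner products, the integrand is x \<bullet> g (x +
  y) / (2 \<pi> |x|^2), the radial derivative of \<phi> around \<open>y\<close> divided by 2 \<pi>
  |x|. The directions of the rays are parametrised by the unit disc instead of the unit circle, so
  that Fubini and scaling of Lebesgue measure suffice; the area \<pi> of the disc is the factor
  removed at the end.\<close>

lemma integral_kernel_perp_gradient:
  "(\<integral>x. biot_savart_kernel x \<bullet> perp (g (x + y)) \<partial>lborel) = - \<phi> y"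
proof -
  obtain B where B: "B > 0" "\<And>x. norm (g x) \<le> B" using g_bounded by blast
  define R where "R = \<rho> + norm y"
  have "R > 0" using rho(1) by (simp add: R_def add_pos_nonneg)
  have g0: "g (x + y) = 0" if "norm x \<ge> R" for x using far_g that by (simp add: R_def)
  define q where "q x = x \<bullet> g (x + y)" for x
  have [measurable]: "q \<in> borel_measurable borel" unfolding q_def by measurable
  have q_le: "\<bar>q x\<bar> \<le> B * norm x * indicator {..<R} (norm x)" for x
  proof (cases "norm x < R")
    case True
    have "\<bar>q x\<bar> \<le> norm x * norm (g (x + y))" unfolding q_def by (rule Cauchy_Schwarz_ineq2)
    also have "\<dots> \<le> norm x * B" by (intro mult_left_mono B) auto
    finally show ?thesis using True by (simp add: mult.commute)
  qed (simp add: q_def g0)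
  \<comment> \<open>Since \<open>\<integral>\<^sub>a\<^sup>\<infinity> s\<^sup>-\<^sup>3 ds = 1 / (2 a\<^sup>2)\<close>, integrating \<open>W\<close> over \<open>s\<close> gives the integrand up to a factor; substituting \<open>x = s v\<close>
    turns its integral over \<open>x\<close> into that of \<open>V\<close>, which along each ray is the derivative of \<open>\<phi>\<close>.\<close>
  define W where "W s x = indicator {0<..} s * (indicator {norm x..} s * (1 / s ^ 3 * q x))" for s :: real and x
  have [measurable]: "(\<lambda>p. W (fst p) (snd p)) \<in> borel_measurable (lborel \<Otimes>\<^sub>M lborel)"
    unfolding W_def indicator_def atLeast_iff by measurable
  have tail: "(\<integral>\<^sup>+s. ennreal \<bar>W s x\<bar> \<partial>lborel) = ennreal \<bar>q x\<bar> * ennreal (1 / (2 * (norm x)\<^sup>2))" if "x \<noteq> 0" for x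
  proof -
    have "(\<integral>\<^sup>+s. ennreal \<bar>W s x\<bar> \<partial>lborel) = (\<integral>\<^sup>+s. ennreal \<bar>q x\<bar> * (ennreal (1 / s ^ 3) * indicator {norm x..} s) \<partial>lborel)"
    proof (intro nn_integral_cong)
      fix s :: real
      have "s > 0" if "norm x \<le> s" using that \<open>x \<noteq> 0\<close> by (meson less_le_trans zero_less_norm_iff)
      then show "ennreal \<bar>W s x\<bar> = ennreal \<bar>q x\<bar> * (ennreal (1 / s ^ 3) * indicator {norm x..} s)"
        by (auto simp: W_def abs_mult mult.commute split: split_indicator simp flip: ennreal_mult)
    qed
    also have "\<dots> = ennreal \<bar>q x\<bar> * ennreal (1 / (2 * (norm x)\<^sup>2))"
      using that by (subst nn_integral_cmult) (auto simp: nn_integral_cube_tail)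
    finally show ?thesis .
  qed
  have iW: "integrable (lborel \<Otimes>\<^sub>M lborel) (\<lambda>(s, x). W s x)"
  proof (rule integrableI_bounded)
    have "(\<integral>\<^sup>+p. ennreal (norm (case p of (s, x) \<Rightarrow> W s x)) \<partial>(lborel \<Otimes>\<^sub>M lborel)) =
        (\<integral>\<^sup>+x. \<integral>\<^sup>+s. ennreal \<bar>W s x\<bar> \<partial>lborel \<partial>lborel)"
      by (subst lborel_pair.nn_integral_snd[symmetric]) (auto simp: case_prod_beta')
    also have "\<dots> \<le> (\<integral>\<^sup>+x. ennreal (4 * B) * ennreal (norm (trunc_kernel R x)) \<partial>lborel)"
    proof (intro nn_integral_mono_AE)
      have "AE x in lborel. x \<noteq> (0 :: real ^ 2)" by (rule AE_lborel_singleton)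
      then show "AE x in lborel. (\<integral>\<^sup>+s. ennreal \<bar>W s x\<bar> \<partial>lborel) \<le> ennreal (4 * B) * ennreal (norm (trunc_kernel R x))"
      proof eventually_elim
        fix x :: "real ^ 2" assume "x \<noteq> 0"
        have "\<bar>q x\<bar> * (1 / (2 * (norm x)\<^sup>2)) \<le> (B * norm x * indicator {..<R} (norm x)) * (1 / (2 * (norm x)\<^sup>2))"
          by (intro mult_right_mono q_le) auto
        \<comment> \<open>For |x| < R this compares B / (2 |x|) with 4 B / (2 \<pi> |x|); the 4
          absorbs \<pi>.\<close>
        also have "\<dots> \<le> 4 * B * norm (trunc_kernel R x)"
          using \<open>x \<noteq> 0\<close> B(1) pi_less_4 by (auto simp: norm_trunc_kernel power2_eq_square field_simps)
        finally show "(\<integral>\<^sup>+s. ennreal \<bar>W s x\<bar> \<partial>lborel) \<le> ennreal (4 * B) * ennreal (norm (trunc_kernel R x))"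
          using B(1) by (simp add: tail[OF \<open>x \<noteq> 0\<close>] ennreal_leI flip: ennreal_mult)
      qed
    qed
    also have "\<dots> = ennreal (4 * B) * ennreal R"
      using \<open>R > 0\<close> by (simp add: nn_integral_cmult nn_integral_trunc_kernel)
    finally show "(\<integral>\<^sup>+p. ennreal (norm (case p of (s, x) \<Rightarrow> W s x)) \<partial>(lborel \<Otimes>\<^sub>M lborel)) < \<infinity>"
      by (simp add: ennreal_mult_less_top order_le_less_trans less_top top_unique flip: ennreal_mult)
  qed (simp add: case_prod_beta')
  \<comment> \<open>Under x = s v the condition |x| \<le> s becomes |v| \<le> 1, and the powers of s
    cancel: s^2 from the change of variables, s^(-3) from the weight and s from
    \<open>q\<close>.\<close>
  define V where "V s v = indicator {0<..} s * (indicator (cball 0 1) v * (v \<bullet> g (s *\<^sub>R v + y)))" for s :: real and v :: "real ^ 2"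
  have [measurable]: "(\<lambda>p. V (fst p) (snd p)) \<in> borel_measurable (lborel \<Otimes>\<^sub>M lborel)"
    unfolding V_def by measurable
  \<comment> \<open>As \<open>g\<close> vanishes for s |v| \<ge> R, the variable s is confined to an
    interval of length R / |v|. The factor |v| compensates its growth near v = 0, so the integral
    over s is at most B R for every v.\<close>
  have V_le: "\<bar>V s v\<bar> \<le> B * norm v * indicator {0..R / norm v} s * indicator (cball 0 1) v" for s v
  proof (cases "0 < s \<and> v \<in> cball 0 1 \<and> v \<noteq> 0 \<and> norm (s *\<^sub>R v) < R")
    case True
    have "\<bar>v \<bullet> g (s *\<^sub>R v + y)\<bar> \<le> norm v * norm (g (s *\<^sub>R v + y))" by (rule Cauchy_Schwarz_ineq2)
    also have "\<dots> \<le> norm v * B" by (intro mult_left_mono B) auto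
    finally show ?thesis using True by (auto simp: V_def mult.commute field_simps indicator_def)
  next
    case False
    then have "V s v = 0" using g0[of "s *\<^sub>R v"] by (auto simp: V_def indicator_def)
    then show ?thesis using B(1) by simp
  qed
  have iV: "integrable (lborel \<Otimes>\<^sub>M lborel) (\<lambda>(s, v). V s v)"
  proof (rule integrableI_bounded)
    have "(\<integral>\<^sup>+p. ennreal (norm (case p of (s, v) \<Rightarrow> V s v)) \<partial>(lborel \<Otimes>\<^sub>M lborel)) =
        (\<integral>\<^sup>+v. \<integral>\<^sup>+s. ennreal \<bar>V s v\<bar> \<partial>lborel \<partial>lborel)"
      by (subst lborel_pair.nn_integral_snd[symmetric]) (auto simp: case_prod_beta')
    also have "\<dots> \<le> (\<integral>\<^sup>+v. ennreal (B * R) * indicator (cball (0 :: real ^ 2) 1) v \<partial>lborel)"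
    proof (intro nn_integral_mono)
      fix v :: "real ^ 2"
      have "(\<integral>\<^sup>+s. ennreal \<bar>V s v\<bar> \<partial>lborel) \<le> (\<integral>\<^sup>+s. ennreal (B * norm v * indicator (cball 0 1) v) * indicator {0..R / norm v} s \<partial>lborel)"
      proof (intro nn_integral_mono)
        fix s :: real
        have "ennreal \<bar>V s v\<bar> \<le> ennreal (B * norm v * indicator {0..R / norm v} s * indicator (cball 0 1) v)"
          by (rule ennreal_leI[OF V_le])
        then show "ennreal \<bar>V s v\<bar> \<le> ennreal (B * norm v * indicator (cball 0 1) v) * indicator {0..R / norm v} s"
          by (auto simp: indicator_def split: if_splits)
      qed
      also have "\<dots> = ennreal (B * norm v * indicator (cball 0 1) v) * ennreal (R / norm v)"
        using \<open>R > 0\<close> by (subst nn_integral_cmult) auto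
      also have "\<dots> \<le> ennreal (B * R) * indicator (cball 0 1) v"
        using \<open>R > 0\<close> B(1) by (cases "v = 0") (auto split: split_indicator simp flip: ennreal_mult)
      finally show "(\<integral>\<^sup>+s. ennreal \<bar>V s v\<bar> \<partial>lborel) \<le> ennreal (B * R) * indicator (cball 0 1) v" .
    qed
    also have "\<dots> = ennreal (B * R) * emeasure lborel (cball (0 :: real ^ 2) 1)"
      by (subst nn_integral_cmult) auto
    also have "\<dots> < \<infinity>"
      using emeasure_lborel_cball_finite[of "0 :: real ^ 2" 1] by (simp add: ennreal_mult_less_top)
    finally show "(\<integral>\<^sup>+p. ennreal (norm (case p of (s, v) \<Rightarrow> V s v)) \<partial>(lborel \<Otimes>\<^sub>M lborel)) < \<infinity>" .
  qed (simp add: case_prod_beta')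
  have WV: "(\<integral>x. W s x \<partial>lborel) = (\<integral>v. V s v \<partial>lborel)" for s
  proof (cases "s > 0")
    case True
    have "(\<integral>x. W s x \<partial>lborel) = s\<^sup>2 *\<^sub>R (\<integral>v. W s (s *\<^sub>R v) \<partial>lborel)"
      by (rule integral_scaling[OF True]) (simp add: W_def indicator_def)
    also have "\<dots> = (\<integral>v. s\<^sup>2 * W s (s *\<^sub>R v) \<partial>lborel)" by simp
    also have "(\<lambda>v. s\<^sup>2 * W s (s *\<^sub>R v)) = V s"
      using True by (auto simp: fun_eq_iff W_def V_def q_def power2_eq_square power3_eq_cube indicator_def)
    finally show ?thesis .
  qed (simp add: W_def V_def)
  have ray: "(\<integral>s. V s v \<partial>lborel) = - \<phi> y * indicator (cball 0 1) v" if "v \<noteq> 0" for v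
  proof -
    \<comment> \<open>At s = S the point s v + y has norm at least \<rho>, so \<phi> vanishes there
      and only the endpoint s = 0 contributes.\<close>
    define S where "S = R / norm v"
    have "S > 0" using \<open>R > 0\<close> that by (simp add: S_def)
    have "(\<integral>s. indicator {0..S} s *\<^sub>R (v \<bullet> g (s *\<^sub>R v + y)) \<partial>lborel) = \<phi> (S *\<^sub>R v + y) - \<phi> (0 *\<^sub>R v + y)"
    proof (rule integral_FTC_Icc)
      show "((\<lambda>s. \<phi> (s *\<^sub>R v + y)) has_vector_derivative v \<bullet> g (s *\<^sub>R v + y)) (at s within {0..S})" for s
        by (rule field_along_curve) (auto intro!: derivative_eq_intros)
      show "continuous_on {0..S} (\<lambda>s. v \<bullet> g (s *\<^sub>R v + y))"
        by (intro continuous_intros continuous_on_compose2[OF cont_g]) auto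
    qed (use \<open>S > 0\<close> in simp)
    also have "\<phi> (S *\<^sub>R v + y) = 0"
    proof (rule rho(2))
      have "norm (S *\<^sub>R v) = R" using that \<open>R > 0\<close> by (simp add: S_def)
      then show "\<rho> \<le> norm (S *\<^sub>R v + y)"
        using norm_triangle_ineq4[of "S *\<^sub>R v + y" y] by (simp add: R_def)
    qed
    finally have "(\<integral>s. indicator {0..S} s *\<^sub>R (v \<bullet> g (s *\<^sub>R v + y)) \<partial>lborel) = - \<phi> y" by simp
    moreover have "(\<integral>s. V s v \<partial>lborel) = (\<integral>s. indicator (cball 0 1) v * (indicator {0..S} s *\<^sub>R (v \<bullet> g (s *\<^sub>R v + y))) \<partial>lborel)"
    proof (intro integral_cong_AE)
      have "AE s in lborel. s \<noteq> (0 :: real)" by (rule AE_lborel_singleton)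
      then show "AE s in lborel. V s v = indicator (cball 0 1) v * (indicator {0..S} s *\<^sub>R (v \<bullet> g (s *\<^sub>R v + y)))"
      proof eventually_elim
        fix s :: real assume "s \<noteq> 0"
        have "g (s *\<^sub>R v + y) = 0" if "s > S"
        proof (rule g0)
          have "R < s * norm v" using that \<open>v \<noteq> 0\<close> by (simp add: S_def field_simps)
          also have "\<dots> \<le> \<bar>s\<bar> * norm v" by (intro mult_right_mono) auto
          finally show "R \<le> norm (s *\<^sub>R v)" by simp
        qed
        then show "V s v = indicator (cball 0 1) v * (indicator {0..S} s *\<^sub>R (v \<bullet> g (s *\<^sub>R v + y)))"
          using \<open>s \<noteq> 0\<close> by (auto simp: V_def indicator_def)
      qed
    qed (simp_all add: V_def)
    ultimately show ?thesis by simp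
  qed
  have "pi * (\<integral>x. biot_savart_kernel x \<bullet> perp (g (x + y)) \<partial>lborel) = (\<integral>x. pi * (biot_savart_kernel x \<bullet> perp (g (x + y))) \<partial>lborel)"
    by simp
  also have "\<dots> = (\<integral>x. (\<integral>s. W s x \<partial>lborel) \<partial>lborel)"
  proof (intro integral_cong_AE)
    have "AE x in lborel. x \<noteq> (0 :: real ^ 2)" by (rule AE_lborel_singleton)
    then show "AE x in lborel. pi * (biot_savart_kernel x \<bullet> perp (g (x + y))) = (\<integral>s. W s x \<partial>lborel)"
    proof eventually_elim
      fix x :: "real ^ 2" assume "x \<noteq> 0"
      have W: "W s x = q x * (indicator {norm x..} s * (1 / s ^ 3))" for s
        using \<open>x \<noteq> 0\<close> by (auto simp: W_def indicator_def) (metis norm_le_zero_iff not_less order_trans)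
      have "(\<integral>s. indicator {norm x..} s * (1 / s ^ 3) \<partial>lborel) = 1 / (2 * (norm x)\<^sup>2)"
      proof -
        have "(\<integral>\<^sup>+s. ennreal (indicator {norm x..} s * (1 / s ^ 3)) \<partial>lborel) = ennreal (1 / (2 * (norm x)\<^sup>2))"
          using \<open>x \<noteq> 0\<close> by (subst nn_integral_cube_tail[symmetric]) (auto intro!: nn_integral_cong split: split_indicator)
        moreover have "0 \<le> indicator {norm x..} s * (1 / s ^ 3)" for s
          using order_trans[OF norm_ge_zero, of x s] by (auto split: split_indicator)
        ultimately show ?thesis
          by (subst integral_eq_nn_integral) auto
      qed
      then have "(\<integral>s. W s x \<partial>lborel) = q x * (1 / (2 * (norm x)\<^sup>2))"
        unfolding W by (simp only: integral_mult_right_zero)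
      also have "\<dots> = pi * (biot_savart_kernel x \<bullet> perp (g (x + y)))"
        by (simp add: q_def biot_savart_kernel_def inner_real2 add_divide_distrib distrib_left add.commute)
      finally show "pi * (biot_savart_kernel x \<bullet> perp (g (x + y))) = (\<integral>s. W s x \<partial>lborel)" by simp
    qed
  next
    show "(\<lambda>x. pi * (biot_savart_kernel x \<bullet> perp (g (x + y)))) \<in> borel_measurable lborel"
      using measurable_compose[OF _ measurable_perp] by measurable
    show "(\<lambda>x. \<integral>s. W s x \<partial>lborel) \<in> borel_measurable lborel"
      unfolding W_def indicator_def atLeast_iff by measurable
  qed
  also have "\<dots> = (\<integral>s. (\<integral>x. W s x \<partial>lborel) \<partial>lborel)"
    using lborel_pair.Fubini_integral[OF iW] by simp
  also have "\<dots> = (\<integral>s. (\<integral>v. V s v \<partial>lborel) \<partial>lborel)"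
    by (simp add: WV)
  also have "\<dots> = (\<integral>v. (\<integral>s. V s v \<partial>lborel) \<partial>lborel)"
    using lborel_pair.Fubini_integral[OF iV] by simp
  also have "\<dots> = (\<integral>v. - \<phi> y * indicator (cball (0 :: real ^ 2) 1) v \<partial>lborel)"
  proof (intro integral_cong_AE)
    have "AE x in lborel. x \<noteq> (0 :: real ^ 2)" by (rule AE_lborel_singleton)
    then show "AE v in lborel. (\<integral>s. V s v \<partial>lborel) = - \<phi> y * indicator (cball 0 1) v"
      by eventually_elim (rule ray)
    show "(\<lambda>v. \<integral>s. V s v \<partial>lborel) \<in> borel_measurable lborel"
      unfolding V_def by measurable
  qed simp
  also have "\<dots> = - \<phi> y * pi"
    using content_cball[of 1 "0 :: real ^ 2"] by (simp add: unit_ball_vol_2)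
  finally have "pi * (\<integral>x. biot_savart_kernel x \<bullet> perp (g (x + y)) \<partial>lborel) = pi * - \<phi> y"
    by (simp only: mult.commute)
  then show ?thesis by (simp only: mult_cancel_left pi_neq_zero simp_thms)
qed

end

section \<open>Gradients of test functions\<close>

definition gradient :: "(real ^ 2 \<Rightarrow> real) \<Rightarrow> real ^ 2 \<Rightarrow> real ^ 2" where
  "gradient \<phi> x = vector [partial_deriv 1 \<phi> x, partial_deriv 2 \<phi> x]"

lemma gradient_nth [simp]: "gradient \<phi> x $ 1 = partial_deriv 1 \<phi> x" "gradient \<phi> x $ 2 = partial_deriv 2 \<phi> x"
  by (simp_all add: gradient_def)

lemma has_derivative_gradient:
  assumes "\<phi> differentiable (at x)"
  shows "(\<phi> has_derivative (\<lambda>v. v \<bullet> gradient \<phi> x)) (at x)"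
proof -
  have d: "(\<phi> has_derivative frechet_derivative \<phi> (at x)) (at x)"
    using assms by (simp only: frechet_derivative_works)
  then have l: "linear (frechet_derivative \<phi> (at x))" by (rule has_derivative_linear)
  have "frechet_derivative \<phi> (at x) v = v \<bullet> gradient \<phi> x" for v
  proof -
    have "v = v $ 1 *\<^sub>R axis 1 1 + v $ 2 *\<^sub>R axis 2 1"
      by (rule vec2_eqI) (simp_all add: axis_def)
    then have "frechet_derivative \<phi> (at x) v = frechet_derivative \<phi> (at x) (v $ 1 *\<^sub>R axis 1 1 + v $ 2 *\<^sub>R axis 2 1)"
      by simp
    also have "\<dots> = v \<bullet> gradient \<phi> x"
      by (simp add: linear_add[OF l] linear_scale[OF l] inner_real2 partial_deriv_def)
    finally show ?thesis .
  qed
  then have "frechet_derivative \<phi> (at x) = (\<lambda>v. v \<bullet> gradient \<phi> x)" by auto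
  with d show ?thesis by simp
qed

lemma distr_div_eq: "distr_div u \<phi> = - (\<integral>x. u x \<bullet> gradient \<phi> x \<partial>lborel)"
  by (simp add: distr_div_def inner_real2)

lemma distr_curl_eq: "distr_curl u \<phi> = - (\<integral>x. u x \<bullet> perp (gradient \<phi> x) \<partial>lborel)"
  by (simp add: distr_curl_def inner_real2 algebra_simps)

lemma test_field_gradient:
  assumes "test_function \<phi>"
  shows "\<exists>\<rho>. test_field \<phi> (gradient \<phi>) \<rho>"
proof -
  have diff: "\<phi> differentiable (at x)" for x
    using assms by (auto simp: test_function_def dest: spec[of _ "Suc 0"])
  \<comment> \<open>Second-order differentiability serves to make the partial derivatives
    continuous.\<close>
  have "times_differentiable (Suc (Suc 0)) \<phi>"
    using assms unfolding test_function_def by blast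
  then have diff2: "partial_deriv i \<phi> differentiable (at x)" for i x by simp
  have "bounded (closure {x. \<phi> x \<noteq> 0})"
    using assms by (auto simp: test_function_def compact_imp_bounded)
  then obtain r where r: "r > 0" "\<And>x. x \<in> closure {x. \<phi> x \<noteq> 0} \<Longrightarrow> norm x \<le> r"
    by (auto simp: bounded_pos)
  have phi0: "\<phi> x = 0" if "norm x > r" for x
    using r(2)[of x] that closure_subset[of "{x. \<phi> x \<noteq> 0}"] by force
  show ?thesis
  \<comment> \<open>The radius is enlarged by 1 so that every point of norm at least
    \<open>r + 1\<close> lies in the open set \<open>- cball 0 r\<close> on which \<phi> is
    identically zero; there the gradient vanishes too.\<close>
  proof (intro exI[of _ "r + 1"] test_field.intro)
    show "(\<phi> has_derivative (\<lambda>v. v \<bullet> gradient \<phi> x)) (at x)" for x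
      using has_derivative_gradient[OF diff] .
    have "continuous_on UNIV (partial_deriv i \<phi>)" for i
      using diff2 by (auto intro!: continuous_at_imp_continuous_on differentiable_imp_continuous_within)
    then have "continuous_on UNIV (\<lambda>x. \<chi> i. partial_deriv i \<phi> x)"
      by (intro continuous_on_vec_lambda)
    also have "(\<lambda>x. \<chi> i. partial_deriv i \<phi> x) = gradient \<phi>"
      by (intro ext vec2_eqI) simp_all
    finally show "continuous_on UNIV (gradient \<phi>)" .
    show "0 < r + 1" using r by simp
    show "\<phi> x = 0" if "r + 1 \<le> norm x" for x using that by (intro phi0) simp
    show "gradient \<phi> x = 0" if "r + 1 \<le> norm x" for x
    proof -
      have "open (- cball (0 :: real ^ 2) r)" using closed_cball by (rule open_Compl)
      moreover have "x \<in> - cball 0 r" using that by simp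
      moreover have "0 = \<phi> z" if "z \<in> - cball 0 r" for z using that by (simp add: phi0)
      ultimately have "(\<phi> has_derivative (\<lambda>v. 0)) (at x)"
        using has_derivative_transform_within_open[OF has_derivative_const[of 0 "at x"], of "- cball 0 r" \<phi>] by blast
      then have "frechet_derivative \<phi> (at x) = (\<lambda>v. 0)"
        by (rule frechet_derivative_at[symmetric])
      then show ?thesis by (intro vec2_eqI) (simp_all add: partial_deriv_def)
    qed
  qed
qed

lemma measurable_gradient:
  assumes "test_function \<phi>"
  shows "gradient \<phi> \<in> borel_measurable borel"
proof -
  obtain \<rho> where "test_field \<phi> (gradient \<phi>) \<rho>" using test_field_gradient[OF assms] ..
  then show ?thesis
    by (intro borel_measurable_continuous_onI test_field.cont_g)
qed

text \<open>Serves to pass from a field written with one density to the Biot-Savart field itself,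
  since the two are identified only almost everywhere.\<close>

lemma
  assumes \<phi>: "test_function \<phi>"
    and [measurable]: "u \<in> borel_measurable borel" "v \<in> borel_measurable borel"
    and uv: "AE x in lborel. u x = v x"
  shows distr_div_cong_AE: "distr_div u \<phi> = distr_div v \<phi>"
    and distr_curl_cong_AE: "distr_curl u \<phi> = distr_curl v \<phi>"
proof -
  note measurable_gradient[OF \<phi>, measurable] measurable_compose[OF measurable_gradient[OF \<phi>] measurable_perp, measurable]
  have "(\<integral>x. u x \<bullet> gradient \<phi> x \<partial>lborel) = (\<integral>x. v x \<bullet> gradient \<phi> x \<partial>lborel)"
    using uv by (intro integral_cong_AE) auto
  moreover have "(\<integral>x. u x \<bullet> perp (gradient \<phi> x) \<partial>lborel) = (\<integral>x. v x \<bullet> perp (gradient \<phi> x) \<partial>lborel)"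
    using uv by (intro integral_cong_AE) auto
  ultimately show "distr_div u \<phi> = distr_div v \<phi>" "distr_curl u \<phi> = distr_curl v \<phi>"
    by (simp_all add: distr_div_eq distr_curl_eq)
qed

section \<open>The velocity field of a vorticity measure\<close>

text \<open>Translation invariance gives the squares of f (x + h) and of f x the same integral, and
  by square integrability these finite numbers cancel. Fubini then moves the integral over
  \<open>S\<close> onto the second factor, where it can act on the kernel.\<close>

lemma averaged_difference_identity:
  fixes f :: "'a::euclidean_space \<Rightarrow> 'b::euclidean_space"
  assumes f [measurable]: "f \<in> borel_measurable borel"
    and L2: "(\<integral>\<^sup>+x. ennreal ((norm (f x))\<^sup>2) \<partial>lborel) < \<infinity>"
    and S [measurable]: "S \<in> sets borel" and S_fin: "emeasure lborel S < \<infinity>"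
  shows "(\<integral>\<^sup>+h\<in>S. (\<integral>\<^sup>+x. ennreal ((norm (f (x + h) - f x))\<^sup>2) \<partial>lborel) \<partial>lborel) =
    ennreal (2 * (\<integral>x. f x \<bullet> (LINT h:S|lborel. f x - f (x + h)) \<partial>lborel))"
proof -
  let ?N = "\<integral>\<^sup>+x. ennreal ((norm (f x))\<^sup>2) \<partial>lborel"
  have i2: "integrable lborel (\<lambda>x. (norm (f x))\<^sup>2)"
    using L2 by (intro integrableI_bounded) auto
  have i2h: "integrable lborel (\<lambda>x. (norm (f (x + h)))\<^sup>2)" for h
    by (rule integrable_translate[OF i2])
  define F where "F h x = f x \<bullet> (f x - f (x + h))" for h x
  have F_le: "\<bar>F h x\<bar> \<le> 2 * (norm (f x))\<^sup>2 + (norm (f (x + h)))\<^sup>2" for h x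
  proof -
    have "\<bar>F h x\<bar> \<le> norm (f x) * norm (f x - f (x + h))"
      unfolding F_def by (rule Cauchy_Schwarz_ineq2)
    also have "\<dots> \<le> norm (f x) * (norm (f x) + norm (f (x + h)))"
      by (intro mult_left_mono norm_triangle_ineq4) auto
    also have "\<dots> \<le> 2 * (norm (f x))\<^sup>2 + (norm (f (x + h)))\<^sup>2"
      using sum_squares_bound[of "norm (f x)" "norm (f (x + h))"]
        zero_le_power2[of "norm (f x)"] zero_le_power2[of "norm (f (x + h))"]
      unfolding power2_eq_square distrib_left by linarith
    finally show ?thesis .
  qed
  have iF: "integrable lborel (F h)" for h
  proof (rule Bochner_Integration.integrable_bound)
    show "integrable lborel (\<lambda>x. 2 * (norm (f x))\<^sup>2 + (norm (f (x + h)))\<^sup>2)"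
      by (intro Bochner_Integration.integrable_add integrable_mult_right i2 i2h)
    show "F h \<in> borel_measurable lborel" unfolding F_def by measurable
    show "AE x in lborel. norm (F h x) \<le> norm (2 * (norm (f x))\<^sup>2 + (norm (f (x + h)))\<^sup>2)"
      using F_le by (auto intro: order_trans[OF _ abs_ge_self])
  qed
  have sq: "(norm (f (x + h) - f x))\<^sup>2 = ((norm (f (x + h)))\<^sup>2 - (norm (f x))\<^sup>2) + 2 * F h x" for h x
    unfolding F_def power2_norm_eq_inner by (simp add: inner_diff inner_commute algebra_simps)
  define c where "c h = (\<integral>x. F h x \<partial>lborel)" for h
  have inner: "(\<integral>\<^sup>+x. ennreal ((norm (f (x + h) - f x))\<^sup>2) \<partial>lborel) = ennreal (2 * c h)" and c_nonneg: "0 \<le> c h" for h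
  proof -
    have i: "integrable lborel (\<lambda>x. (norm (f (x + h) - f x))\<^sup>2)"
      unfolding sq by (intro Bochner_Integration.integrable_add Bochner_Integration.integrable_diff integrable_mult_right i2 i2h iF)
    have "(\<integral>x. (norm (f (x + h) - f x))\<^sup>2 \<partial>lborel) =
        ((\<integral>x. (norm (f (x + h)))\<^sup>2 \<partial>lborel) - (\<integral>x. (norm (f x))\<^sup>2 \<partial>lborel)) + 2 * c h"
      unfolding sq c_def
      by (subst Bochner_Integration.integral_add)
        (auto intro!: Bochner_Integration.integrable_diff Bochner_Integration.integral_diff i2 i2h iF)
    then have eq: "(\<integral>x. (norm (f (x + h) - f x))\<^sup>2 \<partial>lborel) = 2 * c h"
      using integral_translate[of "\<lambda>x. (norm (f x))\<^sup>2" h] by simp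
    then show "(\<integral>\<^sup>+x. ennreal ((norm (f (x + h) - f x))\<^sup>2) \<partial>lborel) = ennreal (2 * c h)"
      using nn_integral_eq_integral[OF i] by simp
    show "0 \<le> c h" using eq Bochner_Integration.integral_nonneg[of lborel "\<lambda>x. (norm (f (x + h) - f x))\<^sup>2"] by simp
  qed
  define G where "G h x = indicator S h * F h x" for h x
  have [measurable]: "(\<lambda>p. G (fst p) (snd p)) \<in> borel_measurable (lborel \<Otimes>\<^sub>M lborel)"
    unfolding G_def F_def by measurable
  have iG: "integrable (lborel \<Otimes>\<^sub>M lborel) (\<lambda>(h, x). G h x)"
  proof (rule integrableI_bounded)
    have "(\<integral>\<^sup>+p. ennreal (norm (case p of (h, x) \<Rightarrow> G h x)) \<partial>(lborel \<Otimes>\<^sub>M lborel)) =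
        (\<integral>\<^sup>+h. \<integral>\<^sup>+x. ennreal \<bar>G h x\<bar> \<partial>lborel \<partial>lborel)"
      by (subst lborel.nn_integral_fst[symmetric]) (auto simp: case_prod_beta')
    also have "\<dots> \<le> (\<integral>\<^sup>+h. indicator S h * (2 * ?N + ?N) \<partial>lborel)"
    proof (rule nn_integral_mono)
      fix h :: 'a
      have "(\<integral>\<^sup>+x. ennreal \<bar>F h x\<bar> \<partial>lborel) \<le> (\<integral>\<^sup>+x. 2 * ennreal ((norm (f x))\<^sup>2) + ennreal ((norm (f (x + h)))\<^sup>2) \<partial>lborel)"
        using F_le[of h]
        by (intro nn_integral_mono) (simp add: ennreal_leI flip: ennreal_plus ennreal_mult'' ennreal_numeral)
      also have "\<dots> = 2 * ?N + ?N"
        by (simp add: nn_integral_add nn_integral_cmult nn_integral_translate[of "\<lambda>x. ennreal ((norm (f x))\<^sup>2)" h])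
      finally show "(\<integral>\<^sup>+x. ennreal \<bar>G h x\<bar> \<partial>lborel) \<le> indicator S h * (2 * ?N + ?N)"
        by (auto simp: G_def split: split_indicator)
    qed
    also have "\<dots> = emeasure lborel S * (2 * ?N + ?N)"
      by (subst nn_integral_multc) auto
    also have "\<dots> < \<infinity>" using L2 S_fin by (simp add: ennreal_mult_less_top)
    finally show "(\<integral>\<^sup>+p. ennreal (norm (case p of (h, x) \<Rightarrow> G h x)) \<partial>(lborel \<Otimes>\<^sub>M lborel)) < \<infinity>" .
  qed (simp add: case_prod_beta')
  have intG: "(\<integral>x. G h x \<partial>lborel) = indicator S h * c h" for h
    by (simp add: G_def c_def)
  have ic: "integrable lborel (\<lambda>h. indicator S h * c h)"
    using lborel_pair.integrable_fst'[OF iG] by (simp add: intG)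
  have "(\<integral>\<^sup>+h\<in>S. (\<integral>\<^sup>+x. ennreal ((norm (f (x + h) - f x))\<^sup>2) \<partial>lborel) \<partial>lborel) =
      (\<integral>\<^sup>+h. ennreal (2 * (indicator S h * c h)) \<partial>lborel)"
    by (intro nn_integral_cong) (auto simp: inner split: split_indicator)
  also have "\<dots> = ennreal (\<integral>h. 2 * (indicator S h * c h) \<partial>lborel)"
    by (intro nn_integral_eq_integral AE_I2 mult_nonneg_nonneg c_nonneg integrable_mult_right ic) auto
  also have "(\<integral>h. 2 * (indicator S h * c h) \<partial>lborel) = 2 * (\<integral>h. (\<integral>x. G h x \<partial>lborel) \<partial>lborel)"
    by (simp add: intG)
  also have "(\<integral>h. (\<integral>x. G h x \<partial>lborel) \<partial>lborel) = (\<integral>x. (\<integral>h. G h x \<partial>lborel) \<partial>lborel)"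
    using lborel_pair.Fubini_integral[OF iG] by simp
  also have "(\<lambda>x. \<integral>h. G h x \<partial>lborel) = (\<lambda>x. f x \<bullet> (LINT h:S|lborel. f x - f (x + h)))"
  proof
    fix x
    have "integrable lborel (\<lambda>h. indicator S h *\<^sub>R (f x - f (x + h)))"
    proof (rule Bochner_Integration.integrable_bound)
      \<comment> \<open>The bound a \<le> 1 + a^2 yields integrability over \<open>S\<close> at
        every \<open>x\<close>, so the identity of integrands needs no exceptional null set.\<close>
      show "integrable lborel (\<lambda>h. indicator S h * (norm (f x) + 1) + (norm (f (h + x)))\<^sup>2)"
        using S_fin by (intro Bochner_Integration.integrable_add i2h integrable_mult_left) auto
      have "norm (f x - f (x + h)) \<le> (norm (f x) + 1) + (norm (f (h + x)))\<^sup>2" for h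
      proof -
        have "norm (f (h + x)) \<le> 1 + (norm (f (h + x)))\<^sup>2"
          using sum_squares_bound[of 1 "norm (f (h + x))"] norm_ge_zero[of "f (h + x)"]
          unfolding power2_eq_square by linarith
        then show ?thesis using norm_triangle_ineq4[of "f x" "f (x + h)"] by (simp add: add.commute[of h])
      qed
      then show "AE h in lborel. norm (indicator S h *\<^sub>R (f x - f (x + h))) \<le> norm (indicator S h * (norm (f x) + 1) + (norm (f (h + x)))\<^sup>2)"
        by (auto split: split_indicator)
    qed measurable
    then have "f x \<bullet> (LINT h:S|lborel. f x - f (x + h)) = (\<integral>h. f x \<bullet> (indicator S h *\<^sub>R (f x - f (x + h))) \<partial>lborel)"
      unfolding set_lebesgue_integral_def by (subst integral_inner_right) auto
    also have "\<dots> = (\<integral>h. G h x \<partial>lborel)" by (simp add: G_def F_def)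
    finally show "(\<integral>h. G h x \<partial>lborel) = f x \<bullet> (LINT h:S|lborel. f x - f (x + h))" by simp
  qed
  finally show ?thesis .
qed

text \<open>Models \<omega> as the density \<sigma> times \<mu>, with all signs inside \<sigma>. The
  function \<open>Mx\<close> stands for the vorticity maximal function and is known only through
  measurability, its bounds from below and above, and the integral condition.\<close>

locale vorticity = finite_measure \<mu> for \<mu> :: "(real ^ 2) measure" +
  fixes \<sigma> :: "real ^ 2 \<Rightarrow> real" and Mx :: "real \<Rightarrow> ennreal"
  assumes sets_mu [simp, measurable_cong]: "sets \<mu> = sets borel"
    and measurable_sigma [measurable]: "\<sigma> \<in> borel_measurable borel" and sigma_le: "\<bar>\<sigma> y\<bar> \<le> 1"
    and measurable_Mx [measurable]: "Mx \<in> borel_measurable borel"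
    and emeasure_cball_le: "emeasure \<mu> (cball x s) \<le> Mx s"
    and Mx_le: "Mx s \<le> emeasure \<mu> UNIV"
    and dini: "(\<integral>\<^sup>+s\<in>{0<..1}. Mx s / ennreal s \<partial>lborel) < \<infinity>"
begin

abbreviation mass :: ennreal where "mass \<equiv> emeasure \<mu> UNIV"

definition dini_integral :: "real \<Rightarrow> ennreal" where
  "dini_integral r = (\<integral>\<^sup>+s\<in>{0<..r}. Mx s / ennreal s \<partial>lborel)"

lemma space_mu [simp]: "space \<mu> = UNIV"
  using sets_eq_imp_space_eq[OF sets_mu] by simp

lemma mass_finite: "mass < \<infinity>"
  by (metis emeasure_finite infinity_ennreal_def top.not_eq_extremum)

text \<open>For s \<ge> 1 the integrand is at most the total mass, so the condition on
  \<open>{0<..1}\<close> controls every bounded range of radii.\<close>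

lemma dini_integral_finite: "dini_integral r < \<infinity>"
proof -
  have "dini_integral r \<le> (\<integral>\<^sup>+s. Mx s / ennreal s * indicator {0<..1} s + mass * indicator {1..max 1 r} s \<partial>lborel)"
    unfolding dini_integral_def
  proof (intro nn_integral_mono)
    fix s :: real
    have "Mx s / ennreal s \<le> mass" if "s \<ge> 1"
    proof -
      have "Mx s / ennreal s = Mx s * ennreal (inverse s)"
        using that by (simp add: divide_ennreal_def inverse_ennreal)
      also have "\<dots> \<le> mass * ennreal 1"
        using that by (intro mult_mono Mx_le ennreal_leI) (auto simp: inverse_le_1_iff)
      finally show ?thesis by simp
    qed
    then show "Mx s / ennreal s * indicator {0<..r} s \<le> Mx s / ennreal s * indicator {0<..1} s + mass * indicator {1..max 1 r} s"
      by (auto split: split_indicator)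
  qed
  also have "\<dots> = (\<integral>\<^sup>+s\<in>{0<..1}. Mx s / ennreal s \<partial>lborel) + mass * ennreal (max 1 r - 1)"
    by (subst nn_integral_add) (auto simp: nn_integral_cmult)
  also have "\<dots> < \<infinity>" using dini mass_finite by (simp add: ennreal_mult_less_top)
  finally show ?thesis .
qed

text \<open>The point where the maximal function enters. After interchanging the integrals, the
  inner one is the mass of the closed ball of radius |x| around \<open>y\<close>, at most
  \<open>Mx\<close> at |x|; polar coordinates turn 1 / |x|^2 into 2 \<pi> / s.\<close>

lemma nn_integral_annulus_energy_le:
  "(\<integral>\<^sup>+z. annulus_energy r (norm (z - y)) \<partial>\<mu>) \<le> ennreal (2 * pi) * dini_integral r"
proof -
  interpret pair_sigma_finite \<mu> "lborel :: (real ^ 2) measure" ..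
  have "(\<integral>\<^sup>+z. annulus_energy r (norm (z - y)) \<partial>\<mu>) =
      (\<integral>\<^sup>+x. \<integral>\<^sup>+z. ennreal (1 / (norm (x :: real ^ 2))\<^sup>2) * indicator {norm (z - y)..<r} (norm x) \<partial>\<mu> \<partial>lborel)"
    unfolding annulus_energy_def
    by (intro Fubini'[symmetric]) (measurable, auto)
  also have "\<dots> \<le> (\<integral>\<^sup>+x. (ennreal (1 / (norm (x :: real ^ 2))\<^sup>2) * indicator {..<r} (norm x)) * Mx (norm x) \<partial>lborel)"
  proof (intro nn_integral_mono)
    fix x :: "real ^ 2"
    have "(\<integral>\<^sup>+z. ennreal (1 / (norm x)\<^sup>2) * indicator {norm (z - y)..<r} (norm x) \<partial>\<mu>) =
        (\<integral>\<^sup>+z. (ennreal (1 / (norm x)\<^sup>2) * indicator {..<r} (norm x)) * indicator (cball y (norm x)) z \<partial>\<mu>)"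
      by (intro nn_integral_cong) (auto simp: dist_norm norm_minus_commute split: split_indicator)
    also have "\<dots> = (ennreal (1 / (norm x)\<^sup>2) * indicator {..<r} (norm x)) * emeasure \<mu> (cball y (norm x))"
      by (subst nn_integral_cmult) auto
    also have "\<dots> \<le> (ennreal (1 / (norm x)\<^sup>2) * indicator {..<r} (norm x)) * Mx (norm x)"
      by (intro mult_left_mono emeasure_cball_le) auto
    finally show "(\<integral>\<^sup>+z. ennreal (1 / (norm x)\<^sup>2) * indicator {norm (z - y)..<r} (norm x) \<partial>\<mu>) \<le>
        (ennreal (1 / (norm x)\<^sup>2) * indicator {..<r} (norm x)) * Mx (norm x)" .
  qed
  also have "\<dots> = (\<integral>\<^sup>+s. ennreal (2 * pi * s) * ((ennreal (1 / s\<^sup>2) * indicator {..<r} s) * Mx s) * indicator {0<..} s \<partial>lborel)"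
    by (rule nn_integral_radial) measurable
  also have "\<dots> \<le> (\<integral>\<^sup>+s. ennreal (2 * pi) * (Mx s / ennreal s * indicator {0<..r} s) \<partial>lborel)"
  proof (intro nn_integral_mono)
    fix s :: real
    have "ennreal (2 * pi * s) * (ennreal (1 / s\<^sup>2) * Mx s) = ennreal (2 * pi) * (Mx s / ennreal s)" if "s > 0"
    proof -
      have "ennreal (2 * pi * s) * (ennreal (1 / s\<^sup>2) * Mx s) = ennreal (2 * pi * s * (1 / s\<^sup>2)) * Mx s"
        using that by (subst ennreal_mult) (auto simp only: mult.assoc intro!: mult_nonneg_nonneg, auto)
      also have "2 * pi * s * (1 / s\<^sup>2) = 2 * pi * inverse s"
        using that by (simp add: field_simps power2_eq_square)
      also have "ennreal (2 * pi * inverse s) * Mx s = ennreal (2 * pi) * (Mx s / ennreal s)"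
        using that by (simp add: ennreal_mult divide_ennreal_def inverse_ennreal mult_ac)
      finally show ?thesis .
    qed
    then show "ennreal (2 * pi * s) * ((ennreal (1 / s\<^sup>2) * indicator {..<r} s) * Mx s) * indicator {0<..} s \<le>
        ennreal (2 * pi) * (Mx s / ennreal s * indicator {0<..r} s)"
      by (auto split: split_indicator)
  qed
  also have "\<dots> = ennreal (2 * pi) * dini_integral r"
    unfolding dini_integral_def by (intro nn_integral_cmult) measurable
  finally show ?thesis .
qed

section \<open>Potentials of the measure and their square integrability\<close>

text \<open>A scalar majorant of the truncated velocity. Its finiteness at a point is the criterion
  for convergence of the vector-valued integrals there.\<close>

definition abs_potential :: "real \<Rightarrow> real ^ 2 \<Rightarrow> ennreal" where
  "abs_potential R x = (\<integral>\<^sup>+y. ennreal (norm (trunc_kernel R (x - y))) \<partial>\<mu>)"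

lemma measurable_abs_potential [measurable (raw)]:
  assumes "f \<in> borel_measurable M"
  shows "(\<lambda>x. abs_potential R (f x)) \<in> borel_measurable M"
proof -
  have "abs_potential R \<in> borel_measurable borel" unfolding abs_potential_def by measurable
  from measurable_compose[OF assms this] show ?thesis .
qed

lemma abs_potential_mono: "R \<le> R' \<Longrightarrow> abs_potential R x \<le> abs_potential R' x"
  unfolding abs_potential_def by (intro nn_integral_mono ennreal_leI) (auto simp: norm_trunc_kernel)

lemma nn_integral_abs_potential:
  assumes "R \<ge> 0"
  shows "(\<integral>\<^sup>+x. abs_potential R x \<partial>lborel) = ennreal R * mass"
proof -
  interpret pair_sigma_finite \<mu> "lborel :: (real ^ 2) measure" ..
  have "(\<integral>\<^sup>+x. abs_potential R x \<partial>lborel) = (\<integral>\<^sup>+y. \<integral>\<^sup>+x. ennreal (norm (trunc_kernel R (x - y))) \<partial>lborel \<partial>\<mu>)"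
    unfolding abs_potential_def by (intro Fubini') measurable
  also have "\<dots> = (\<integral>\<^sup>+y. ennreal R \<partial>\<mu>)"
    using assms nn_integral_translate[of "\<lambda>x. ennreal (norm (trunc_kernel R x))"]
    by (simp add: nn_integral_trunc_kernel flip: add_uminus_conv_diff)
  finally show ?thesis by simp
qed

lemma AE_abs_potential_finite: "AE x in lborel. abs_potential R x < \<infinity>"
proof -
  have "(\<integral>\<^sup>+x. abs_potential (max 0 R) x \<partial>lborel) \<noteq> \<infinity>"
    using mass_finite by (simp add: nn_integral_abs_potential ennreal_mult_eq_top_iff)
  then have "AE x in lborel. abs_potential (max 0 R) x \<noteq> \<infinity>"
    by (intro nn_integral_noteq_infinite) auto
  then show ?thesis
  proof eventually_elim
    fix x assume "abs_potential (max 0 R) x \<noteq> \<infinity>"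
    then show "abs_potential R x < \<infinity>"
      using abs_potential_mono[of R "max 0 R" x] by (simp add: top.not_eq_extremum order.strict_trans1)
  qed
qed

lemma nn_integral_product:
  fixes f g :: "real ^ 2 \<Rightarrow> ennreal"
  assumes [measurable]: "f \<in> borel_measurable borel" "g \<in> borel_measurable borel"
  shows "(\<integral>\<^sup>+p. f (fst p) * g (snd p) \<partial>(\<mu> \<Otimes>\<^sub>M \<mu>)) = (\<integral>\<^sup>+y. f y \<partial>\<mu>) * (\<integral>\<^sup>+z. g z \<partial>\<mu>)"
  by (subst nn_integral_fst[symmetric]) (auto simp: nn_integral_cmult nn_integral_multc)

text \<open>The square is written as a double integral over \<mu> \<times> \<mu>. Integrating in x
  first leaves the product bound for two kernels, whose annulus part is controlled by the integral
  of \<open>Mx\<close>, uniformly in the first point.\<close>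

lemma nn_integral_abs_potential_square: "(\<integral>\<^sup>+x. (abs_potential R x)\<^sup>2 \<partial>lborel) < \<infinity>"
proof -
  interpret P: pair_sigma_finite \<mu> \<mu> ..
  interpret Q: pair_sigma_finite "\<mu> \<Otimes>\<^sub>M \<mu>" "lborel :: (real ^ 2) measure" ..
  let ?n = "\<lambda>x. ennreal (norm (trunc_kernel R x))"
  have "(\<integral>\<^sup>+x. (abs_potential R x)\<^sup>2 \<partial>lborel) = (\<integral>\<^sup>+x. \<integral>\<^sup>+p. ?n (x - fst p) * ?n (x - snd p) \<partial>(\<mu> \<Otimes>\<^sub>M \<mu>) \<partial>lborel)"
    unfolding abs_potential_def by (subst nn_integral_product) (auto simp: power2_eq_square)
  also have "\<dots> = (\<integral>\<^sup>+p. \<integral>\<^sup>+x. ?n (x - fst p) * ?n (x - snd p) \<partial>lborel \<partial>(\<mu> \<Otimes>\<^sub>M \<mu>))"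
    by (intro Q.Fubini') measurable
  also have "\<dots> \<le> (\<integral>\<^sup>+p. 2 * (annulus_energy R (norm (snd p - fst p)) + 1) \<partial>(\<mu> \<Otimes>\<^sub>M \<mu>))"
  proof (intro nn_integral_mono)
    fix p :: "(real ^ 2) \<times> (real ^ 2)"
    have "(\<integral>\<^sup>+x. ?n (x - fst p) * ?n (x - snd p) \<partial>lborel) = (\<integral>\<^sup>+x. ?n (x + fst p - fst p) * ?n (x + fst p - snd p) \<partial>lborel)"
      by (rule nn_integral_translate[symmetric]) measurable
    also have "\<dots> = (\<integral>\<^sup>+x. ennreal (norm (trunc_kernel R x) * norm (trunc_kernel R (x + (fst p - snd p)))) \<partial>lborel)"
      by (simp add: ennreal_mult' algebra_simps)
    also have "\<dots> \<le> 2 * (annulus_energy R (norm (fst p - snd p)) + 1)"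
      by (rule nn_integral_trunc_kernel_product_le)
    finally show "(\<integral>\<^sup>+x. ?n (x - fst p) * ?n (x - snd p) \<partial>lborel) \<le> 2 * (annulus_energy R (norm (snd p - fst p)) + 1)"
      by (simp add: norm_minus_commute)
  qed
  also have "\<dots> = (\<integral>\<^sup>+y. \<integral>\<^sup>+z. 2 * (annulus_energy R (norm (z - y)) + 1) \<partial>\<mu> \<partial>\<mu>)"
    by (subst nn_integral_fst[symmetric]) auto
  also have "\<dots> \<le> (\<integral>\<^sup>+y. 2 * (ennreal (2 * pi) * dini_integral R + mass) \<partial>\<mu>)"
  proof (intro nn_integral_mono)
    fix y
    have "(\<integral>\<^sup>+z. 2 * (annulus_energy R (norm (z - y)) + 1) \<partial>\<mu>) = 2 * ((\<integral>\<^sup>+z. annulus_energy R (norm (z - y)) \<partial>\<mu>) + mass)"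
      by (simp add: nn_integral_cmult nn_integral_add)
    also have "\<dots> \<le> 2 * (ennreal (2 * pi) * dini_integral R + mass)"
      by (intro mult_left_mono add_right_mono nn_integral_annulus_energy_le) auto
    finally show "(\<integral>\<^sup>+z. 2 * (annulus_energy R (norm (z - y)) + 1) \<partial>\<mu>) \<le> 2 * (ennreal (2 * pi) * dini_integral R + mass)" .
  qed
  also have "\<dots> < \<infinity>"
    using mass_finite dini_integral_finite[of R] by (simp add: ennreal_mult_less_top)
  finally show ?thesis .
qed

lemmas nn_integral_fst_mu = nn_integral_fst

definition trunc_velocity :: "real \<Rightarrow> real ^ 2 \<Rightarrow> real ^ 2" where
  "trunc_velocity R x = (\<integral>y. \<sigma> y *\<^sub>R trunc_kernel R (x - y) \<partial>\<mu>)"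

definition diff_velocity :: "real \<Rightarrow> real \<Rightarrow> real ^ 2 \<Rightarrow> real ^ 2" where
  "diff_velocity R r x = (\<integral>z. \<sigma> z *\<^sub>R diff_kernel R r (x - z) \<partial>\<mu>)"

lemma measurable_trunc_velocity [measurable (raw)]:
  assumes "f \<in> borel_measurable M"
  shows "(\<lambda>x. trunc_velocity R (f x)) \<in> borel_measurable M"
proof -
  have "trunc_velocity R \<in> borel_measurable borel" unfolding trunc_velocity_def by measurable
  from measurable_compose[OF assms this] show ?thesis .
qed

lemma measurable_diff_velocity [measurable]: "diff_velocity R r \<in> borel_measurable borel"
  unfolding diff_velocity_def by measurable

lemma sigma_scaleR_le: "norm (\<sigma> y *\<^sub>R v) \<le> norm v"
  using sigma_le[of y] by (simp add: mult_left_le_one_le)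

lemma norm_trunc_velocity_le: "ennreal (norm (trunc_velocity R x)) \<le> abs_potential R x"
proof -
  have "ennreal (norm (trunc_velocity R x)) \<le> (\<integral>\<^sup>+y. ennreal (norm (\<sigma> y *\<^sub>R trunc_kernel R (x - y))) \<partial>\<mu>)"
    unfolding trunc_velocity_def by (rule ennreal_norm_integral_le)
  also have "\<dots> \<le> abs_potential R x"
    unfolding abs_potential_def by (intro nn_integral_mono ennreal_leI sigma_scaleR_le)
  finally show ?thesis .
qed

lemma integrable_trunc_potential:
  assumes "abs_potential R x < \<infinity>"
  shows "integrable \<mu> (\<lambda>y. \<sigma> y *\<^sub>R trunc_kernel R (x - y))"
proof (rule integrableI_bounded)
  have "(\<integral>\<^sup>+y. ennreal (norm (\<sigma> y *\<^sub>R trunc_kernel R (x - y))) \<partial>\<mu>) \<le> abs_potential R x"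
    unfolding abs_potential_def by (intro nn_integral_mono ennreal_leI sigma_scaleR_le)
  with assms show "(\<integral>\<^sup>+y. ennreal (norm (\<sigma> y *\<^sub>R trunc_kernel R (x - y))) \<partial>\<mu>) < \<infinity>" by simp
qed measurable

lemma nn_integral_diff_kernel_le:
  assumes "r > 0" "4 * r \<le> R"
  shows "(\<integral>\<^sup>+z. ennreal (norm (\<sigma> z *\<^sub>R diff_kernel R r (x - z))) \<partial>\<mu>) \<le> ennreal (8 * pi * r\<^sup>2) * abs_potential (2 * R) x"
proof -
  have "(\<integral>\<^sup>+z. ennreal (norm (\<sigma> z *\<^sub>R diff_kernel R r (x - z))) \<partial>\<mu>) \<le>
      (\<integral>\<^sup>+z. ennreal (8 * pi * r\<^sup>2) * ennreal (norm (trunc_kernel (2 * R) (x - z))) \<partial>\<mu>)"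
    using order_trans[OF sigma_scaleR_le norm_diff_kernel_le[OF assms]]
    by (intro nn_integral_mono) (simp add: ennreal_leI flip: ennreal_mult)
  also have "\<dots> = ennreal (8 * pi * r\<^sup>2) * abs_potential (2 * R) x"
    unfolding abs_potential_def by (intro nn_integral_cmult) measurable
  finally show ?thesis .
qed

lemma integrable_diff_potential:
  assumes "r > 0" "4 * r \<le> R" "abs_potential (2 * R) x < \<infinity>"
  shows "integrable \<mu> (\<lambda>z. \<sigma> z *\<^sub>R diff_kernel R r (x - z))"
proof (rule integrableI_bounded)
  show "(\<integral>\<^sup>+z. ennreal (norm (\<sigma> z *\<^sub>R diff_kernel R r (x - z))) \<partial>\<mu>) < \<infinity>"
    by (rule order_le_less_trans[OF nn_integral_diff_kernel_le[OF assms(1,2)]])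
      (use assms(3) in \<open>simp add: ennreal_mult_less_top\<close>)
qed measurable

text \<open>Averaging in h commutes with the integral against \<mu>. Fubini is justified because the
  potential at h + x, integrated over all h, equals R times the mass, while the potential at
  \<open>x\<close> itself is finite by assumption.\<close>

lemma averaged_trunc_velocity:
  assumes r: "r > 0" and R: "R \<ge> 0" and x: "abs_potential R x < \<infinity>"
  shows "(LINT h:ball 0 r|lborel. trunc_velocity R x - trunc_velocity R (x + h)) = diff_velocity R r x"
proof -
  interpret pair_sigma_finite "lborel :: (real ^ 2) measure" \<mu> ..
  define H where "H h z = indicator (ball 0 r) h *\<^sub>R (\<sigma> z *\<^sub>R (trunc_kernel R (x - z) - trunc_kernel R (x - z + h)))" for h z
  have [measurable]: "(\<lambda>p. H (fst p) (snd p)) \<in> borel_measurable (lborel \<Otimes>\<^sub>M \<mu>)"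
    unfolding H_def by measurable
  have iH: "integrable (lborel \<Otimes>\<^sub>M \<mu>) (\<lambda>(h, z). H h z)"
  proof (rule integrableI_bounded)
    have "(\<integral>\<^sup>+p. ennreal (norm (case p of (h, z) \<Rightarrow> H h z)) \<partial>(lborel \<Otimes>\<^sub>M \<mu>)) = (\<integral>\<^sup>+h. \<integral>\<^sup>+z. ennreal (norm (H h z)) \<partial>\<mu> \<partial>lborel)"
      by (subst nn_integral_fst_mu[symmetric]) (auto simp: case_prod_beta')
    also have "\<dots> \<le> (\<integral>\<^sup>+h. indicator (ball 0 r) h * abs_potential R x + abs_potential R (h + x) \<partial>lborel)"
    proof (intro nn_integral_mono)
      fix h :: "real ^ 2"
      have "(\<integral>\<^sup>+z. ennreal (norm (H h z)) \<partial>\<mu>) \<le>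
          (\<integral>\<^sup>+z. indicator (ball 0 r) h * (ennreal (norm (trunc_kernel R (x - z))) + ennreal (norm (trunc_kernel R (h + x - z)))) \<partial>\<mu>)"
      proof (intro nn_integral_mono)
        fix z
        have "norm (\<sigma> z *\<^sub>R (trunc_kernel R (x - z) - trunc_kernel R (x - z + h))) \<le> norm (trunc_kernel R (x - z)) + norm (trunc_kernel R (h + x - z))"
          by (rule order_trans[OF sigma_scaleR_le]) (use norm_triangle_ineq4 in \<open>simp add: algebra_simps\<close>)
        then show "ennreal (norm (H h z)) \<le> indicator (ball 0 r) h * (ennreal (norm (trunc_kernel R (x - z))) + ennreal (norm (trunc_kernel R (h + x - z))))"
          by (auto simp: H_def ennreal_leI split: split_indicator simp flip: ennreal_plus)
      qed
      also have "\<dots> = indicator (ball 0 r) h * (abs_potential R x + abs_potential R (h + x))"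
        unfolding abs_potential_def by (simp add: nn_integral_cmult nn_integral_add)
      also have "\<dots> \<le> indicator (ball 0 r) h * abs_potential R x + abs_potential R (h + x)"
        by (auto split: split_indicator)
      finally show "(\<integral>\<^sup>+z. ennreal (norm (H h z)) \<partial>\<mu>) \<le> indicator (ball 0 r) h * abs_potential R x + abs_potential R (h + x)" .
    qed
    also have "\<dots> = emeasure lborel (ball (0 :: real ^ 2) r) * abs_potential R x + ennreal R * mass"
      using R by (simp add: nn_integral_add nn_integral_multc nn_integral_translate nn_integral_abs_potential)
    also have "\<dots> < \<infinity>"
      using x mass_finite emeasure_lborel_ball_finite[of "0 :: real ^ 2" r] by (simp add: ennreal_mult_less_top)
    finally show "(\<integral>\<^sup>+p. ennreal (norm (case p of (h, z) \<Rightarrow> H h z)) \<partial>(lborel \<Otimes>\<^sub>M \<mu>)) < \<infinity>" .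
  qed (simp add: case_prod_beta')
  have "AE v in lborel. abs_potential R v < \<infinity>" by (rule AE_abs_potential_finite)
  then have "AE h in lborel. abs_potential R (x + h) < \<infinity>"
    by (rule AE_translate)
  then have "AE h in lborel. indicator (ball 0 r) h *\<^sub>R (trunc_velocity R x - trunc_velocity R (x + h)) = (\<integral>z. H h z \<partial>\<mu>)"
  proof eventually_elim
    fix h assume h: "abs_potential R (x + h) < \<infinity>"
    have "trunc_velocity R x - trunc_velocity R (x + h) =
        (\<integral>z. \<sigma> z *\<^sub>R trunc_kernel R (x - z) - \<sigma> z *\<^sub>R trunc_kernel R (x + h - z) \<partial>\<mu>)"
      unfolding trunc_velocity_def
      by (intro Bochner_Integration.integral_diff[symmetric] integrable_trunc_potential x h)
    then show "indicator (ball 0 r) h *\<^sub>R (trunc_velocity R x - trunc_velocity R (x + h)) = (\<integral>z. H h z \<partial>\<mu>)"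
      by (simp only: H_def integral_scaleR_right flip: scaleR_diff_right) (simp only: diff_add_eq)
  qed
  then have "(LINT h:ball 0 r|lborel. trunc_velocity R x - trunc_velocity R (x + h)) = (\<integral>h. (\<integral>z. H h z \<partial>\<mu>) \<partial>lborel)"
    unfolding set_lebesgue_integral_def by (intro integral_cong_AE) (auto simp: H_def)
  also have "\<dots> = (\<integral>z. (\<integral>h. H h z \<partial>lborel) \<partial>\<mu>)"
    using Fubini_integral[OF iH] by simp
  also have "\<dots> = diff_velocity R r x"
    unfolding diff_velocity_def diff_kernel_def set_lebesgue_integral_def H_def
    by (simp only: scaleR_left_commute[of _ "\<sigma> _"] integral_scaleR_right)
  finally show ?thesis .
qed

section \<open>The energy of the truncated velocity\<close>

definition energy_error :: "real \<Rightarrow> real \<Rightarrow> real" where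
  "energy_error r R = r ^ 3 / (2 * R) + 2 * r\<^sup>2 * (1 + 2 * r) / sqrt R"

text \<open>Integrating in x before \<mu> \<times> \<mu> and shifting by z leaves the pairing at
  displacement z - y, multiplied by \<open>\<sigma> y * \<sigma> z\<close>. Only the modulus of this
  factor is used, so the kernel estimate can be integrated against the positive product
  measure.\<close>

lemma trunc_energy_le:
  assumes r: "r > 0" and R: "4 * r \<le> R"
  shows "ennreal \<bar>\<integral>x. trunc_velocity R x \<bullet> diff_velocity R r x \<partial>lborel\<bar> \<le>
    ennreal (r\<^sup>2 / 2) * mass * dini_integral r + ennreal (energy_error r R) * mass * mass"
proof -
  interpret P: pair_sigma_finite \<mu> \<mu> ..
  interpret Q: pair_sigma_finite "lborel :: (real ^ 2) measure" "\<mu> \<Otimes>\<^sub>M \<mu>" ..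
  define f where "f x p = (\<sigma> (fst p) *\<^sub>R trunc_kernel R (x - fst p)) \<bullet> (\<sigma> (snd p) *\<^sub>R diff_kernel R r (x - snd p))" for x p
  have [measurable]: "(\<lambda>q. f (fst q) (snd q)) \<in> borel_measurable (lborel \<Otimes>\<^sub>M (\<mu> \<Otimes>\<^sub>M \<mu>))"
    unfolding f_def by measurable
  \<comment> \<open>The majorant for Fubini: both factors are compared with the potential at cutoff
    \<open>2 * R\<close>, whose square is integrable.\<close>
  have bound: "(\<integral>\<^sup>+p. ennreal \<bar>f x p\<bar> \<partial>(\<mu> \<Otimes>\<^sub>M \<mu>)) \<le> ennreal (8 * pi * r\<^sup>2) * (abs_potential (2 * R) x)\<^sup>2" for x
  proof -
    have "(\<integral>\<^sup>+p. ennreal \<bar>f x p\<bar> \<partial>(\<mu> \<Otimes>\<^sub>M \<mu>)) \<le>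
        (\<integral>\<^sup>+p. ennreal (norm (trunc_kernel R (x - fst p))) * ennreal (norm (\<sigma> (snd p) *\<^sub>R diff_kernel R r (x - snd p))) \<partial>(\<mu> \<Otimes>\<^sub>M \<mu>))"
    proof (intro nn_integral_mono)
      fix p
      have "\<bar>f x p\<bar> \<le> norm (\<sigma> (fst p) *\<^sub>R trunc_kernel R (x - fst p)) * norm (\<sigma> (snd p) *\<^sub>R diff_kernel R r (x - snd p))"
        unfolding f_def by (rule Cauchy_Schwarz_ineq2)
      also have "\<dots> \<le> norm (trunc_kernel R (x - fst p)) * norm (\<sigma> (snd p) *\<^sub>R diff_kernel R r (x - snd p))"
        by (intro mult_right_mono sigma_scaleR_le) auto
      finally show "ennreal \<bar>f x p\<bar> \<le> ennreal (norm (trunc_kernel R (x - fst p))) * ennreal (norm (\<sigma> (snd p) *\<^sub>R diff_kernel R r (x - snd p)))"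
        by (subst ennreal_mult[symmetric]) (auto intro: ennreal_leI)
    qed
    also have "\<dots> = abs_potential R x * (\<integral>\<^sup>+z. ennreal (norm (\<sigma> z *\<^sub>R diff_kernel R r (x - z))) \<partial>\<mu>)"
      unfolding abs_potential_def by (rule nn_integral_product) measurable
    also have "\<dots> \<le> abs_potential (2 * R) x * (ennreal (8 * pi * r\<^sup>2) * abs_potential (2 * R) x)"
      using r R by (intro mult_mono abs_potential_mono nn_integral_diff_kernel_le) auto
    finally show ?thesis by (simp add: power2_eq_square mult_ac)
  qed
  have int_f: "integrable (lborel \<Otimes>\<^sub>M (\<mu> \<Otimes>\<^sub>M \<mu>)) (\<lambda>(x, p). f x p)"
  proof (rule integrableI_bounded)
    have "(\<integral>\<^sup>+q. ennreal (norm (case q of (x, p) \<Rightarrow> f x p)) \<partial>(lborel \<Otimes>\<^sub>M (\<mu> \<Otimes>\<^sub>M \<mu>))) =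
        (\<integral>\<^sup>+x. \<integral>\<^sup>+p. ennreal \<bar>f x p\<bar> \<partial>(\<mu> \<Otimes>\<^sub>M \<mu>) \<partial>lborel)"
      by (subst sigma_finite_measure.nn_integral_fst[OF P.sigma_finite_measure_axioms, symmetric]) (auto simp: case_prod_beta')
    also have "\<dots> \<le> (\<integral>\<^sup>+x. ennreal (8 * pi * r\<^sup>2) * (abs_potential (2 * R) x)\<^sup>2 \<partial>lborel)"
      by (intro nn_integral_mono bound)
    also have "\<dots> = ennreal (8 * pi * r\<^sup>2) * (\<integral>\<^sup>+x. (abs_potential (2 * R) x)\<^sup>2 \<partial>lborel)"
      by (intro nn_integral_cmult) measurable
    also have "\<dots> < \<infinity>"
      using nn_integral_abs_potential_square[of "2 * R"] by (simp add: ennreal_mult_less_top)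
    finally show "(\<integral>\<^sup>+q. ennreal (norm (case q of (x, p) \<Rightarrow> f x p)) \<partial>(lborel \<Otimes>\<^sub>M (\<mu> \<Otimes>\<^sub>M \<mu>))) < \<infinity>" .
  qed (simp add: case_prod_beta')
  have "AE x in lborel. trunc_velocity R x \<bullet> diff_velocity R r x = (\<integral>p. f x p \<partial>(\<mu> \<Otimes>\<^sub>M \<mu>))"
    using AE_abs_potential_finite[of R] AE_abs_potential_finite[of "2 * R"] Q.AE_integrable_fst'[OF int_f]
  proof eventually_elim
    fix x assume x: "abs_potential R x < \<infinity>" "abs_potential (2 * R) x < \<infinity>"
      and i: "integrable (\<mu> \<Otimes>\<^sub>M \<mu>) (\<lambda>p. case (x, p) of (x, p) \<Rightarrow> f x p)"
    have "(\<integral>p. f x p \<partial>(\<mu> \<Otimes>\<^sub>M \<mu>)) = (\<integral>y. (\<integral>z. f x (y, z) \<partial>\<mu>) \<partial>\<mu>)"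
      using P.integral_fst'[of "f x"] i by simp
    also have "\<dots> = (\<integral>y. (\<sigma> y *\<^sub>R trunc_kernel R (x - y)) \<bullet> diff_velocity R r x \<partial>\<mu>)"
      unfolding f_def diff_velocity_def fst_conv snd_conv
      using integrable_diff_potential[OF r R x(2)] by (subst integral_inner_right) auto
    also have "\<dots> = trunc_velocity R x \<bullet> diff_velocity R r x"
      unfolding trunc_velocity_def using integrable_trunc_potential[OF x(1)] by (subst integral_inner_left) auto
    finally show "trunc_velocity R x \<bullet> diff_velocity R r x = (\<integral>p. f x p \<partial>(\<mu> \<Otimes>\<^sub>M \<mu>))" by simp
  qed
  then have "(\<integral>x. trunc_velocity R x \<bullet> diff_velocity R r x \<partial>lborel) = (\<integral>x. (\<integral>p. f x p \<partial>(\<mu> \<Otimes>\<^sub>M \<mu>)) \<partial>lborel)"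
    by (intro integral_cong_AE) measurable
  also have "\<dots> = (\<integral>p. (\<integral>x. f x p \<partial>lborel) \<partial>(\<mu> \<Otimes>\<^sub>M \<mu>))"
    using Q.Fubini_integral[OF int_f] by simp
  finally have "ennreal \<bar>\<integral>x. trunc_velocity R x \<bullet> diff_velocity R r x \<partial>lborel\<bar> \<le>
      (\<integral>\<^sup>+p. ennreal \<bar>\<integral>x. f x p \<partial>lborel\<bar> \<partial>(\<mu> \<Otimes>\<^sub>M \<mu>))"
    using ennreal_norm_integral_le[of "\<mu> \<Otimes>\<^sub>M \<mu>" "\<lambda>p. \<integral>x. f x p \<partial>lborel"] by simp
  also have "\<dots> \<le> (\<integral>\<^sup>+p. ennreal (r\<^sup>2 / (4 * pi)) * annulus_energy r (norm (fst p - snd p)) + ennreal (energy_error r R) \<partial>(\<mu> \<Otimes>\<^sub>M \<mu>))"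
  proof (intro nn_integral_mono)
    fix p :: "(real ^ 2) \<times> (real ^ 2)"
    obtain y z where p: "p = (y, z)" by force
    have "(\<integral>x. f x p \<partial>lborel) = (\<integral>x. f (x + z) p \<partial>lborel)"
      by (rule integral_translate[symmetric]) (simp add: f_def)
    also have "\<dots> = (\<integral>x. (\<sigma> y * \<sigma> z) * (trunc_kernel R (x + (z - y)) \<bullet> diff_kernel R r x) \<partial>lborel)"
      by (intro Bochner_Integration.integral_cong) (auto simp: f_def p algebra_simps)
    also have "\<dots> = (\<sigma> y * \<sigma> z) * (\<integral>x. trunc_kernel R (x + (z - y)) \<bullet> diff_kernel R r x \<partial>lborel)"
      by simp
    also have "\<bar>\<dots>\<bar> \<le> \<bar>\<integral>x. trunc_kernel R (x + (z - y)) \<bullet> diff_kernel R r x \<partial>lborel\<bar>"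
      using sigma_le[of y] sigma_le[of z] unfolding abs_mult
      by (intro mult_left_le_one_le mult_le_one) auto
    finally have "ennreal \<bar>\<integral>x. f x p \<partial>lborel\<bar> \<le> ennreal \<bar>\<integral>x. trunc_kernel R (x + (z - y)) \<bullet> diff_kernel R r x \<partial>lborel\<bar>"
      by (rule ennreal_leI)
    also have "\<dots> \<le> ennreal (r\<^sup>2 / (4 * pi)) * annulus_energy r (norm (z - y)) + ennreal (energy_error r R)"
      unfolding energy_error_def by (rule truncated_cross_le[OF r R])
    finally show "ennreal \<bar>\<integral>x. f x p \<partial>lborel\<bar> \<le> ennreal (r\<^sup>2 / (4 * pi)) * annulus_energy r (norm (fst p - snd p)) + ennreal (energy_error r R)"
      by (simp add: p norm_minus_commute)
  qed
  also have "\<dots> = (\<integral>\<^sup>+y. \<integral>\<^sup>+z. ennreal (r\<^sup>2 / (4 * pi)) * annulus_energy r (norm (y - z)) + ennreal (energy_error r R) \<partial>\<mu> \<partial>\<mu>)"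
    by (subst nn_integral_fst[symmetric]) auto
  also have "\<dots> \<le> (\<integral>\<^sup>+y. ennreal (r\<^sup>2 / (4 * pi)) * (ennreal (2 * pi) * dini_integral r) + ennreal (energy_error r R) * mass \<partial>\<mu>)"
  proof (intro nn_integral_mono)
    fix y
    have "(\<integral>\<^sup>+z. ennreal (r\<^sup>2 / (4 * pi)) * annulus_energy r (norm (y - z)) + ennreal (energy_error r R) \<partial>\<mu>) =
        ennreal (r\<^sup>2 / (4 * pi)) * (\<integral>\<^sup>+z. annulus_energy r (norm (z - y)) \<partial>\<mu>) + ennreal (energy_error r R) * mass"
      by (simp add: nn_integral_add nn_integral_cmult norm_minus_commute)
    also have "\<dots> \<le> ennreal (r\<^sup>2 / (4 * pi)) * (ennreal (2 * pi) * dini_integral r) + ennreal (energy_error r R) * mass"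
      by (intro add_right_mono mult_left_mono nn_integral_annulus_energy_le) auto
    finally show "(\<integral>\<^sup>+z. ennreal (r\<^sup>2 / (4 * pi)) * annulus_energy r (norm (y - z)) + ennreal (energy_error r R) \<partial>\<mu>) \<le>
        ennreal (r\<^sup>2 / (4 * pi)) * (ennreal (2 * pi) * dini_integral r) + ennreal (energy_error r R) * mass" .
  qed
  also have "\<dots> = (ennreal (r\<^sup>2 / (4 * pi)) * ennreal (2 * pi)) * mass * dini_integral r + ennreal (energy_error r R) * mass * mass"
    by (simp add: distrib_right distrib_left mult_ac)
  also have "ennreal (r\<^sup>2 / (4 * pi)) * ennreal (2 * pi) = ennreal (r\<^sup>2 / 2)"
    by (subst ennreal_mult[symmetric]) auto
  finally show ?thesis .
qed

lemma trunc_velocity_averaged_differences: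
  assumes r: "r > 0" and R: "4 * r \<le> R"
  shows "(\<integral>\<^sup>+h\<in>ball 0 r. (\<integral>\<^sup>+x. ennreal ((norm (trunc_velocity R (x + h) - trunc_velocity R x))\<^sup>2) \<partial>lborel) \<partial>lborel)
    \<le> ennreal (r\<^sup>2) * mass * dini_integral r + ennreal (2 * energy_error r R) * mass * mass"
proof -
  have "(\<integral>\<^sup>+x. ennreal ((norm (trunc_velocity R x))\<^sup>2) \<partial>lborel) \<le> (\<integral>\<^sup>+x. (abs_potential R x)\<^sup>2 \<partial>lborel)"
    by (intro nn_integral_mono) (simp add: power_mono norm_trunc_velocity_le flip: ennreal_power)
  also have "\<dots> < \<infinity>" by (rule nn_integral_abs_potential_square)
  finally have "(\<integral>\<^sup>+h\<in>ball 0 r. (\<integral>\<^sup>+x. ennreal ((norm (trunc_velocity R (x + h) - trunc_velocity R x))\<^sup>2) \<partial>lborel) \<partial>lborel) =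
      ennreal (2 * (\<integral>x. trunc_velocity R x \<bullet> (LINT h:ball 0 r|lborel. trunc_velocity R x - trunc_velocity R (x + h)) \<partial>lborel))"
    using emeasure_lborel_ball_finite[of "0 :: real ^ 2" r]
    by (intro averaged_difference_identity) auto
  also have "(\<integral>x. trunc_velocity R x \<bullet> (LINT h:ball 0 r|lborel. trunc_velocity R x - trunc_velocity R (x + h)) \<partial>lborel) =
      (\<integral>x. trunc_velocity R x \<bullet> diff_velocity R r x \<partial>lborel)"
  proof (intro integral_cong_AE)
    show "AE x in lborel. trunc_velocity R x \<bullet> (LINT h:ball 0 r|lborel. trunc_velocity R x - trunc_velocity R (x + h)) =
        trunc_velocity R x \<bullet> diff_velocity R r x"
      using AE_abs_potential_finite[of R] r R
      by (auto simp: averaged_trunc_velocity)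
  qed (unfold set_lebesgue_integral_def, measurable)
  also have "ennreal (2 * (\<integral>x. trunc_velocity R x \<bullet> diff_velocity R r x \<partial>lborel)) \<le>
      2 * ennreal \<bar>\<integral>x. trunc_velocity R x \<bullet> diff_velocity R r x \<partial>lborel\<bar>"
    by (simp add: ennreal_leI flip: ennreal_mult'' ennreal_numeral)
  also have "\<dots> \<le> 2 * (ennreal (r\<^sup>2 / 2) * mass * dini_integral r + ennreal (energy_error r R) * mass * mass)"
    by (intro mult_left_mono trunc_energy_le r R) auto
  also have "\<dots> = (2 * ennreal (r\<^sup>2 / 2)) * mass * dini_integral r + (2 * ennreal (energy_error r R)) * mass * mass"
    by (simp add: distrib_left mult.assoc)
  also have "2 * ennreal (r\<^sup>2 / 2) = ennreal (r\<^sup>2)"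
    by (simp flip: ennreal_mult'' ennreal_numeral)
  also have "2 * ennreal (energy_error r R) = ennreal (2 * energy_error r R)"
    by (subst ennreal_mult') auto
  finally show ?thesis .
qed

section \<open>Removal of the cutoff\<close>

definition velocity :: "real ^ 2 \<Rightarrow> real ^ 2" where
  "velocity x = (\<integral>y. \<sigma> y *\<^sub>R biot_savart_kernel (x - y) \<partial>\<mu>)"

lemma measurable_velocity [measurable (raw)]:
  assumes "f \<in> borel_measurable M"
  shows "(\<lambda>x. velocity (f x)) \<in> borel_measurable M"
proof -
  have "velocity \<in> borel_measurable borel" unfolding velocity_def by measurable
  from measurable_compose[OF assms this] show ?thesis .
qed

lemma norm_kernel_diff_trunc_le:
  assumes "R > 0"
  shows "norm (biot_savart_kernel v - trunc_kernel R v) \<le> 1 / (2 * pi * R)"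
proof (cases "norm v < R")
  case False
  then have "1 / (2 * pi * norm v) \<le> 1 / (2 * pi * R)"
    using assms by (intro divide_left_mono) (auto intro!: mult_pos_pos)
  then show ?thesis using False by (simp add: trunc_kernel_def norm_kernel)
qed (use assms in \<open>simp add: trunc_kernel_def\<close>)

text \<open>The kernel is split at distance 1; beyond it K is at most 1 / (2 \<pi>) < 1, so the far
  part costs no more than the total mass.\<close>

lemma nn_integral_kernel_le:
  "(\<integral>\<^sup>+y. ennreal (norm (biot_savart_kernel (x - y))) \<partial>\<mu>) \<le> abs_potential 1 x + mass"
proof -
  have "(\<integral>\<^sup>+y. ennreal (norm (biot_savart_kernel (x - y))) \<partial>\<mu>) \<le> (\<integral>\<^sup>+y. ennreal (norm (trunc_kernel 1 (x - y))) + 1 \<partial>\<mu>)"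
  proof (intro nn_integral_mono)
    fix y
    have "norm (biot_savart_kernel (x - y)) \<le> norm (trunc_kernel 1 (x - y)) + norm (biot_savart_kernel (x - y) - trunc_kernel 1 (x - y))"
      by norm
    also have "\<dots> \<le> norm (trunc_kernel 1 (x - y)) + 1"
      using norm_kernel_diff_trunc_le[of 1 "x - y"] pi_gt3 by (auto intro: order_trans)
    finally show "ennreal (norm (biot_savart_kernel (x - y))) \<le> ennreal (norm (trunc_kernel 1 (x - y))) + 1"
      by (simp add: ennreal_leI flip: ennreal_plus ennreal_1)
  qed
  also have "\<dots> = abs_potential 1 x + mass"
    unfolding abs_potential_def by (simp add: nn_integral_add)
  finally show ?thesis .
qed

lemma AE_integrable_kernel: "AE x in lborel. integrable \<mu> (\<lambda>y. biot_savart_kernel (x - y))"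
  using AE_abs_potential_finite[of 1]
proof eventually_elim
  fix x assume "abs_potential 1 x < \<infinity>"
  then show "integrable \<mu> (\<lambda>y. biot_savart_kernel (x - y))"
    using nn_integral_kernel_le[of x] mass_finite
    by (intro integrableI_bounded) (auto intro: order_le_less_trans simp: ennreal_add_eq_top)
qed

lemma norm_velocity_le: "ennreal (norm (velocity x)) \<le> abs_potential 1 x + mass"
proof -
  have "ennreal (norm (velocity x)) \<le> (\<integral>\<^sup>+y. ennreal (norm (\<sigma> y *\<^sub>R biot_savart_kernel (x - y))) \<partial>\<mu>)"
    unfolding velocity_def by (rule ennreal_norm_integral_le)
  also have "\<dots> \<le> (\<integral>\<^sup>+y. ennreal (norm (biot_savart_kernel (x - y))) \<partial>\<mu>)"
    by (intro nn_integral_mono ennreal_leI sigma_scaleR_le)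
  also note nn_integral_kernel_le
  finally show ?thesis .
qed

lemma locally_integrable_velocity: "locally_integrable velocity"
  unfolding locally_integrable_def set_integrable_def
proof (intro allI impI integrableI_bounded)
  fix C :: "(real ^ 2) set" assume C: "compact C"
  then have [measurable]: "C \<in> sets borel" by (simp add: borel_compact)
  show "(\<lambda>x. indicator C x *\<^sub>R velocity x) \<in> borel_measurable lborel" by measurable
  have "(\<integral>\<^sup>+x. ennreal (norm (indicator C x *\<^sub>R velocity x)) \<partial>lborel) \<le> (\<integral>\<^sup>+x. abs_potential 1 x + mass * indicator C x \<partial>lborel)"
    using norm_velocity_le by (intro nn_integral_mono) (auto split: split_indicator)
  also have "\<dots> = ennreal 1 * mass + mass * emeasure lborel C"
    by (simp add: nn_integral_add nn_integral_abs_potential nn_integral_cmult)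
  also have "\<dots> < \<infinity>"
    using mass_finite emeasure_compact_finite[OF C] by (simp add: ennreal_mult_less_top)
  finally show "(\<integral>\<^sup>+x. ennreal (norm (indicator C x *\<^sub>R velocity x)) \<partial>lborel) < \<infinity>" .
qed


lemma trunc_velocity_tendsto:
  assumes i: "integrable \<mu> (\<lambda>y. biot_savart_kernel (x - y))"
  shows "(\<lambda>n. trunc_velocity (real (Suc n)) x) \<longlonglongrightarrow> velocity x"
  unfolding trunc_velocity_def velocity_def
proof (rule integral_dominated_convergence[where w = "\<lambda>y. norm (biot_savart_kernel (x - y))"])
  show "integrable \<mu> (\<lambda>y. norm (biot_savart_kernel (x - y)))" by (rule integrable_norm[OF i])
  show "AE y in \<mu>. (\<lambda>n. \<sigma> y *\<^sub>R trunc_kernel (real (Suc n)) (x - y)) \<longlonglongrightarrow> \<sigma> y *\<^sub>R biot_savart_kernel (x - y)"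
  proof (intro AE_I2 tendsto_scaleR tendsto_const tendsto_eventually)
    fix y
    obtain N :: nat where "norm (x - y) < real N" using reals_Archimedean2 by blast
    then have "trunc_kernel (real (Suc n)) (x - y) = biot_savart_kernel (x - y)" if "n \<ge> N" for n
      using that by (simp add: trunc_kernel_def)
    then show "\<forall>\<^sub>F n in sequentially. trunc_kernel (real (Suc n)) (x - y) = biot_savart_kernel (x - y)"
      by (auto simp: eventually_sequentially)
  qed
  show "AE y in \<mu>. norm (\<sigma> y *\<^sub>R trunc_kernel (real (Suc n)) (x - y)) \<le> norm (biot_savart_kernel (x - y))" for n
    using order_trans[OF sigma_scaleR_le] by (intro AE_I2) (auto simp: trunc_kernel_def)
qed measurable

lemma energy_error_tendsto: "(\<lambda>n. energy_error r (real (Suc n))) \<longlonglongrightarrow> 0"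
  unfolding energy_error_def by real_asymp

text \<open>For fixed h, almost every x has an integrable kernel at both x and x + h, and there the
  truncated differences converge. Fatou is then needed twice, for the integral in x and for the one
  in h.\<close>

lemma velocity_averaged_differences:
  assumes r: "r > 0"
  shows "(\<integral>\<^sup>+h\<in>ball 0 r. (\<integral>\<^sup>+x. ennreal ((norm (velocity (x + h) - velocity x))\<^sup>2) \<partial>lborel) \<partial>lborel)
    \<le> ennreal (r\<^sup>2) * mass * dini_integral r"
proof -
  let ?g = "\<lambda>n h x. ennreal ((norm (trunc_velocity (real (Suc n)) (x + h) - trunc_velocity (real (Suc n)) x))\<^sup>2)"
  let ?b = "\<lambda>n. ennreal (r\<^sup>2) * mass * dini_integral r + ennreal (2 * energy_error r (real (Suc n))) * mass * mass"
  have "(\<integral>\<^sup>+h\<in>ball 0 r. (\<integral>\<^sup>+x. ennreal ((norm (velocity (x + h) - velocity x))\<^sup>2) \<partial>lborel) \<partial>lborel) \<le>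
      (\<integral>\<^sup>+h. liminf (\<lambda>n. (\<integral>\<^sup>+x. ?g n h x \<partial>lborel) * indicator (ball 0 r) h) \<partial>lborel)"
  proof (intro nn_integral_mono)
    fix h :: "real ^ 2"
    have "AE x in lborel. integrable \<mu> (\<lambda>y. biot_savart_kernel (h + x - y))"
      by (rule AE_translate[OF AE_integrable_kernel])
    then have "AE x in lborel. ennreal ((norm (velocity (x + h) - velocity x))\<^sup>2) = liminf (\<lambda>n. ?g n h x)"
      using AE_integrable_kernel
    proof eventually_elim
      fix x assume 1: "integrable \<mu> (\<lambda>y. biot_savart_kernel (h + x - y))"
        and 2: "integrable \<mu> (\<lambda>y. biot_savart_kernel (x - y))"
      have "(\<lambda>n. ?g n h x) \<longlonglongrightarrow> ennreal ((norm (velocity (x + h) - velocity x))\<^sup>2)"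
        using trunc_velocity_tendsto[OF 1] trunc_velocity_tendsto[OF 2]
        by (intro tendsto_ennrealI tendsto_power tendsto_norm tendsto_diff) (simp_all add: add.commute)
      then show "ennreal ((norm (velocity (x + h) - velocity x))\<^sup>2) = liminf (\<lambda>n. ?g n h x)"
        by (rule lim_imp_Liminf[OF sequentially_bot, symmetric])
    qed
    then have "(\<integral>\<^sup>+x. ennreal ((norm (velocity (x + h) - velocity x))\<^sup>2) \<partial>lborel) = (\<integral>\<^sup>+x. liminf (\<lambda>n. ?g n h x) \<partial>lborel)"
      by (rule nn_integral_cong_AE)
    also have "\<dots> \<le> liminf (\<lambda>n. \<integral>\<^sup>+x. ?g n h x \<partial>lborel)"
      by (rule nn_integral_liminf) measurable
    finally show "(\<integral>\<^sup>+x. ennreal ((norm (velocity (x + h) - velocity x))\<^sup>2) \<partial>lborel) * indicator (ball 0 r) h \<le>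
        liminf (\<lambda>n. (\<integral>\<^sup>+x. ?g n h x \<partial>lborel) * indicator (ball 0 r) h)"
      by (cases "h \<in> ball 0 r") auto
  qed
  also have "\<dots> \<le> liminf (\<lambda>n. \<integral>\<^sup>+h\<in>ball 0 r. (\<integral>\<^sup>+x. ?g n h x \<partial>lborel) \<partial>lborel)"
    by (rule nn_integral_liminf) measurable
  also have "\<dots> \<le> liminf ?b"
  proof (rule Liminf_mono)
    obtain N :: nat where N: "4 * r < real N" using reals_Archimedean2 by blast
    show "\<forall>\<^sub>F n in sequentially. (\<integral>\<^sup>+h\<in>ball 0 r. (\<integral>\<^sup>+x. ?g n h x \<partial>lborel) \<partial>lborel) \<le> ?b n"
      using eventually_ge_at_top[of N]
      by eventually_elim (use N r in \<open>intro trunc_velocity_averaged_differences, auto\<close>)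
  qed
  also have "liminf ?b = ennreal (r\<^sup>2) * mass * dini_integral r"
  proof (rule lim_imp_Liminf[OF sequentially_bot])
    have "(\<lambda>n. ennreal (2 * energy_error r (real (Suc n)))) \<longlonglongrightarrow> ennreal (2 * 0)"
      by (intro tendsto_ennrealI tendsto_mult tendsto_const energy_error_tendsto)
    \<comment> \<open>Finiteness of the total mass is essential here: it keeps the product of the
      vanishing error with \<open>mass * mass\<close> convergent to 0.\<close>
    then have "(\<lambda>n. ennreal (2 * energy_error r (real (Suc n))) * (mass * mass)) \<longlonglongrightarrow> 0"
      using mass_finite ennreal_tendsto_cmult[of "mass * mass" "\<lambda>n. ennreal (2 * energy_error r (real (Suc n)))" "ennreal (2 * 0)" sequentially]
      by (simp add: mult.commute ennreal_mult_less_top)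
    then have "?b \<longlonglongrightarrow> ennreal (r\<^sup>2) * mass * dini_integral r + 0"
      by (intro tendsto_add tendsto_const) (simp add: mult.assoc)
    then show "?b \<longlonglongrightarrow> ennreal (r\<^sup>2) * mass * dini_integral r" by simp
  qed
  finally show ?thesis .
qed

section \<open>Divergence and curl of the velocity\<close>

text \<open>Reduces both distributional identities to the kernel: \<open>h\<close> is the gradient
  for the divergence and its image under \<open>perp\<close> for the curl. The bounded support of
  \<open>h\<close> restricts the far field of K to a disc of finite area, which justifies
  Fubini.\<close>

lemma integral_velocity_inner:
  fixes h :: "real ^ 2 \<Rightarrow> real ^ 2"
  assumes [measurable]: "h \<in> borel_measurable borel"
    and h_le: "\<And>x. norm (h x) \<le> B" and h0: "\<And>x. norm x \<ge> R \<Longrightarrow> h x = 0"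
  shows "(\<integral>x. velocity x \<bullet> h x \<partial>lborel) = (\<integral>y. \<sigma> y * (\<integral>x. biot_savart_kernel x \<bullet> h (x + y) \<partial>lborel) \<partial>\<mu>)"
proof -
  interpret Q: pair_sigma_finite "lborel :: (real ^ 2) measure" \<mu> ..
  have "B \<ge> 0" using order_trans[OF norm_ge_zero h_le] .
  define f where "f x y = (\<sigma> y *\<^sub>R biot_savart_kernel (x - y)) \<bullet> h x" for x y
  have [measurable]: "(\<lambda>p. f (fst p) (snd p)) \<in> borel_measurable (lborel \<Otimes>\<^sub>M \<mu>)"
    unfolding f_def by measurable
  have int_f: "integrable (lborel \<Otimes>\<^sub>M \<mu>) (\<lambda>(x, y). f x y)"
  proof (rule integrableI_bounded)
    have "(\<integral>\<^sup>+p. ennreal (norm (case p of (x, y) \<Rightarrow> f x y)) \<partial>(lborel \<Otimes>\<^sub>M \<mu>)) = (\<integral>\<^sup>+x. \<integral>\<^sup>+y. ennreal \<bar>f x y\<bar> \<partial>\<mu> \<partial>lborel)"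
      by (subst nn_integral_fst_mu[symmetric]) (auto simp: case_prod_beta')
    also have "\<dots> \<le> (\<integral>\<^sup>+x. ennreal B * (abs_potential 1 x + mass * indicator (ball 0 R) x) \<partial>lborel)"
    proof (intro nn_integral_mono)
      fix x :: "real ^ 2"
      show "(\<integral>\<^sup>+y. ennreal \<bar>f x y\<bar> \<partial>\<mu>) \<le> ennreal B * (abs_potential 1 x + mass * indicator (ball 0 R) x)"
      proof (cases "norm x < R")
        case True
        have "(\<integral>\<^sup>+y. ennreal \<bar>f x y\<bar> \<partial>\<mu>) \<le> (\<integral>\<^sup>+y. ennreal B * ennreal (norm (biot_savart_kernel (x - y))) \<partial>\<mu>)"
        proof (intro nn_integral_mono)
          fix y
          have "\<bar>f x y\<bar> \<le> norm (\<sigma> y *\<^sub>R biot_savart_kernel (x - y)) * norm (h x)"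
            unfolding f_def by (rule Cauchy_Schwarz_ineq2)
          also have "\<dots> \<le> norm (biot_savart_kernel (x - y)) * B"
            by (intro mult_mono sigma_scaleR_le h_le) auto
          finally show "ennreal \<bar>f x y\<bar> \<le> ennreal B * ennreal (norm (biot_savart_kernel (x - y)))"
            using \<open>B \<ge> 0\<close> by (subst ennreal_mult[symmetric]) (auto intro: ennreal_leI simp: mult.commute)
        qed
        also have "\<dots> = ennreal B * (\<integral>\<^sup>+y. ennreal (norm (biot_savart_kernel (x - y))) \<partial>\<mu>)"
          by (intro nn_integral_cmult) measurable
        also have "\<dots> \<le> ennreal B * (abs_potential 1 x + mass * indicator (ball 0 R) x)"
          using nn_integral_kernel_le[of x] True by (intro mult_left_mono) auto
        finally show ?thesis .
      next
        case False
        then show ?thesis by (simp add: f_def h0)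
      qed
    qed
    also have "\<dots> = ennreal B * (ennreal 1 * mass + mass * emeasure lborel (ball (0 :: real ^ 2) R))"
      by (simp add: nn_integral_cmult nn_integral_add nn_integral_abs_potential)
    also have "\<dots> < \<infinity>"
      using mass_finite emeasure_lborel_ball_finite[of "0 :: real ^ 2" R] by (simp add: ennreal_mult_less_top)
    finally show "(\<integral>\<^sup>+p. ennreal (norm (case p of (x, y) \<Rightarrow> f x y)) \<partial>(lborel \<Otimes>\<^sub>M \<mu>)) < \<infinity>" .
  qed (simp add: case_prod_beta')
  have "AE x in lborel. velocity x \<bullet> h x = (\<integral>y. f x y \<partial>\<mu>)"
    using AE_integrable_kernel
  proof eventually_elim
    fix x assume i: "integrable \<mu> (\<lambda>y. biot_savart_kernel (x - y))"
    have "integrable \<mu> (\<lambda>y. \<sigma> y *\<^sub>R biot_savart_kernel (x - y))"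
      by (rule Bochner_Integration.integrable_bound[OF i]) (auto intro!: AE_I2 sigma_scaleR_le simp del: norm_scaleR)
    then show "velocity x \<bullet> h x = (\<integral>y. f x y \<partial>\<mu>)"
      unfolding velocity_def f_def by (subst integral_inner_left) auto
  qed
  then have "(\<integral>x. velocity x \<bullet> h x \<partial>lborel) = (\<integral>x. (\<integral>y. f x y \<partial>\<mu>) \<partial>lborel)"
    by (intro integral_cong_AE) measurable
  also have "\<dots> = (\<integral>y. (\<integral>x. f x y \<partial>lborel) \<partial>\<mu>)"
    using Q.Fubini_integral[OF int_f] by simp
  also have "(\<lambda>y. \<integral>x. f x y \<partial>lborel) = (\<lambda>y. \<sigma> y * (\<integral>x. biot_savart_kernel x \<bullet> h (x + y) \<partial>lborel))"
  proof
    fix y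
    have "(\<integral>x. f x y \<partial>lborel) = (\<integral>x. f (x + y) y \<partial>lborel)"
      by (rule integral_translate[symmetric]) (simp add: f_def)
    then show "(\<integral>x. f x y \<partial>lborel) = \<sigma> y * (\<integral>x. biot_savart_kernel x \<bullet> h (x + y) \<partial>lborel)"
      by (simp add: f_def)
  qed
  finally show ?thesis .
qed

lemma distr_div_velocity:
  assumes "test_function \<phi>"
  shows "distr_div velocity \<phi> = 0"
proof -
  obtain \<rho> where "test_field \<phi> (gradient \<phi>) \<rho>" using test_field_gradient[OF assms] ..
  then interpret test_field \<phi> "gradient \<phi>" \<rho> .
  obtain B where B: "B > 0" "\<And>x. norm (gradient \<phi> x) \<le> B" using g_bounded by blast
  have "(\<integral>x. velocity x \<bullet> gradient \<phi> x \<partial>lborel) = 0"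
    by (subst integral_velocity_inner[of _ B \<rho>]) (auto simp: integral_kernel_gradient B rho)
  then show ?thesis by (simp add: distr_div_eq)
qed

text \<open>The minus sign of the distributional pairing cancels the one in
  \<open>integral_kernel_perp_gradient\<close>.\<close>

lemma distr_curl_velocity:
  assumes "test_function \<phi>"
  shows "distr_curl velocity \<phi> = (\<integral>y. \<sigma> y * \<phi> y \<partial>\<mu>)"
proof -
  obtain \<rho> where "test_field \<phi> (gradient \<phi>) \<rho>" using test_field_gradient[OF assms] ..
  then interpret test_field \<phi> "gradient \<phi>" \<rho> .
  obtain B where B: "B > 0" "\<And>x. norm (gradient \<phi> x) \<le> B" using g_bounded by blast
  have [measurable]: "(\<lambda>x. perp (gradient \<phi> x)) \<in> borel_measurable borel"
    by (rule measurable_compose[OF _ measurable_perp]) measurable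
  have "(\<integral>x. velocity x \<bullet> perp (gradient \<phi> x) \<partial>lborel) = (\<integral>y. \<sigma> y * - \<phi> y \<partial>\<mu>)"
    by (subst integral_velocity_inner[of _ B \<rho>]) (auto simp: integral_kernel_perp_gradient B rho)
  then show ?thesis by (simp add: distr_curl_eq)
qed

lemma integrable_test_function:
  assumes "test_function \<phi>"
  shows "integrable \<mu> \<phi>"
proof -
  obtain \<rho> where "test_field \<phi> (gradient \<phi>) \<rho>" using test_field_gradient[OF assms] ..
  then interpret test_field \<phi> "gradient \<phi>" \<rho> .
  have cont: "continuous_on UNIV \<phi>"
    using deriv by (auto intro!: continuous_at_imp_continuous_on has_derivative_continuous)
  have "compact (\<phi> ` cball 0 \<rho>)"
    by (intro compact_continuous_image continuous_on_subset[OF cont]) auto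
  then obtain B where B: "B > 0" "\<And>x. x \<in> cball 0 \<rho> \<Longrightarrow> norm (\<phi> x) \<le> B"
    using compact_imp_bounded[THEN bounded_pos[THEN iffD1]] by (metis imageI)
  have "norm (\<phi> x) \<le> B" for x
    using B rho(2)[of x] by (cases "norm x \<le> \<rho>") auto
  moreover have "\<phi> \<in> borel_measurable \<mu>"
    using borel_measurable_continuous_onI[OF cont] by simp
  ultimately show ?thesis
    by (intro integrable_const_bound[of _ B]) auto
qed

end

section \<open>From the density representation back to the signed measure\<close>

theorem theorem2p13:
  fixes \<omega> :: "(real ^ 2) set \<Rightarrow> real" and u :: "real ^ 2 \<Rightarrow> real ^ 2"
  assumes "finite_signed_measure \<omega>"
    and "(\<integral>\<^sup>+ s \<in> {0<..1}. vorticity_maximal \<omega> s / ennreal s \<partial>lborel) < \<infinity>"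
    and "u = biot_savart \<omega>"
  shows "(AE x in lborel. signed_integrable \<omega> (\<lambda>y. biot_savart_kernel (x - y)))
    \<and> locally_integrable u
    \<and> (\<forall>\<phi>. test_function \<phi> \<longrightarrow> distr_div u \<phi> = 0)
    \<and> (\<forall>\<phi>. test_function \<phi> \<longrightarrow> distr_curl u \<phi> = signed_integral \<omega> \<phi>)
    \<and> (\<forall>r>0.
          (1 / emeasure lborel (ball (0 :: real ^ 2) r)) *
          (\<integral>\<^sup>+ h \<in> ball 0 r. (\<integral>\<^sup>+ x. ennreal ((norm (u (x + h) - u x))\<^sup>2) \<partial>lborel) \<partial>lborel)
          \<le> total_variation_norm \<omega> *
            (\<integral>\<^sup>+ s \<in> {0<..r}. vorticity_maximal \<omega> s / ennreal s \<partial>lborel))"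
proof -
  interpret S: signed_measure \<omega> by (rule signed_measure.intro[OF assms(1)])
  let ?V = "variation \<omega>"
  obtain p n where pn: "p \<in> borel_measurable borel" "\<And>y. 0 \<le> p y" "\<And>y. p y \<le> 1"
    "positive_variation \<omega> = density ?V (\<lambda>x. ennreal (p x))"
    "n \<in> borel_measurable borel" "\<And>y. 0 \<le> n y" "\<And>y. n y \<le> 1"
    "negative_variation \<omega> = density ?V (\<lambda>x. ennreal (n x))"
    by (rule S.half_variation_densities) blast
  define \<sigma> where "\<sigma> y = p y - n y" for y
  have \<sigma>: "\<sigma> \<in> borel_measurable borel" "\<bar>\<sigma> y\<bar> \<le> 1" for y
    using pn(1,5) pn(2,3,6,7)[of y] by (auto simp: \<sigma>_def[abs_def] abs_le_iff)
  note rep = S.signed_integral_density[OF pn, folded \<sigma>_def]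
  have mono: "mono (vorticity_maximal \<omega>)"
    unfolding mono_def vorticity_maximal_def
    by (intro allI impI SUP_mono' emeasure_mono) auto
  have le: "vorticity_maximal \<omega> s \<le> emeasure ?V UNIV" for s
    unfolding vorticity_maximal_def by (intro SUP_least emeasure_mono) auto
  interpret vorticity ?V \<sigma> "vorticity_maximal \<omega>"
  proof (intro vorticity.intro vorticity_axioms.intro S.finite_measure_variation)
    \<comment> \<open>A supremum over uncountably many centres. Its measurability comes from
      monotonicity in the radius, applied to real values, which is possible because the variation is
      finite.\<close>
    show "vorticity_maximal \<omega> \<in> borel_measurable borel"
    proof -
      have fin: "vorticity_maximal \<omega> s < top" for s
        using order_le_less_trans[OF le] finite_measure.emeasure_finite[OF S.finite_measure_variation]
        by (metis infinity_ennreal_def top.not_eq_extremum)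
      then have "mono (\<lambda>s. enn2real (vorticity_maximal \<omega> s))"
        using mono by (intro monoI enn2real_mono) (auto dest: monoD)
      then have "(\<lambda>s. ennreal (enn2real (vorticity_maximal \<omega> s))) \<in> borel_measurable borel"
        by (intro measurable_compose[OF borel_measurable_mono measurable_ennreal])
      then show ?thesis using fin by (simp add: ennreal_enn2real)
    qed
    show "emeasure ?V (cball x s) \<le> vorticity_maximal \<omega> s" for x s
      unfolding vorticity_maximal_def by (rule SUP_upper) simp
    show "vorticity_maximal \<omega> s \<le> emeasure ?V UNIV" for s by (rule le)
  qed (use \<sigma> assms(2) in auto)
  \<comment> \<open>The density representation applies where the kernel is integrable; elsewhere the
    Bochner integrals over the two halves may take default values of their own.\<close>
  have AE_u: "AE x in lborel. u x = velocity x"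
    using AE_integrable_kernel by eventually_elim (simp add: assms(3) biot_savart_def velocity_def rep)
  have AE_uh: "AE x in lborel. u (x + h) = velocity (x + h)" for h
    using AE_translate[OF AE_u, of h] by (simp add: add.commute)
  \<comment> \<open>Agreement with \<open>velocity\<close> almost everywhere does not give Borel
    measurability, as \<open>lborel\<close> is not complete. It is derived from the two parametrised
    integrals that define \<open>u\<close>.\<close>
  have u_meas [measurable]: "u \<in> borel_measurable borel"
  proof -
    interpret P: finite_measure "positive_variation \<omega>" by (rule S.finite_half_variations)
    interpret N: finite_measure "negative_variation \<omega>" by (rule S.finite_half_variations)
    have "(\<lambda>x. \<integral>y. biot_savart_kernel (x - y) \<partial>positive_variation \<omega>) \<in> borel_measurable borel"
      by (rule P.borel_measurable_lebesgue_integral) measurable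
    moreover have "(\<lambda>x. \<integral>y. biot_savart_kernel (x - y) \<partial>negative_variation \<omega>) \<in> borel_measurable borel"
      by (rule N.borel_measurable_lebesgue_integral) measurable
    ultimately show ?thesis
      unfolding assms(3) biot_savart_def[abs_def] signed_integral_def by (rule borel_measurable_diff)
  qed
  have vel_meas: "velocity \<in> borel_measurable borel"
    by measurable
  have "AE x in lborel. signed_integrable \<omega> (\<lambda>y. biot_savart_kernel (x - y))"
    using AE_integrable_kernel by (simp add: signed_integrable_def)
  moreover have "locally_integrable u"
    unfolding locally_integrable_def
  proof (intro allI impI)
    fix C :: "(real ^ 2) set" assume C: "compact C"
    then have [measurable]: "C \<in> sets borel" by (simp add: borel_compact)
    have "set_integrable lborel C velocity"
      using locally_integrable_velocity C by (simp add: locally_integrable_def)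
    then show "set_integrable lborel C u"
      unfolding set_integrable_def
      by (rule integrable_cong_AE_imp) (use AE_u in \<open>measurable, auto\<close>)
  qed
  moreover have "distr_div u \<phi> = 0" if "test_function \<phi>" for \<phi>
    using distr_div_cong_AE[OF that u_meas vel_meas AE_u] distr_div_velocity[OF that] by simp
  moreover have "distr_curl u \<phi> = signed_integral \<omega> \<phi>" if "test_function \<phi>" for \<phi>
    using distr_curl_cong_AE[OF that u_meas vel_meas AE_u] distr_curl_velocity[OF that]
      rep[OF integrable_test_function[OF that]] by simp
  moreover have "(1 / emeasure lborel (ball (0 :: real ^ 2) r)) *
      (\<integral>\<^sup>+ h \<in> ball 0 r. (\<integral>\<^sup>+ x. ennreal ((norm (u (x + h) - u x))\<^sup>2) \<partial>lborel) \<partial>lborel)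
      \<le> total_variation_norm \<omega> * (\<integral>\<^sup>+ s \<in> {0<..r}. vorticity_maximal \<omega> s / ennreal s \<partial>lborel)"
    if r: "r > 0" for r
  proof -
    have "(\<integral>\<^sup>+ x. ennreal ((norm (u (x + h) - u x))\<^sup>2) \<partial>lborel) = (\<integral>\<^sup>+ x. ennreal ((norm (velocity (x + h) - velocity x))\<^sup>2) \<partial>lborel)" for h
    proof (rule nn_integral_cong_AE)
      show "AE x in lborel. ennreal ((norm (u (x + h) - u x))\<^sup>2) = ennreal ((norm (velocity (x + h) - velocity x))\<^sup>2)"
        using AE_u AE_uh[of h] by eventually_elim simp
    qed
    then have "(1 / emeasure lborel (ball (0 :: real ^ 2) r)) *
        (\<integral>\<^sup>+ h \<in> ball 0 r. (\<integral>\<^sup>+ x. ennreal ((norm (u (x + h) - u x))\<^sup>2) \<partial>lborel) \<partial>lborel) \<le>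
        ennreal (1 / (pi * r\<^sup>2)) * (ennreal (r\<^sup>2) * mass * dini_integral r)"
      using velocity_averaged_differences[OF r] r
      by (simp add: emeasure_ball_real2 divide_ennreal mult_left_mono flip: ennreal_1)
    \<comment> \<open>The factor r^2 of the energy bound cancels against the area \<pi> r^2; what
      remains is bounded by 1 in the next line.\<close>
    also have "\<dots> = ennreal (1 / pi) * (mass * dini_integral r)"
      using r by (simp add: mult.assoc[symmetric]) (simp add: field_simps flip: ennreal_mult)
    also have "\<dots> \<le> ennreal 1 * (mass * dini_integral r)"
      using pi_gt3 by (intro mult_right_mono ennreal_leI) (auto simp: field_simps)
    finally show ?thesis by (simp add: total_variation_norm_def dini_integral_def)
  qed
  ultimately show ?thesis by blast
qed

end
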